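(* Let $D\ge3$ and $0<r<1/2$. Put $g=1-2r$ and $q=\lfloor 1/g\rfloor+1$. There are constants $0<c_{D,r}<C_{D,r}<\infty$ such that, for all sufficiently large $n$, $$\frac{c_{D,r}}n\le\mathbb P\bigl(G_D(n;r)\models\Theta_q(1,\dots,q)\bigr)\le\frac{C_{D,r}}n,$$ where $\Theta_q$ is the first-order formula defined in the context.
   Context: Let $\mathbb T^D=(\mathbb R/\mathbb Z)^D$, with torus $L^\infty$ metric $d_\infty(x,y)=\max_{1\le i\le D}\|x_i-y_i\|_{\mathbb T}$, where $\|t\|_{\mathbb T}=\min_{m\in\mathbb Z}|t-m|$. Let $X_1,\dots,X_n$ be independent uniform random points of $\mathbb T^D$. For $0\le r\le1/2$, $G_D(n;r)$ is the simple (loopless) graph on $[n]=\{1,\dots,n\}$ in which distinct $i,j$ are adjacent iff $d_\infty(X_i,X_j)\le r$. Put $M_D=2^{D-2}+1$. For vertices $x_1,\dots,x_q$ of a graph, $\Theta_q(x_1,\dots,x_q)$ says that $x_1,\dots,x_q$ are distinct, that they have exactly $M_D$ common neighbors (vertices adjacent to all of $x_1,\dots,x_q$), and that these common neighbors are pairwise non-adjacent. As a first-order formula with edge relation $E$: $$\Theta_q(x_1,\dots,x_q)=\Bigl(\bigwedge_{1\le a<b\le q}x_a\ne x_b\Bigr)\wedge\exists z_1\cdots\exists z_{M_D}\Bigl[\bigwedge_{i=1}^{M_D}\bigwedge_{a=1}^qE(z_i,x_a)\wedge\bigwedge_{1\le i<j\le M_D}(z_i\ne z_j\wedge\neg E(z_i,z_j))\wedge\forall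 z\Bigl(\bigl(\bigwedge_{a=1}^qE(z,x_a)\bigr)\to\bigvee_{i=1}^{M_D}z=z_i\Bigr)\Bigr].$$ $\Theta_q(1,\dots,q)$ means the formula evaluated at the vertices $1,\dots,q\in[n]$. *)

theory Defs
  imports "HOL-Probability.Probability"
begin

section \<open>The torus\<close>

definition circle_norm :: "real \<Rightarrow> real" where
  "circle_norm t = (INF m::int. \<bar>t - of_int m\<bar>)"

text \<open>The infimum is a minimum.\<close>

lemma circle_norm_eq_round: "circle_norm t = \<bar>t - of_int (round t)\<bar>"
  unfolding circle_norm_def
proof (rule antisym)
  have "bdd_below (range (\<lambda>m::int. \<bar>t - of_int m\<bar>))"
    by (rule bdd_belowI[of _ 0]) auto
  then show "(INF m::int. \<bar>t - of_int m\<bar>) \<le> \<bar>t - of_int (round t)\<bar>"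
    by (rule cINF_lower) simp
  show "\<bar>t - of_int (round t)\<bar> \<le> (INF m::int. \<bar>t - of_int m\<bar>)"
    by (rule cINF_greatest) (auto simp: round_diff_minimal)
qed

lemma circle_norm_add_int: "circle_norm (t + of_int k) = circle_norm t"
proof -
  have "circle_norm (t + of_int k) = (INF m::int. \<bar>t - of_int (m - k)\<bar>)"
    unfolding circle_norm_def by (intro INF_cong refl arg_cong[where f = abs]) auto
  also have "\<dots> = Inf ((\<lambda>m::int. \<bar>t - of_int m\<bar>) ` range (\<lambda>m. m - k))"
    by (simp only: image_image)
  also have "range (\<lambda>m. m - k) = (UNIV :: int set)"
    by (rule surj_def[THEN iffD2]) (metis add_diff_cancel)
  finally show ?thesis by (simp add: circle_norm_def)
qed

quotient_type circle = real / "\<lambda>s t :: real. s - t \<in> \<int>"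
proof (rule equivpI)
  show "reflp (\<lambda>s t :: real. s - t \<in> \<int>)" by (simp add: reflp_def)
  show "symp (\<lambda>s t :: real. s - t \<in> \<int>)"
    by (auto simp: symp_def) (metis Ints_minus minus_diff_eq)
  show "transp (\<lambda>s t :: real. s - t \<in> \<int>)"
    by (auto simp: transp_def) (metis Ints_add diff_add_cancel add_diff_eq)
qed

lift_definition circle_dist :: "circle \<Rightarrow> circle \<Rightarrow> real" is "\<lambda>s t. circle_norm (s - t)"
proof -
  fix s s' t t' :: real
  assume "s - s' \<in> \<int>" "t - t' \<in> \<int>"
  then obtain k l :: int where kl: "s = s' + of_int k" "t = t' + of_int l"
    by (auto elim!: Ints_cases simp: algebra_simps)
  have "s - t = (s' - t') + of_int (k - l)" using kl by simp
  then show "circle_norm (s - t) = circle_norm (s' - t')"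
    by (simp only: circle_norm_add_int)
qed

text \<open>
  The Borel sigma-algebra of the quotient topology on the circle, and the uniform (Haar)
  probability measure, i.e. the image of Lebesgue measure on the fundamental domain.
\<close>

definition circle_borel :: "circle measure" where
  "circle_borel = sigma UNIV {U. open (abs_circle -` U)}"

definition circle_uniform :: "circle measure" where
  "circle_uniform = distr (uniform_measure lborel {0..<1}) circle_borel abs_circle"

text \<open>A point of the \<open>D\<close>-dimensional torus is an extensional function on \<open>{1..D}\<close>.\<close>

definition torus_uniform :: "nat \<Rightarrow> (nat \<Rightarrow> circle) measure" where
  "torus_uniform D = (\<Pi>\<^sub>M i\<in>{1..D}. circle_uniform)"

definition torus_dist :: "nat \<Rightarrow> (nat \<Rightarrow> circle) \<Rightarrow> (nat \<Rightarrow> circle) \<Rightarrow> real" where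
  "torus_dist D x y = Max ((\<lambda>i. circle_dist (x i) (y i)) ` {1..D})"

text \<open>The joint law of \<open>n\<close> independent uniform points; the \<open>i\<close>-th point is the \<open>i\<close>-th coordinate.\<close>

definition torus_sample :: "nat \<Rightarrow> nat \<Rightarrow> (nat \<Rightarrow> nat \<Rightarrow> circle) measure" where
  "torus_sample D n = (\<Pi>\<^sub>M i\<in>{1..n}. torus_uniform D)"

lemma prob_space_circle_uniform: "prob_space circle_uniform"
proof -
  have "abs_circle \<in> borel \<rightarrow>\<^sub>M circle_borel"
    unfolding circle_borel_def by (rule measurable_measure_of) auto
  then have "abs_circle \<in> uniform_measure lborel {0..<1} \<rightarrow>\<^sub>M circle_borel" by simp
  then show ?thesis
    unfolding circle_uniform_def
    by (intro prob_space.prob_space_distr prob_space_uniform_measure) auto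
qed

lemma prob_space_torus_uniform: "prob_space (torus_uniform D)"
  unfolding torus_uniform_def by (intro prob_space_PiM prob_space_circle_uniform)

lemma prob_space_torus_sample: "prob_space (torus_sample D n)"
  unfolding torus_sample_def by (intro prob_space_PiM prob_space_torus_uniform)

lemma torus_sample_independent_uniform:
  assumes "n \<ge> 1"
  shows "prob_space.indep_vars (torus_sample D n) (\<lambda>_. torus_uniform D) (\<lambda>i X. X i) {1..n}"
    and "\<forall>i\<in>{1..n}. distr (torus_sample D n) (torus_uniform D) (\<lambda>X. X i) = torus_uniform D"
proof -
  have D: "distr (torus_sample D n) (torus_uniform D) (\<lambda>X. X i) = torus_uniform D"
    if "i \<in> {1..n}" for i
    using distr_PiM_component[of "{1..n}" "\<lambda>_. torus_uniform D" i] that prob_space_torus_uniform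
    by (simp add: torus_sample_def)
  then show "\<forall>i\<in>{1..n}. distr (torus_sample D n) (torus_uniform D) (\<lambda>X. X i) = torus_uniform D"
    by blast
  have "distr (torus_sample D n) (\<Pi>\<^sub>M i\<in>{1..n}. torus_uniform D) (\<lambda>X. \<lambda>i\<in>{1..n}. X i)
      = distr (torus_sample D n) (torus_sample D n) (\<lambda>X. X)"
    by (rule distr_cong) (auto simp: torus_sample_def space_PiM PiE_def extensional_restrict)
  also have "\<dots> = (\<Pi>\<^sub>M i\<in>{1..n}. distr (torus_sample D n) (torus_uniform D) (\<lambda>X. X i))"
    unfolding distr_id by (subst torus_sample_def, intro PiM_cong refl) (simp add: D)
  finally show "prob_space.indep_vars (torus_sample D n) (\<lambda>_. torus_uniform D) (\<lambda>i X. X i) {1..n}"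
    using assms
    by (subst prob_space.indep_vars_iff_distr_eq_PiM'[OF prob_space_torus_sample])
       (auto simp: torus_sample_def)
qed

section \<open>First-order logic of graphs\<close>

text \<open>A graph is given by its vertex set and its adjacency relation.\<close>

type_synonym 'v graph = "'v set \<times> ('v \<Rightarrow> 'v \<Rightarrow> bool)"

definition torus_graph :: "nat \<Rightarrow> nat \<Rightarrow> real \<Rightarrow> (nat \<Rightarrow> nat \<Rightarrow> circle) \<Rightarrow> nat graph" where
  "torus_graph D n r X =
     ({1..n}, \<lambda>i j. i \<in> {1..n} \<and> j \<in> {1..n} \<and> i \<noteq> j \<and> torus_dist D (X i) (X j) \<le> r)"

datatype formula =
    Eq nat nat
  | Edge nat nat
  | Neg formula
  | Conj "formula list"
  | Disj "formula list"
  | Imp formula formula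
  | Exists nat formula
  | Forall nat formula

fun models :: "'v graph \<Rightarrow> (nat \<Rightarrow> 'v) \<Rightarrow> formula \<Rightarrow> bool" where
  "models G v (Eq x y) \<longleftrightarrow> v x = v y"
| "models G v (Edge x y) \<longleftrightarrow> snd G (v x) (v y)"
| "models G v (Neg \<phi>) \<longleftrightarrow> \<not> models G v \<phi>"
| "models G v (Conj \<phi>s) \<longleftrightarrow> (\<forall>\<phi>\<in>set \<phi>s. models G v \<phi>)"
| "models G v (Disj \<phi>s) \<longleftrightarrow> (\<exists>\<phi>\<in>set \<phi>s. models G v \<phi>)"
| "models G v (Imp \<phi> \<psi>) \<longleftrightarrow> (models G v \<phi> \<longrightarrow> models G v \<psi>)"
| "models G v (Exists x \<phi>) \<longleftrightarrow> (\<exists>a\<in>fst G. models G (v(x := a)) \<phi>)"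
| "models G v (Forall x \<phi>) \<longleftrightarrow> (\<forall>a\<in>fst G. models G (v(x := a)) \<phi>)"

text \<open>
  The free variables \<open>x\<^sub>1, \<dots>, x\<^sub>q\<close> of \<open>\<Theta>\<^sub>q\<close> are the variables \<open>1, \<dots>, q\<close>; the bound variables
  \<open>z\<^sub>1, \<dots>, z\<^sub>M\<close> are \<open>q + 1, \<dots>, q + M\<close>, and \<open>z\<close> is \<open>q + M + 1\<close>, where \<open>M = 2 ^ (D - 2) + 1\<close>.
\<close>

definition M_dim :: "nat \<Rightarrow> nat" where
  "M_dim D = 2 ^ (D - 2) + 1"

definition Theta :: "nat \<Rightarrow> nat \<Rightarrow> formula" where
  "Theta D q = (let M = M_dim D; xs = [1..<q + 1]; zs = [q + 1..<q + M + 1]; z = q + M + 1 in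
     Conj [
       Conj [Neg (Eq a b). a \<leftarrow> xs, b \<leftarrow> xs, a < b],
       foldr Exists zs (Conj [
         Conj [Edge c a. c \<leftarrow> zs, a \<leftarrow> xs],
         Conj [Conj [Neg (Eq c d), Neg (Edge c d)]. c \<leftarrow> zs, d \<leftarrow> zs, c < d],
         Forall z (Imp (Conj [Edge z a. a \<leftarrow> xs]) (Disj [Eq z c. c \<leftarrow> zs]))])])"

lemma models_Exists_upt:
  "models G v (foldr Exists [l..<u] \<phi>) \<longleftrightarrow>
     (\<exists>w. (\<forall>c\<in>{l..<u}. w c \<in> fst G) \<and> (\<forall>c. c \<notin> {l..<u} \<longrightarrow> w c = v c) \<and> models G w \<phi>)"
proof (induction "u - l" arbitrary: l v)
  case 0
  then have "w = v" if "\<forall>c. c \<notin> {l..<u} \<longrightarrow> w c = v c" for w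
    using that by auto
  with 0 show ?case by auto
next
  case (Suc k)
  then have lu: "l < u" "k = u - Suc l" by auto
  have IH: "models G v' (foldr Exists [Suc l..<u] \<phi>) \<longleftrightarrow>
     (\<exists>w. (\<forall>c\<in>{Suc l..<u}. w c \<in> fst G) \<and> (\<forall>c. c \<notin> {Suc l..<u} \<longrightarrow> w c = v' c) \<and> models G w \<phi>)"
    for v' using Suc(1)[OF lu(2)] .
  have "models G v (foldr Exists [l..<u] \<phi>) \<longleftrightarrow>
      (\<exists>a\<in>fst G. \<exists>w. (\<forall>c\<in>{Suc l..<u}. w c \<in> fst G) \<and>
         (\<forall>c. c \<notin> {Suc l..<u} \<longrightarrow> w c = (v(l := a)) c) \<and> models G w \<phi>)"
    using lu(1) by (simp add: upt_conv_Cons IH del: upt_Suc)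
  also have "\<dots> \<longleftrightarrow> (\<exists>w. (\<forall>c\<in>{l..<u}. w c \<in> fst G) \<and> (\<forall>c. c \<notin> {l..<u} \<longrightarrow> w c = v c) \<and> models G w \<phi>)"
    (is "?L \<longleftrightarrow> ?R")
  proof
    assume ?L
    then obtain a w where w: "a \<in> fst G" "\<forall>c\<in>{Suc l..<u}. w c \<in> fst G"
      "\<forall>c. c \<notin> {Suc l..<u} \<longrightarrow> w c = (v(l := a)) c" "models G w \<phi>" by blast
    have "w l = a" using w(3) by simp
    then have "\<forall>c\<in>{l..<u}. w c \<in> fst G" using w(1,2)
      by (metis atLeastLessThan_iff le_antisym not_less_eq_eq)
    moreover have "\<forall>c. c \<notin> {l..<u} \<longrightarrow> w c = v c" using w(3) lu(1) by auto
    ultimately show ?R using w(4) by blast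
  next
    assume ?R
    then obtain w where w: "\<forall>c\<in>{l..<u}. w c \<in> fst G" "\<forall>c. c \<notin> {l..<u} \<longrightarrow> w c = v c" "models G w \<phi>"
      by blast
    have "\<forall>c. c \<notin> {Suc l..<u} \<longrightarrow> w c = (v(l := w l)) c" using w(2) by auto
    moreover have "\<forall>c\<in>{Suc l..<u}. w c \<in> fst G" using w(1) by simp
    moreover have "w l \<in> fst G" using w(1) lu(1) by simp
    ultimately show ?L using w(3) by blast
  qed
  finally show ?case .
qed

text \<open>The verbal description of \<open>\<Theta>\<^sub>q\<close>.\<close>

lemma models_Theta_iff:
  fixes G :: "'v graph" and v :: "nat \<Rightarrow> 'v" and D q :: nat
  defines "N \<equiv> {w \<in> fst G. \<forall>a\<in>{1..q}. snd G w (v a)}"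
  assumes sym: "\<And>u w. snd G u w \<Longrightarrow> snd G w u" and irr: "\<And>u. \<not> snd G u u"
  shows "models G v (Theta D q) \<longleftrightarrow>
    inj_on v {1..q} \<and> card N = M_dim D \<and> (\<forall>u\<in>N. \<forall>w\<in>N. \<not> snd G u w)"
proof -
  define M where "M = M_dim D"
  define Z where "Z = {q + 1..<q + M + 1}"
  have M: "M > 0" by (simp add: M_def M_dim_def)
  have sets: "set [1..<q + 1] = {1..q}" "set [q + 1..<q + M + 1] = Z" unfolding Z_def by auto
  have A: "(\<forall>a\<in>{1..q}. \<forall>b\<in>{1..q}. a < b \<longrightarrow> v a \<noteq> v b) \<longleftrightarrow> inj_on v {1..q}"
    unfolding inj_on_def by (metis linorder_neqE_nat less_irrefl)
  have "models G v (Theta D q) \<longleftrightarrow> inj_on v {1..q} \<and>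
     (\<exists>w. (\<forall>c\<in>Z. w c \<in> fst G) \<and> (\<forall>c. c \<notin> Z \<longrightarrow> w c = v c) \<and>
        (\<forall>c\<in>Z. \<forall>a\<in>{1..q}. snd G (w c) (w a)) \<and>
        (\<forall>c\<in>Z. \<forall>d\<in>Z. c < d \<longrightarrow> w c \<noteq> w d \<and> \<not> snd G (w c) (w d)) \<and>
        (\<forall>b\<in>fst G. (\<forall>a\<in>{1..q}. snd G b (w a)) \<longrightarrow> (\<exists>c\<in>Z. b = w c)))"
    (is "_ \<longleftrightarrow> _ \<and> (\<exists>w. ?P w)")
  proof -
    have zn: "q + M + 1 \<notin> Z" "q + M + 1 \<notin> {1..q}" by (auto simp: Z_def)
    have upd: "(w(q + M + 1 := b)) c = w c" if "c \<in> Z \<or> c \<in> {1..q}" for w :: "nat \<Rightarrow> 'v" and b c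
      using that zn by auto
    have ball_concat: "(\<forall>\<phi>\<in>set (concat (map f l)). P \<phi>) \<longleftrightarrow> (\<forall>a\<in>set l. \<forall>\<phi>\<in>set (f a). P \<phi>)"
      for f :: "nat \<Rightarrow> formula list" and l P by auto
    have ball_map: "(\<forall>\<phi>\<in>set (map f l). P \<phi>) \<longleftrightarrow> (\<forall>a\<in>set l. P (f a))"
      for f :: "nat \<Rightarrow> formula" and l P by auto
    have ball_if: "(\<forall>\<phi>\<in>set (if b then [\<psi>] else []). P \<phi>) \<longleftrightarrow> (b \<longrightarrow> P \<psi>)"
      for b :: bool and \<psi> :: formula and P by auto
    have C1: "models G u (Conj [Neg (Eq a b). a \<leftarrow> [1..<q + 1], b \<leftarrow> [1..<q + 1], a < b]) \<longleftrightarrow>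
        (\<forall>a\<in>{1..q}. \<forall>b\<in>{1..q}. a < b \<longrightarrow> u a \<noteq> u b)" for u
      by (simp only: models.simps ball_concat ball_map ball_if sets list.set Set.ball_simps simp_thms)
    have C2: "models G u (Conj [Edge c a. c \<leftarrow> [q + 1..<q + M + 1], a \<leftarrow> [1..<q + 1]]) \<longleftrightarrow>
        (\<forall>c\<in>Z. \<forall>a\<in>{1..q}. snd G (u c) (u a))" for u
      by (simp only: models.simps ball_concat ball_map ball_if sets list.set Set.ball_simps simp_thms)
    have C3: "models G u (Conj [Conj [Neg (Eq c d), Neg (Edge c d)].
          c \<leftarrow> [q + 1..<q + M + 1], d \<leftarrow> [q + 1..<q + M + 1], c < d]) \<longleftrightarrow>
        (\<forall>c\<in>Z. \<forall>d\<in>Z. c < d \<longrightarrow> u c \<noteq> u d \<and> \<not> snd G (u c) (u d))" for u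
      by (simp only: models.simps ball_concat ball_map ball_if sets list.set Set.ball_simps simp_thms)
    have C4: "models G u (Forall (q + M + 1) (Imp (Conj [Edge (q + M + 1) a. a \<leftarrow> [1..<q + 1]])
          (Disj [Eq (q + M + 1) c. c \<leftarrow> [q + 1..<q + M + 1]]))) \<longleftrightarrow>
        (\<forall>b\<in>fst G. (\<forall>a\<in>{1..q}. snd G b (u a)) \<longrightarrow> (\<exists>c\<in>Z. b = u c))" for u
      unfolding models.simps set_map sets Set.ball_simps bex_simps
      by (intro ball_cong refl) (simp only: Set.bex_simps models.simps upd fun_upd_same simp_thms cong: ball_cong bex_cong)
    have split: "models G v (Theta D q) \<longleftrightarrow>
       (\<forall>a\<in>{1..q}. \<forall>b\<in>{1..q}. a < b \<longrightarrow> v a \<noteq> v b) \<and> (\<exists>w. ?P w)"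
      unfolding Theta_def Let_def M_def[symmetric] models.simps(4)[of _ _ "[_, _]"]
        models.simps(4)[of _ _ "[_, _, _]"] list.set
      by (simp only: Set.ball_simps C1 C2 C3 C4 models_Exists_upt Z_def[symmetric]
          models.simps(4)[of _ _ "[_, _, _]"] list.set simp_thms)
    then show ?thesis unfolding A .
  qed
  also have "\<dots> \<longleftrightarrow> inj_on v {1..q} \<and> card N = M \<and> (\<forall>u\<in>N. \<forall>w\<in>N. \<not> snd G u w)"
  proof (rule conj_cong[OF refl], rule iffI)
    assume "\<exists>w. ?P w"
    then obtain w where w: "?P w" by blast
    have wv: "w a = v a" if "a \<in> {1..q}" for a using w that by (auto simp: Z_def)
    have N: "N = w ` Z" using w wv by (auto simp: N_def)
    have "inj_on w Z" using w unfolding inj_on_def by (metis linorder_neqE_nat)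
    then have "card N = M" unfolding N by (simp add: card_image Z_def)
    moreover have "\<forall>c\<in>Z. \<forall>d\<in>Z. \<not> snd G (w c) (w d)"
      using w sym irr by (metis linorder_neqE_nat)
    ultimately show "card N = M \<and> (\<forall>u\<in>N. \<forall>w\<in>N. \<not> snd G u w)" unfolding N by blast
  next
    assume R: "card N = M \<and> (\<forall>u\<in>N. \<forall>w\<in>N. \<not> snd G u w)"
    then have "finite N" using M by (metis card.infinite less_irrefl)
    moreover have "finite Z" "card Z = card N" using R by (auto simp: Z_def)
    ultimately obtain h where h: "bij_betw h Z N" using finite_same_card_bij by blast
    define w where "w = (\<lambda>c. if c \<in> Z then h c else v c)"
    have wZ: "w c = h c" if "c \<in> Z" for c using that by (simp add: w_def)
    have wv: "w a = v a" if "a \<in> {1..q}" for a using that by (auto simp: w_def Z_def)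
    have hN: "h c \<in> N" if "c \<in> Z" for c using h that by (auto simp: bij_betw_def)
    have hinj: "h c \<noteq> h d" if "c \<in> Z" "d \<in> Z" "c < d" for c d
      using h that by (auto simp: bij_betw_def inj_on_def)
    have hsurj: "\<exists>c\<in>Z. b = h c" if "b \<in> N" for b
      using h that by (auto simp: bij_betw_def)
    have "\<forall>c\<in>Z. h c \<in> fst G \<and> (\<forall>a\<in>{1..q}. snd G (h c) (v a))"
      using hN unfolding N_def by blast
    moreover have "\<forall>b\<in>fst G. (\<forall>a\<in>{1..q}. snd G b (v a)) \<longrightarrow> (\<exists>c\<in>Z. b = h c)"
      using hsurj unfolding N_def by blast
    moreover have "\<forall>c. c \<notin> Z \<longrightarrow> w c = v c" by (simp add: w_def)
    moreover have "\<forall>c\<in>Z. \<forall>d\<in>Z. c < d \<longrightarrow> h c \<noteq> h d \<and> \<not> snd G (h c) (h d)"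
      using hinj hN R by blast
    ultimately have "?P w" by (simp add: wZ wv)
    then show "\<exists>w. ?P w" by blast
  qed
  finally show ?thesis unfolding M_def .
qed

end

theory Submission
  imports Defs
begin

text \<open>
  In each coordinate the points adjacent to \<open>1, \<dots>, q\<close> form the complement of \<open>q\<close> open arcs of length
  \<open>g\<close>, the common arc. It lies in an arc of length \<open>2 * r\<close> around any one of the \<open>q\<close> points, hence in a
  union of two cliques. If the common arcs of two coordinates were themselves cliques, a set of pairwise
  non-adjacent common neighbours would have at most \<open>2 ^ (D - 2) < M_dim D\<close> elements; so at most one
  coordinate can be thin. The number of common neighbours is binomial with mean about \<open>n * V\<close>, where
  \<open>V\<close> is the product of the lengths \<open>L\<close> of the common arcs, so that \<open>V\<close> has to be of order \<open>1 / n\<close>. A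
  common arc that is not empty satisfies \<open>L \<le> \<delta>\<close> with probability \<open>O(\<delta>)\<close>, which is where \<open>1 / n\<close> comes
  from, whereas one that is not a clique satisfies \<open>L \<le> \<delta>\<close> only with probability \<open>O(\<delta>\<^sup>2)\<close> (two different
  pairs of arcs nearly touch), so that \<open>1 / L\<close> is integrable and the other coordinates contribute a
  constant. Conversely, because \<open>q * g > 1\<close> the \<open>q\<close> arcs can cover the circle up to one gap of length of
  order \<open>1 / n\<close>, with probability of order \<open>1 / n\<close>; if the points are close together in all other
  coordinates, these offer \<open>2 ^ (D - 1) \<ge> M_dim D\<close> mutually distant boxes for the common neighbours.
\<close>

section \<open>The circle\<close>

text \<open>What the value of \<open>M_dim\<close> prevents is logarithms: two independent lengths,
  each at most \<delta> with probability of order \<delta>, have a product below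
  \<open>1 / n\<close> with probability of order \<open>log n / n\<close>, so two thin coordinates
  at once would spoil the rate. For the same reason a single slack cannot control a wide arc, as the
  mean of \<open>1 / u\<close> diverges for a uniform slack \<open>u\<close>. Instead
  \<open>1 / L\<close> is bounded by products \<open>1 / sqrt u * (1 / sqrt v)\<close> of two
  slacks, which are independent when their index pairs differ as sets, so that the mean splits into
  two integrals of \<open>1 / sqrt t\<close>. A pair and its swap are dependent, but almost surely
  their slacks are not both small. For the thin coordinate the binomial weight is replaced by a
  decreasing function \<open>decay\<close>. Averaged over a uniform slack \<open>u\<close>,
  \<open>decay (w * u)\<close> is at most \<open>1 / w\<close>; with \<open>w = n * W\<close>, where
  \<open>W\<close> bounds the product of the other lengths from below, this leaves a mean of
  \<open>1 / W\<close>, which factors over the coordinates. To use independence of coordinates, the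
  centres, sampled point by point, are transposed into a family indexed by coordinates.\<close>

definition crep :: "circle \<Rightarrow> real" where
  "crep c = frac (rep_circle c)"

lemma abs_circle_eq_iff: "abs_circle s = abs_circle t \<longleftrightarrow> s - t \<in> \<int>"
  by (simp add: circle.abs_eq_iff)

lemma abs_crep [simp]: "abs_circle (crep c) = c"
proof -
  have "abs_circle (crep c) = abs_circle (rep_circle c)"
    unfolding crep_def abs_circle_eq_iff by (simp add: frac_def)
  then show ?thesis using Quotient3_abs_rep[OF Quotient3_circle] by simp
qed

text \<open>\<open>rep_circle\<close> is an unspecified choice of representative; taking its
  fractional part pins it down, which makes this equation provable.\<close>

lemma crep_abs: "crep (abs_circle t) = frac t"
proof -
  have "abs_circle (crep (abs_circle t)) = abs_circle t" by simp
  then have "crep (abs_circle t) - t \<in> \<int>" by (simp only: abs_circle_eq_iff)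
  then obtain k where "crep (abs_circle t) = t + of_int k"
    by (auto elim!: Ints_cases simp: algebra_simps)
  moreover have "frac (crep (abs_circle t)) = crep (abs_circle t)"
    by (simp add: crep_def)
  ultimately show ?thesis by (metis frac_add_of_int_right)
qed

lemma circle_dist_crep: "circle_dist c d = circle_norm (crep c - crep d)"
  by (metis abs_crep circle_dist.abs_eq)

lemma circle_norm_le_iff: "circle_norm t \<le> r \<longleftrightarrow> (\<exists>k::int. \<bar>t - of_int k\<bar> \<le> r)"
  unfolding circle_norm_eq_round by (meson order_trans round_diff_minimal)

lemma circle_norm_minus: "circle_norm (- t) = circle_norm t"
proof (rule antisym)
  have le: "circle_norm (- s) \<le> circle_norm s" for s
  proof -
    have "\<bar>- s - of_int (- round s)\<bar> \<le> circle_norm s" unfolding circle_norm_eq_round by simp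
    then show ?thesis using circle_norm_le_iff by blast
  qed
  show "circle_norm (- t) \<le> circle_norm t" by (rule le)
  show "circle_norm t \<le> circle_norm (- t)" using le[of "- t"] by simp
qed

lemma circle_dist_commute: "circle_dist c d = circle_dist d c"
  unfolding circle_dist_crep by (metis circle_norm_minus minus_diff_eq)

text \<open>Membership in an arc becomes the existence of an integer shift, the form in which linear
  arithmetic can combine several arcs. The bound \<open>l < 1\<close> makes the shift
  unique.\<close>

lemma frac_le_iff:
  assumes "0 \<le> l" "l < 1"
  shows "frac t \<le> l \<longleftrightarrow> (\<exists>k::int. 0 \<le> t - of_int k \<and> t - of_int k \<le> l)"
proof
  assume "frac t \<le> l"
  then have "0 \<le> t - of_int \<lfloor>t\<rfloor> \<and> t - of_int \<lfloor>t\<rfloor> \<le> l" using frac_ge_0[of t] by (simp add: frac_def)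
  then show "\<exists>k::int. 0 \<le> t - of_int k \<and> t - of_int k \<le> l" by blast
next
  assume "\<exists>k::int. 0 \<le> t - of_int k \<and> t - of_int k \<le> l"
  then obtain k :: int where k: "0 \<le> t - of_int k" "t - of_int k \<le> l" by blast
  then have "frac t = t - of_int k" using assms unfolding frac_unique_iff by auto
  then show "frac t \<le> l" using k by simp
qed

lemma circle_dist_le_iff_frac:
  assumes "0 \<le> r" "r < 1/2"
  shows "circle_dist c d \<le> r \<longleftrightarrow> frac (crep c - crep d + r) \<le> 2 * r"
proof -
  have eq: "\<bar>t - of_int k\<bar> \<le> r \<longleftrightarrow> 0 \<le> (t + r) - of_int k \<and> (t + r) - of_int k \<le> 2 * r" for t and k :: int
    by auto
  show ?thesis
    unfolding circle_dist_crep circle_norm_le_iff eq using assms by (subst frac_le_iff) auto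
qed

section \<open>The Borel structure of the circle\<close>

lemma space_circle_borel [simp]: "space circle_borel = UNIV"
  by (simp add: circle_borel_def)

lemma sets_circle_uniform [simp, measurable_cong]: "sets circle_uniform = sets circle_borel"
  by (simp add: circle_uniform_def)

lemma space_circle_uniform [simp]: "space circle_uniform = UNIV"
  by (simp add: circle_uniform_def)

lemma measurable_abs_circle [measurable]: "abs_circle \<in> borel \<rightarrow>\<^sub>M circle_borel"
  unfolding circle_borel_def by (rule measurable_measure_of) auto

lemma open_frac_vimage: "open {t :: real. 0 < frac t \<and> frac t < a}"
proof -
  have "{t :: real. 0 < frac t \<and> frac t < a} = (\<Union>k::int. {of_int k <..< of_int k + min a 1})"
  proof (intro set_eqI iffI)
    fix t assume "t \<in> {t :: real. 0 < frac t \<and> frac t < a}"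
    then have "t \<in> {of_int \<lfloor>t\<rfloor> <..< of_int \<lfloor>t\<rfloor> + min a 1}"
      using frac_lt_1[of t] by (auto simp: frac_def)
    then show "t \<in> (\<Union>k::int. {of_int k <..< of_int k + min a 1})" by blast
  next
    fix t assume "t \<in> (\<Union>k::int. {of_int k <..< of_int k + min a 1})"
    then obtain k :: int where k: "of_int k < t" "t < of_int k + min a 1" by auto
    then have "frac t = t - of_int k" unfolding frac_unique_iff by auto
    then show "t \<in> {t :: real. 0 < frac t \<and> frac t < a}" using k by (auto simp del: frac_gt_0_iff)
  qed
  then show ?thesis by auto
qed

text \<open>\<open>crep\<close> jumps at the class of 0, so its sublevel sets need not be open. The
  arcs that avoid this class are open, and the class itself is the complement of the largest of
  them.\<close>

lemma measurable_crep [measurable]: "crep \<in> borel_measurable circle_borel"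
proof (rule borel_measurableI_less)
  have openI: "U \<in> sets circle_borel" if "open (abs_circle -` U)" for U
    unfolding circle_borel_def using that by (intro in_measure_of) auto
  have pos: "{c. 0 < crep c \<and> crep c < a} \<in> sets circle_borel" for a
    by (rule openI) (use open_frac_vimage[of a] in \<open>simp add: vimage_def crep_abs\<close>)
  have ge: "0 \<le> crep c" "crep c < 1" for c by (simp_all add: crep_def frac_lt_1)
  have "{c. crep c = 0} = space circle_borel - {c. 0 < crep c \<and> crep c < 1}"
    using ge by (auto simp: less_le)
  then have zero: "{c. crep c = 0} \<in> sets circle_borel" using pos by (metis sets.compl_sets)
  fix a
  have "{c \<in> space circle_borel. crep c < a} = (if a > 0 then {c. crep c = 0} \<union> {c. 0 < crep c \<and> crep c < a} else {})"
  proof (cases "a > 0")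
    case True
    have "0 < crep c \<or> crep c = 0" for c using ge(1)[of c] by linarith
    then show ?thesis using True by auto
  next
    case False
    have "\<not> crep c < a" for c using ge(1)[of c] False by linarith
    then show ?thesis using False by auto
  qed
  then show "{c \<in> space circle_borel. crep c < a} \<in> sets circle_borel" using pos zero by auto
qed

lemma measurable_frac [measurable]: "frac \<in> borel_measurable (borel :: real measure)"
  unfolding frac_def[abs_def] by measurable

section \<open>Integration over the circle, rotations and reflections\<close>

lemma nn_integral_circle_uniform:
  assumes [measurable]: "f \<in> borel_measurable circle_borel"
  shows "(\<integral>\<^sup>+c. f c \<partial>circle_uniform) = (\<integral>\<^sup>+t. f (abs_circle t) * indicator {0..<1} t \<partial>lborel)"
proof -
  have "(\<integral>\<^sup>+c. f c \<partial>circle_uniform) = (\<integral>\<^sup>+t. f (abs_circle t) \<partial>uniform_measure lborel {0..<1})"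
    unfolding circle_uniform_def by (subst nn_integral_distr) auto
  also have "\<dots> = (\<integral>\<^sup>+t. f (abs_circle t) * indicator {0..<1} t \<partial>lborel)"
    by (subst nn_integral_uniform_measure) (auto simp: divide_ennreal_def)
  finally show ?thesis .
qed

text \<open>An integer translation moves the window to one that starts in [0, 1); the part that
  sticks out beyond 1 is then moved back by one period.\<close>

lemma nn_integral_periodic:
  fixes h :: "real \<Rightarrow> ennreal"
  assumes [measurable]: "h \<in> borel_measurable borel" and per: "\<And>t. h (t + 1) = h t"
  shows "(\<integral>\<^sup>+t. h t * indicator {b..<b+1} t \<partial>lborel) = (\<integral>\<^sup>+t. h t * indicator {0..<1} t \<partial>lborel)"
proof -
  have per_int: "h (t + of_int k) = h t" for t and k :: int
  proof (induction k rule: int_induct[where k = 0])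
    case (step1 i) then show ?case using per[of "t + of_int i"] by (simp add: add.assoc)
  next
    case (step2 i) then show ?case using per[of "t + of_int (i - 1)"] by (simp add: add.assoc)
  qed simp
  define k where "k = \<lfloor>b\<rfloor>"
  define b' where "b' = frac b"
  have b': "b = b' + of_int k" "0 \<le> b'" "b' < 1"
    by (simp_all add: b'_def k_def frac_def) linarith
  have "(\<integral>\<^sup>+t. h t * indicator {b..<b+1} t \<partial>lborel)
      = (\<integral>\<^sup>+t. h t * indicator {b'..<b'+1} t \<partial>lborel)"
    by (subst nn_integral_real_affine[of _ 1 "of_int k"])
       (auto simp: b'(1) per_int[unfolded add.commute[of _ "of_int _"]] indicator_def intro!: nn_integral_cong)
  also have "\<dots> = (\<integral>\<^sup>+t. h t * indicator {b'..<1} t + h t * indicator {1..<b'+1} t \<partial>lborel)"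
    by (intro nn_integral_cong) (use b' in \<open>auto simp: indicator_def\<close>)
  also have "\<dots> = (\<integral>\<^sup>+t. h t * indicator {b'..<1} t \<partial>lborel) + (\<integral>\<^sup>+t. h t * indicator {1..<b'+1} t \<partial>lborel)"
    by (rule nn_integral_add) auto
  also have "(\<integral>\<^sup>+t. h t * indicator {1..<b'+1} t \<partial>lborel) = (\<integral>\<^sup>+t. h t * indicator {0..<b'} t \<partial>lborel)"
    by (subst nn_integral_real_affine[of _ 1 1])
       (auto simp: per[unfolded add.commute[of _ 1]] indicator_def intro!: nn_integral_cong)
  also have "(\<integral>\<^sup>+t. h t * indicator {b'..<1} t \<partial>lborel) + \<dots>
      = (\<integral>\<^sup>+t. h t * indicator {b'..<1} t + h t * indicator {0..<b'} t \<partial>lborel)"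
    by (rule nn_integral_add[symmetric]) auto
  also have "\<dots> = (\<integral>\<^sup>+t. h t * indicator {0..<1} t \<partial>lborel)"
    by (intro nn_integral_cong) (use b' in \<open>auto simp: indicator_def\<close>)
  finally show ?thesis .
qed

text \<open>Rotation invariance in the form needed for slacks: as a function of its second index a
  slack has this shape, as a function of its first index the reflected shape of the next
  lemma.\<close>

lemma nn_integral_frac_crep_diff:
  assumes [measurable]: "f \<in> borel_measurable borel"
  shows "(\<integral>\<^sup>+c. f (frac (crep c - b)) \<partial>circle_uniform) = (\<integral>\<^sup>+t. f t * indicator {0..<1} t \<partial>lborel)"
proof -
  have fr: "frac (frac t - b) = frac (t - b)" for t
    by (metis diff_conv_add_uminus frac_add_simps(1))
  have "(\<integral>\<^sup>+c. f (frac (crep c - b)) \<partial>circle_uniform)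
      = (\<integral>\<^sup>+t. f (frac (t - b)) * indicator {0..<1} t \<partial>lborel)"
    by (subst nn_integral_circle_uniform) (auto simp: crep_abs fr)
  also have "\<dots> = (\<integral>\<^sup>+t. f (frac t) * indicator {-b..<-b+1} t \<partial>lborel)"
    by (subst nn_integral_real_affine[of _ 1 "b", simplified])
       (auto simp: indicator_def intro!: nn_integral_cong)
  also have "\<dots> = (\<integral>\<^sup>+t. f (frac t) * indicator {0..<1} t \<partial>lborel)"
    by (rule nn_integral_periodic) (auto simp: frac_1_eq)
  also have "\<dots> = (\<integral>\<^sup>+t. f t * indicator {0..<1} t \<partial>lborel)"
    by (intro nn_integral_cong) (auto simp: indicator_def)
  finally show ?thesis .
qed

lemma nn_integral_frac_diff_crep:
  assumes [measurable]: "f \<in> borel_measurable borel"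
  shows "(\<integral>\<^sup>+c. f (frac (b - crep c)) \<partial>circle_uniform) = (\<integral>\<^sup>+t. f t * indicator {0..<1} t \<partial>lborel)"
proof -
  have fr: "frac (b - frac t) = frac (b - t)" for t by (rule frac_diff_simp)
  have "(\<integral>\<^sup>+c. f (frac (b - crep c)) \<partial>circle_uniform)
      = (\<integral>\<^sup>+t. f (frac (b - t)) * indicator {0..<1} t \<partial>lborel)"
    by (subst nn_integral_circle_uniform) (auto simp: crep_abs fr)
  also have "\<dots> = (\<integral>\<^sup>+t. f (frac t) * indicator {b-1<..b} t \<partial>lborel)"
    by (subst nn_integral_real_affine[of _ "-1" b, simplified])
       (auto simp: indicator_def intro!: nn_integral_cong)
  \<comment> \<open>The reflection has closed the other end of the window; the endpoints are a null
    set.\<close>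
  also have "\<dots> = (\<integral>\<^sup>+t. f (frac t) * indicator {b-1..<b-1+1} t \<partial>lborel)"
  proof (rule nn_integral_cong_AE)
    have "AE t in lborel. t \<noteq> b - 1" "AE t in lborel. t \<noteq> b" by (rule AE_lborel_singleton)+
    then show "AE t in lborel. f (frac t) * indicator {b-1<..b} t = f (frac t) * indicator {b-1..<b-1+1} t"
      by eventually_elim (auto simp: indicator_def)
  qed
  also have "\<dots> = (\<integral>\<^sup>+t. f (frac t) * indicator {0..<1} t \<partial>lborel)"
    by (rule nn_integral_periodic) (auto simp: frac_1_eq)
  also have "\<dots> = (\<integral>\<^sup>+t. f t * indicator {0..<1} t \<partial>lborel)"
    by (intro nn_integral_cong) (auto simp: indicator_def)
  finally show ?thesis .
qed

lemma emeasure_circle_arc: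
  assumes "0 \<le> l" "l < 1"
  shows "emeasure circle_uniform {c. frac (crep c - b) \<le> l} = ennreal l"
proof -
  have [measurable]: "{c. frac (crep c - b) \<le> l} \<in> sets circle_borel"
    using measurable_sets_Collect[of "\<lambda>c. frac (crep c - b) \<le> l" circle_borel] by simp
  have "emeasure circle_uniform {c. frac (crep c - b) \<le> l}
      = (\<integral>\<^sup>+c. indicator {..l} (frac (crep c - b)) \<partial>circle_uniform)"
    by (subst nn_integral_indicator[symmetric]) (auto intro!: nn_integral_cong simp del: nn_integral_indicator simp: indicator_def)
  also have "\<dots> = (\<integral>\<^sup>+t. indicator {..l} t * indicator {0..<1} t \<partial>lborel)"
    by (rule nn_integral_frac_crep_diff) auto
  also have "\<dots> = (\<integral>\<^sup>+t. indicator {0..l} t \<partial>lborel)"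
    by (intro nn_integral_cong) (use assms in \<open>auto simp: indicator_def\<close>)
  also have "\<dots> = ennreal l" using assms by simp
  finally show ?thesis .
qed

section \<open>Transposing iterated product measures\<close>

text \<open>The rows read disjoint sets of indices of one flat product, hence are independent. The
  labelling \<open>f\<close> is left general so that the same flat product can be curried in both
  orders.\<close>

lemma distr_PiM_curry:
  fixes M :: "'a measure" and f :: "'i \<Rightarrow> 'j \<Rightarrow> 'k"
  assumes M: "prob_space M" and I: "I \<noteq> {}" and J: "J \<noteq> {}"
    and f: "\<And>i j i' j'. i \<in> I \<Longrightarrow> j \<in> J \<Longrightarrow> i' \<in> I \<Longrightarrow> j' \<in> J \<Longrightarrow> f i j = f i' j' \<Longrightarrow> i = i' \<and> j = j'"
      "\<And>i j. i \<in> I \<Longrightarrow> j \<in> J \<Longrightarrow> f i j \<in> K"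
  shows "distr (PiM K (\<lambda>_. M)) (PiM I (\<lambda>_. PiM J (\<lambda>_. M))) (\<lambda>\<omega>. \<lambda>i\<in>I. \<lambda>j\<in>J. \<omega> (f i j))
      = PiM I (\<lambda>_. PiM J (\<lambda>_. M))"
proof -
  let ?\<Omega> = "PiM K (\<lambda>_. M)"
  interpret \<Omega>: prob_space ?\<Omega> by (intro prob_space_PiM M)
  have K: "K \<noteq> {}" using I J f(2) by blast
  have ind: "\<Omega>.indep_vars (\<lambda>_. PiM J (\<lambda>_. M)) (\<lambda>i \<omega>. \<lambda>j\<in>J. \<omega> (f i j)) I"
  proof -
    have "\<Omega>.indep_vars (\<lambda>_. M) (\<lambda>k \<omega>. \<omega> k) K"
    proof (subst \<Omega>.indep_vars_iff_distr_eq_PiM')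
      have "distr ?\<Omega> ?\<Omega> (\<lambda>\<omega>. \<lambda>k\<in>K. \<omega> k) = distr ?\<Omega> ?\<Omega> (\<lambda>\<omega>. \<omega>)"
        by (rule distr_cong) (auto simp: space_PiM PiE_def extensional_restrict)
      also have "\<dots> = ?\<Omega>" by simp
      also have "\<dots> = (\<Pi>\<^sub>M i\<in>K. distr ?\<Omega> M (\<lambda>\<omega>. \<omega> i))"
        by (intro PiM_cong) (auto simp: distr_PiM_component[where M = "\<lambda>_. M"] M)
      finally show "distr ?\<Omega> ?\<Omega> (\<lambda>\<omega>. \<lambda>k\<in>K. \<omega> k) = (\<Pi>\<^sub>M i\<in>K. distr ?\<Omega> M (\<lambda>\<omega>. \<omega> i))" .
    qed (use K in auto)
    then have "\<Omega>.indep_vars (\<lambda>i. PiM (f i ` J) (\<lambda>_. M)) (\<lambda>i \<omega>. restrict (\<lambda>k. \<omega> k) (f i ` J)) I"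
    proof (rule \<Omega>.indep_vars_restrict)
      show "f i ` J \<subseteq> K" if "i \<in> I" for i using f(2) that by blast
      show "disjoint_family_on (\<lambda>i. f i ` J) I"
        unfolding disjoint_family_on_def using f(1) by blast
    qed
    then have "\<Omega>.indep_vars (\<lambda>_. PiM J (\<lambda>_. M))
        (\<lambda>i \<omega>. (\<lambda>y. \<lambda>j\<in>J. y (f i j)) (restrict (\<lambda>k. \<omega> k) (f i ` J))) I"
      by (rule \<Omega>.indep_vars_compose2) (intro measurable_restrict measurable_component_singleton imageI)
    then show ?thesis
      by (rule \<Omega>.indep_vars_cong[THEN iffD1, rotated -1]) (auto simp: fun_eq_iff)
  qed
  have "distr ?\<Omega> (PiM I (\<lambda>_. PiM J (\<lambda>_. M))) (\<lambda>\<omega>. \<lambda>i\<in>I. \<lambda>j\<in>J. \<omega> (f i j)) =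
      PiM I (\<lambda>i. distr ?\<Omega> (PiM J (\<lambda>_. M)) (\<lambda>\<omega>. \<lambda>j\<in>J. \<omega> (f i j)))"
    using ind by (subst (asm) \<Omega>.indep_vars_iff_distr_eq_PiM') (use I f in auto)
  also have "\<dots> = PiM I (\<lambda>_. PiM J (\<lambda>_. M))"
  proof (intro PiM_cong refl)
    fix i assume "i \<in> I"
    then show "distr ?\<Omega> (PiM J (\<lambda>_. M)) (\<lambda>\<omega>. \<lambda>j\<in>J. \<omega> (f i j)) = PiM J (\<lambda>_. M)"
      by (intro distr_PiM_reindex M) (use f in \<open>auto simp: inj_on_def\<close>)
  qed
  finally show ?thesis .
qed

lemma measurable_component_component:
  assumes "i \<in> I" "j \<in> J"
  shows "(\<lambda>x. x i j) \<in> PiM I (\<lambda>_. PiM J M) \<rightarrow>\<^sub>M M j"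
  by (rule measurable_compose[OF measurable_component_singleton[OF assms(1)]
        measurable_component_singleton[OF assms(2)]])

text \<open>Both iterated products are images of the flat product over \<open>I \<times> J\<close>.
  This is what turns a sample of points into independent coordinates.\<close>

lemma distr_PiM_transpose:
  fixes M :: "'a measure"
  assumes M: "prob_space M" and I: "I \<noteq> {}" and J: "J \<noteq> {}"
  shows "distr (PiM I (\<lambda>_. PiM J (\<lambda>_. M))) (PiM J (\<lambda>_. PiM I (\<lambda>_. M))) (\<lambda>x. \<lambda>j\<in>J. \<lambda>i\<in>I. x i j)
      = PiM J (\<lambda>_. PiM I (\<lambda>_. M))"
proof -
  let ?\<Omega> = "PiM (I \<times> J) (\<lambda>_. M)"
  have "distr (PiM I (\<lambda>_. PiM J (\<lambda>_. M))) (PiM J (\<lambda>_. PiM I (\<lambda>_. M))) (\<lambda>x. \<lambda>j\<in>J. \<lambda>i\<in>I. x i j)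
    = distr (distr ?\<Omega> (PiM I (\<lambda>_. PiM J (\<lambda>_. M))) (\<lambda>\<omega>. \<lambda>i\<in>I. \<lambda>j\<in>J. \<omega> (i, j)))
        (PiM J (\<lambda>_. PiM I (\<lambda>_. M))) (\<lambda>x. \<lambda>j\<in>J. \<lambda>i\<in>I. x i j)"
    by (subst distr_PiM_curry[OF M I J]) auto
  also have "\<dots> = distr ?\<Omega> (PiM J (\<lambda>_. PiM I (\<lambda>_. M))) (\<lambda>\<omega>. \<lambda>j\<in>J. \<lambda>i\<in>I. \<omega> (i, j))"
  proof (subst distr_distr)
    show "(\<lambda>x. \<lambda>j\<in>J. \<lambda>i\<in>I. x i j) \<in> PiM I (\<lambda>_. PiM J (\<lambda>_. M)) \<rightarrow>\<^sub>M PiM J (\<lambda>_. PiM I (\<lambda>_. M))"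
      by (intro measurable_restrict measurable_component_component)
    show "(\<lambda>\<omega>. \<lambda>i\<in>I. \<lambda>j\<in>J. \<omega> (i, j)) \<in> ?\<Omega> \<rightarrow>\<^sub>M PiM I (\<lambda>_. PiM J (\<lambda>_. M))"
      by (intro measurable_restrict measurable_component_singleton SigmaI)
  qed (auto intro!: distr_cong simp: fun_eq_iff)
  also have "\<dots> = PiM J (\<lambda>_. PiM I (\<lambda>_. M))"
    by (rule distr_PiM_curry[OF M J I]) auto
  finally show ?thesis .
qed

section \<open>The common arc of finitely many points on the circle\<close>

definition common_arc :: "real \<Rightarrow> 'i set \<Rightarrow> ('i \<Rightarrow> circle) \<Rightarrow> circle set" where
  "common_arc r A x = {y. \<forall>a\<in>A. circle_dist y (x a) \<le> r}"

text \<open>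
  If \<open>x a\<close> and \<open>x b\<close> are the extreme centres seen from a point of the common arc, then the component of
  that point has length \<open>slack r x a b\<close>.
\<close>

definition slack :: "real \<Rightarrow> ('i \<Rightarrow> circle) \<Rightarrow> 'i \<Rightarrow> 'i \<Rightarrow> real" where
  "slack r x a b = frac (2 * r - (crep (x a) - crep (x b)))"

lemma slack_nonneg [simp]: "0 \<le> slack r x a b"
  by (simp add: slack_def)

lemma slack_self:
  assumes "0 \<le> r" "r < 1/2"
  shows "slack r x a a = 2 * r"
  using assms by (simp add: slack_def frac_eq)

lemma sets_common_arc:
  assumes "finite A" "0 \<le> r" "r < 1/2"
  shows "common_arc r A x \<in> sets circle_borel"
proof -
  have "Measurable.pred circle_borel (\<lambda>y. \<forall>a\<in>A. frac (crep y - crep (x a) + r) \<le> 2 * r)"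
    using assms(1) by measurable
  then have "{y \<in> space circle_borel. \<forall>a\<in>A. frac (crep y - crep (x a) + r) \<le> 2 * r} \<in> sets circle_borel"
    by (rule predE)
  then show ?thesis unfolding common_arc_def circle_dist_le_iff_frac[OF assms(2,3)] by simp
qed

lemma circle_dist_le_offset:
  assumes "circle_dist y c \<le> r"
  obtains t and k :: int where "\<bar>t\<bar> \<le> r" "crep c = crep y + t + of_int k"
proof -
  obtain k :: int where "\<bar>crep y - crep c - of_int k\<bar> \<le> r"
    using assms unfolding circle_dist_crep circle_norm_le_iff by blast
  then show ?thesis by (intro that[of "crep c - crep y + of_int k" "- k"]) auto
qed

lemma circle_dist_leI:
  fixes k :: int
  assumes "\<bar>crep y - crep c - of_int k\<bar> \<le> r"
  shows "circle_dist y c \<le> r"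
  using assms unfolding circle_dist_crep circle_norm_le_iff by blast

interpretation circle_uniform: prob_space circle_uniform
  by (rule prob_space_circle_uniform)

text \<open>Seen from \<open>p\<close>, every centre has an offset in \<open>[-r, r]\<close>;
  \<open>a\<close> and \<open>b\<close> are the indices of the largest and the smallest one. All
  points between \<open>t a - r\<close> and \<open>t b + r\<close> stay within \<open>r\<close> of
  every centre, and the length of this arc is the slack. The bounds on \<open>t\<close> locate
  \<open>p\<close> inside that arc, so that two points with the same extreme pair can be
  compared.\<close>

lemma slack_le_common_arc:
  assumes A: "finite A" "A \<noteq> {}" and r: "0 \<le> r" "r < 1/2" and p: "p \<in> common_arc r A x"
  obtains a b and t and k :: int where "a \<in> A" "b \<in> A"
    "slack r x a b \<le> measure circle_uniform (common_arc r A x)"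
    "crep (x a) = crep p + t + of_int k" "r - slack r x a b \<le> t" "t \<le> r"
proof -
  have "\<exists>t. \<exists>k::int. \<bar>t\<bar> \<le> r \<and> crep (x a) = crep p + t + of_int k" if "a \<in> A" for a
    using p that circle_dist_le_offset[of p "x a" r] unfolding common_arc_def by blast
  then obtain t and k :: "_ \<Rightarrow> int"
    where t: "\<And>a. a \<in> A \<Longrightarrow> \<bar>t a\<bar> \<le> r \<and> crep (x a) = crep p + t a + of_int (k a)" by metis
  have "Max (t ` A) \<in> t ` A" "Min (t ` A) \<in> t ` A" using A by auto
  then obtain a b where ab: "a \<in> A" "t a = Max (t ` A)" "b \<in> A" "t b = Min (t ` A)"
    by (metis imageE)
  then have a: "a \<in> A" "\<And>c. c \<in> A \<Longrightarrow> t c \<le> t a" and b: "b \<in> A" "\<And>c. c \<in> A \<Longrightarrow> t b \<le> t c"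
    using A(1) by auto
  define e where "e = 2 * r - (t a - t b)"
  have e: "0 \<le> e" "e \<le> 2 * r" using t[OF a(1)] t[OF b(1)] a(2)[OF b(1)] by (auto simp: e_def)
  have slack: "slack r x a b = e"
  proof -
    have "2 * r - (crep (x a) - crep (x b)) - e = of_int (k b - k a)"
      using t[OF a(1)] t[OF b(1)] by (simp add: e_def)
    then have "2 * r - (crep (x a) - crep (x b)) - e \<in> \<int>" by (metis Ints_of_int)
    then show ?thesis unfolding slack_def frac_unique_iff using e r by auto
  qed
  have sub: "{y. frac (crep y - (crep p + t a - r)) \<le> e} \<subseteq> common_arc r A x"
  proof
    fix y assume "y \<in> {y. frac (crep y - (crep p + t a - r)) \<le> e}"
    then obtain m :: int where m: "0 \<le> crep y - (crep p + t a - r) - of_int m"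
        "crep y - (crep p + t a - r) - of_int m \<le> e"
      using frac_le_iff[of e "crep y - (crep p + t a - r)"] e r by auto
    show "y \<in> common_arc r A x" unfolding common_arc_def
    proof (intro CollectI ballI)
      fix c assume c: "c \<in> A"
      show "circle_dist y (x c) \<le> r"
        by (rule circle_dist_leI[of _ _ "m - k c"])
           (use m t[OF c] a(2)[OF c] b(2)[OF c] in \<open>auto simp: e_def\<close>)
    qed
  qed
  have "ennreal e = emeasure circle_uniform {y. frac (crep y - (crep p + t a - r)) \<le> e}"
    by (rule emeasure_circle_arc[symmetric]) (use e r in auto)
  also have "\<dots> \<le> emeasure circle_uniform (common_arc r A x)"
    by (rule emeasure_mono[OF sub]) (use sets_common_arc A r in auto)
  finally have "e \<le> measure circle_uniform (common_arc r A x)"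
    by (simp add: circle_uniform.emeasure_eq_measure)
  with slack that[OF a(1) b(1), of "t a" "k a"] t[OF a(1)] t[OF b(1)] show ?thesis
    by (auto simp: e_def)
qed

text \<open>If \<open>p\<close> and \<open>p'\<close> had the same extreme pair, both offsets to
  \<open>x a\<close> would lie in \<open>[r - slack, r]\<close>, so the distance of \<open>p\<close>
  and \<open>p'\<close>, which exceeds \<open>r\<close>, would be at most the slack and hence at
  most \<open>L\<close>. If the extremes of one point coincide, the slack is
  \<open>2 * r\<close>.\<close>

lemma wide_common_arc_cases:
  assumes A: "finite A" "A \<noteq> {}" and r: "0 < r" "r < 1/2"
    and p: "p \<in> common_arc r A x" "p' \<in> common_arc r A x" "circle_dist p p' > r"
  defines "L \<equiv> measure circle_uniform (common_arc r A x)"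
  shows "r \<le> L \<or> (\<exists>a\<in>A. \<exists>b\<in>A. \<exists>a'\<in>A. \<exists>b'\<in>A. a \<noteq> b \<and> a' \<noteq> b' \<and> (a, b) \<noteq> (a', b') \<and>
    slack r x a b \<le> L \<and> slack r x a' b' \<le> L)"
proof (rule disjCI)
  assume L: "\<not> (\<exists>a\<in>A. \<exists>b\<in>A. \<exists>a'\<in>A. \<exists>b'\<in>A. a \<noteq> b \<and> a' \<noteq> b' \<and> (a, b) \<noteq> (a', b') \<and>
    slack r x a b \<le> L \<and> slack r x a' b' \<le> L)"
  from r have r': "0 \<le> r" "r < 1/2" by auto
  obtain a b t and k :: int where ab: "a \<in> A" "b \<in> A" "slack r x a b \<le> L"
    "crep (x a) = crep p + t + of_int k" "r - slack r x a b \<le> t" "t \<le> r"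
    using slack_le_common_arc[OF A r' p(1)] unfolding L_def by blast
  obtain a' b' t' and k' :: int where ab': "a' \<in> A" "b' \<in> A" "slack r x a' b' \<le> L"
    "crep (x a') = crep p' + t' + of_int k'" "r - slack r x a' b' \<le> t'" "t' \<le> r"
    using slack_le_common_arc[OF A r' p(2)] unfolding L_def by blast
  consider "a = b" | "a' = b'" | "a = a'" "b = b'" using L ab ab' by blast
  then show "r \<le> L"
  proof cases
    case 1 then show ?thesis using ab(3) slack_self[OF r', of x b] r by simp
  next
    case 2 then show ?thesis using ab'(3) slack_self[OF r', of x b'] r by simp
  next
    case 3
    have "circle_dist p p' \<le> slack r x a b"
      by (rule circle_dist_leI[of _ _ "k' - k"]) (use ab ab' 3 in auto)
    then show ?thesis using p(3) ab(3) by linarith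
  qed
qed

text \<open>The slacks of \<open>(a, b)\<close> and \<open>(b, a)\<close> add up to
  \<open>4 * r\<close> modulo 1. A positive sum is thus at least \<open>frac (4 * r)\<close>, or at
  least 1 if \<open>4 * r\<close> is an integer; the larger slack is at least half of that.\<close>

definition slack_bound :: "real \<Rightarrow> real" where
  "slack_bound r = (if frac (4 * r) = 0 then 1 else frac (4 * r)) / 2"

lemma slack_bound_pos: "slack_bound r > 0"
  unfolding slack_bound_def using frac_ge_0[of "4 * r"] by (auto simp: less_le simp del: frac_ge_0)

lemma slack_swap:
  assumes "slack r x a b > 0"
  shows "slack_bound r \<le> max (slack r x a b) (slack r x b a)"
proof -
  define u v where "u = slack r x a b" and "v = slack r x b a"
  have uv: "0 < u" "0 \<le> v" using assms by (auto simp: u_def v_def)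
  have "frac (u + v) = frac (4 * r)"
  proof -
    have "u - (2 * r - (crep (x a) - crep (x b))) \<in> \<int>" "v - (2 * r - (crep (x b) - crep (x a))) \<in> \<int>"
      by (simp_all add: u_def v_def slack_def frac_def)
    from Ints_add[OF this] have "u + v - 4 * r \<in> \<int>" by (simp add: algebra_simps)
    then show ?thesis
      by (metis diff_add_cancel frac_add_int_left)
  qed
  moreover have "frac (u + v) \<le> u + v" using uv by (simp add: frac_def)
  moreover have "1 \<le> u + v" if "frac (u + v) = 0"
  proof -
    from that have "u + v \<in> \<int>" by (simp only: frac_eq_0_iff)
    then obtain m :: int where "u + v = of_int m" by (elim Ints_cases)
    moreover from this have "0 < m" using uv by (metis add_pos_nonneg of_int_0_less_iff)
    ultimately show ?thesis by simp
  qed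
  ultimately have "2 * slack_bound r \<le> u + v" unfolding slack_bound_def by (auto simp del: frac_eq_0_iff)
  then show ?thesis by (simp add: u_def v_def)
qed

text \<open>Two different unordered pairs: some index occurs in the first but not in the second,
  which makes the slacks independent. The remaining case of a pair and its swap is covered by
  \<open>slack_bound\<close>.\<close>

definition slack_pairs :: "'i set \<Rightarrow> (('i \<times> 'i) \<times> ('i \<times> 'i)) set" where
  "slack_pairs A = {((a, b), (a', b')) | a b a' b'. {a, b, a', b'} \<subseteq> A \<and> a \<noteq> b \<and> a' \<noteq> b' \<and> {a, b} \<noteq> {a', b'}}"

text \<open>An upper bound for \<open>1 / L\<close> of a wide arc, one summand per possible reason
  for its length. If \<open>u \<le> L\<close> and \<open>v \<le> L\<close> then
  \<open>sqrt u * sqrt v \<le> L\<close>, and unlike \<open>1 / u\<close> alone the product of the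
  inverse roots is integrable.\<close>

definition slack_sum :: "real \<Rightarrow> 'i set \<Rightarrow> ('i \<Rightarrow> circle) \<Rightarrow> real" where
  "slack_sum r A x = 1 / r + 1 / slack_bound r +
     (\<Sum>((a, b), (a', b'))\<in>slack_pairs A. 1 / sqrt (slack r x a b) * (1 / sqrt (slack r x a' b')))"

text \<open>Division by zero gives 0, so a vanishing slack would drop its summands from
  \<open>slack_sum\<close> and invalidate the bound. On this null event \<open>wide_length\<close>
  is set to 0, which is still a lower bound for a length.\<close>

definition degenerate :: "real \<Rightarrow> 'i set \<Rightarrow> ('i \<Rightarrow> circle) \<Rightarrow> bool" where
  "degenerate r A x \<longleftrightarrow> (\<exists>a\<in>A. \<exists>b\<in>A. a \<noteq> b \<and> slack r x a b = 0)"

definition wide_length :: "real \<Rightarrow> 'i set \<Rightarrow> ('i \<Rightarrow> circle) \<Rightarrow> real" where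
  "wide_length r A x = (if degenerate r A x then 0 else 1 / slack_sum r A x)"

lemma finite_slack_pairs [simp]: "finite A \<Longrightarrow> finite (slack_pairs A)"
  by (rule finite_subset[of _ "(A \<times> A) \<times> (A \<times> A)"]) (auto simp: slack_pairs_def)

lemma slack_sum_ge:
  assumes "finite A" "r > 0"
  shows "1 / r \<le> slack_sum r A x" "1 / slack_bound r \<le> slack_sum r A x"
    and "((a, b), (a', b')) \<in> slack_pairs A \<Longrightarrow>
      1 / sqrt (slack r x a b) * (1 / sqrt (slack r x a' b')) \<le> slack_sum r A x"
proof -
  let ?f = "\<lambda>((a, b), (a', b')). 1 / sqrt (slack r x a b) * (1 / sqrt (slack r x a' b'))"
  have pos: "0 < 1 / r" "0 < 1 / slack_bound r" using assms slack_bound_pos[of r] by auto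
  have nn: "0 \<le> ?f z" for z by (auto simp: split_beta)
  have "0 \<le> sum ?f (slack_pairs A)" by (intro sum_nonneg nn)
  then show "1 / r \<le> slack_sum r A x" "1 / slack_bound r \<le> slack_sum r A x"
    unfolding slack_sum_def using pos by linarith+
  assume "((a, b), (a', b')) \<in> slack_pairs A"
  then have "?f ((a, b), (a', b')) \<le> sum ?f (slack_pairs A)"
    by (intro member_le_sum) (use assms nn in auto)
  then have "1 / sqrt (slack r x a b) * (1 / sqrt (slack r x a' b')) \<le> sum ?f (slack_pairs A)"
    by (simp only: prod.case)
  then show "1 / sqrt (slack r x a b) * (1 / sqrt (slack r x a' b')) \<le> slack_sum r A x"
    unfolding slack_sum_def using pos by linarith
qed

lemma slack_sum_pos:
  assumes "finite A" "r > 0"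
  shows "slack_sum r A x > 0"
  using slack_sum_ge(1)[OF assms] assms(2) by (meson less_le_trans zero_less_divide_1_iff)

lemma wide_length_nonneg: "finite A \<Longrightarrow> r > 0 \<Longrightarrow> wide_length r A x \<ge> 0"
  using slack_sum_pos[of A r x] by (simp add: wide_length_def)

text \<open>Each alternative of \<open>wide_common_arc_cases\<close> meets one summand of
  \<open>slack_sum\<close>: \<open>r \<le> L\<close> the first, swapped indices the second through
  \<open>slack_swap\<close>, and genuinely different pairs one of the products.\<close>

lemma wide_length_le:
  assumes A: "finite A" "A \<noteq> {}" and r: "0 < r" "r < 1/2"
    and p: "p \<in> common_arc r A x" "p' \<in> common_arc r A x" "circle_dist p p' > r"
  shows "wide_length r A x \<le> measure circle_uniform (common_arc r A x)"
proof (cases "degenerate r A x")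
  case False
  define L where "L = measure circle_uniform (common_arc r A x)"
  have pos: "slack r x a b > 0" if "a \<in> A" "b \<in> A" "a \<noteq> b" for a b
    using False that by (auto simp: degenerate_def less_le)
  have goal: "1 / slack_sum r A x \<le> L" if "1 / y \<le> slack_sum r A x" "0 < y" "y \<le> L" for y
    using frac_le[of 1 1 "1 / y" "slack_sum r A x"] that by simp
  from wide_common_arc_cases[OF A r p, folded L_def] have "1 / slack_sum r A x \<le> L"
  proof (elim disjE bexE conjE)
    assume "r \<le> L"
    then show ?thesis using goal[of r] slack_sum_ge(1)[OF A(1) r(1), of x] r by auto
  next
    fix a b a' b'
    assume ab: "a \<in> A" "b \<in> A" "a' \<in> A" "b' \<in> A" "a \<noteq> b" "a' \<noteq> b'" "(a, b) \<noteq> (a', b')"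
      and le: "slack r x a b \<le> L" "slack r x a' b' \<le> L"
    show ?thesis
    proof (cases "{a, b} = {a', b'}")
      case True
      then have "a' = b" "b' = a" using ab by (auto simp: doubleton_eq_iff)
      then have "slack_bound r \<le> L" using slack_swap[OF pos[OF ab(1,2,5)]] le by auto
      then show ?thesis using goal[of "slack_bound r"] slack_sum_ge(2)[OF A(1) r(1), of x] slack_bound_pos[of r]
        by auto
    next
      case False
      then have "((a, b), (a', b')) \<in> slack_pairs A" using ab by (auto simp: slack_pairs_def)
      from slack_sum_ge(3)[OF A(1) r(1) this, of x]
      have "1 / (sqrt (slack r x a b) * sqrt (slack r x a' b')) \<le> slack_sum r A x" by simp
      moreover have "sqrt (slack r x a b) * sqrt (slack r x a' b') \<le> sqrt L * sqrt L"
        using le by (intro mult_mono) (auto simp: L_def)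
      moreover have "sqrt L * sqrt L = L" by (simp add: L_def)
      ultimately show ?thesis
        using goal[of "sqrt (slack r x a b) * sqrt (slack r x a' b')"] pos ab by simp
    qed
  qed
  then show ?thesis using False by (simp add: wide_length_def L_def)
qed (simp add: wide_length_def)

section \<open>Moments of slacks\<close>

interpretation circle_product: product_sigma_finite "\<lambda>_. circle_uniform"
  by (intro product_sigma_finite.intro prob_space_imp_sigma_finite prob_space_circle_uniform)

abbreviation circles :: "'i set \<Rightarrow> ('i \<Rightarrow> circle) measure" where
  "circles A \<equiv> PiM A (\<lambda>_. circle_uniform)"

lemma prob_space_circles: "prob_space (circles A)"
  by (intro prob_space_PiM prob_space_circle_uniform)

lemma measurable_slack [measurable]:
  assumes [measurable]: "a \<in> A" "b \<in> A"
  shows "(\<lambda>x. slack r x a b) \<in> borel_measurable (circles A)"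
  unfolding slack_def by measurable

text \<open>With all points except \<open>x c\<close> fixed, the slack is a rotated or reflected
  uniform point, hence uniform on [0, 1) whatever the other points are. Integrating over
  \<open>x c\<close> first therefore splits off its factor.\<close>

lemma nn_integral_slack_mult:
  assumes A: "finite A" "a \<in> A" "b \<in> A" "a \<noteq> b" "c \<in> {a, b}"
    and f [measurable]: "f \<in> borel_measurable borel"
    and g [measurable]: "g \<in> borel_measurable (circles A)"
    and indep: "\<And>x y. g (x(c := y)) = g x"
  shows "(\<integral>\<^sup>+x. f (slack r x a b) * g x \<partial>circles A)
    = (\<integral>\<^sup>+t. f t * indicator {0..<1} t \<partial>lborel) * (\<integral>\<^sup>+x. g x \<partial>circles A)"
proof -
  let ?U = "\<integral>\<^sup>+t. f t * indicator {0..<1} t \<partial>lborel"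
  define B where "B = A - {c}"
  have B: "finite B" "c \<notin> B" "A = insert c B" using A by (auto simp: B_def)
  have inner: "(\<integral>\<^sup>+y. f (slack r (x(c := y)) a b) \<partial>circle_uniform) = ?U" for x
  proof (cases "c = a")
    case True
    have "slack r (x(c := y)) a b = frac (2 * r + crep (x b) - crep y)" for y
      using True A by (simp add: slack_def algebra_simps)
    then show ?thesis using nn_integral_frac_diff_crep[OF f] by simp
  next
    case False
    then have "slack r (x(c := y)) a b = frac (crep y - (crep (x a) - 2 * r))" for y
      using A by (simp add: slack_def algebra_simps)
    then show ?thesis using nn_integral_frac_crep_diff[OF f] by simp
  qed
  have meas: "(\<lambda>y. f (slack r (x(c := y)) a b)) \<in> borel_measurable circle_uniform" 
    if "x \<in> space (circles B)" for x
    by (rule measurable_compose[OF measurable_component_update[OF that B(2)]])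
       (use A in \<open>simp add: B(3)[symmetric]\<close>)
  have "(\<integral>\<^sup>+x. f (slack r x a b) * g x \<partial>circles A)
      = (\<integral>\<^sup>+x. \<integral>\<^sup>+y. f (slack r (x(c := y)) a b) * g (x(c := y)) \<partial>circle_uniform \<partial>circles B)"
    unfolding B(3) by (rule circle_product.product_nn_integral_insert) (use B A in \<open>auto simp flip: B(3)\<close>)
  also have "\<dots> = (\<integral>\<^sup>+x. ?U * g x \<partial>circles B)"
    by (intro nn_integral_cong) (simp add: indep nn_integral_multc meas inner)
  also have "\<dots> = (\<integral>\<^sup>+x. \<integral>\<^sup>+y. ?U * g (x(c := y)) \<partial>circle_uniform \<partial>circles B)"
    by (simp add: indep circle_uniform.emeasure_space_1[simplified])
  also have "\<dots> = (\<integral>\<^sup>+x. ?U * g x \<partial>circles A)"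
    unfolding B(3) by (rule circle_product.product_nn_integral_insert[symmetric]) (use B A in \<open>auto simp flip: B(3)\<close>)
  also have "\<dots> = ?U * (\<integral>\<^sup>+x. g x \<partial>circles A)" by (rule nn_integral_cmult) simp
  finally show ?thesis .
qed

lemma nn_integral_slack:
  assumes "finite A" "a \<in> A" "b \<in> A" "a \<noteq> b" "f \<in> borel_measurable borel"
  shows "(\<integral>\<^sup>+x. f (slack r x a b) \<partial>circles A) = (\<integral>\<^sup>+t. f t * indicator {0..<1} t \<partial>lborel)"
  using nn_integral_slack_mult[of A a b a f "\<lambda>_. 1" r] assms
  by (simp add: prob_space.emeasure_space_1[OF prob_space_circles])

lemma AE_not_degenerate:
  assumes "finite A"
  shows "AE x in circles A. \<not> degenerate r A x"
proof -
  have "AE x in circles A. slack r x a b \<noteq> 0" if "a \<in> A" "b \<in> A" "a \<noteq> b" for a b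
  proof -
    note [measurable] = that(1,2)
    have "(\<integral>\<^sup>+x. (indicator {0} (slack r x a b) :: ennreal) \<partial>circles A) = (\<integral>\<^sup>+t. indicator {0::real} t * indicator {0..<1} t \<partial>lborel)"
      by (rule nn_integral_slack[where f = "indicator {0}"]) (use assms that in auto)
    also have "\<dots> = (\<integral>\<^sup>+t. indicator {0::real} t \<partial>lborel)"
      by (intro nn_integral_cong) (auto simp: indicator_def)
    also have "\<dots> = 0" by simp
    finally have "AE x in circles A. indicator {0} (slack r x a b) = (0::ennreal)"
      by (subst (asm) nn_integral_0_iff_AE) auto
    then show ?thesis by eventually_elim (auto simp: indicator_def split: if_splits)
  qed
  then have "AE x in circles A. \<forall>a\<in>A. \<forall>b\<in>A. a \<noteq> b \<longrightarrow> slack r x a b \<noteq> 0"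
    by (simp add: AE_ball_countable countable_finite assms)
  then show ?thesis by eventually_elim (auto simp: degenerate_def)
qed

lemma nn_integral_inverse_sqrt_unit:
  "(\<integral>\<^sup>+t. ennreal (1 / sqrt t) * indicator {0..<1} t \<partial>lborel) = 2"
proof -
  have "((\<lambda>x. x powr (-1/2)) has_integral (1 powr (-1/2+1) / (-1/2+1))) {0..1::real}"
    by (rule has_integral_powr_from_0) auto
  then have "((\<lambda>x. if x \<in> {0..1} then x powr (-1/2) else 0) has_integral 2) (UNIV :: real set)"
    by (subst has_integral_restrict_UNIV) simp
  then have "(\<integral>\<^sup>+t. ennreal (if t \<in> {0..1} then t powr (-1/2) else 0) \<partial>lborel) = ennreal 2"
    by (intro nn_integral_has_integral_lborel) auto
  also have "(\<integral>\<^sup>+t. ennreal (if t \<in> {0..1} then t powr (-1/2) else 0) \<partial>lborel)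
      = (\<integral>\<^sup>+t. ennreal (1 / sqrt t) * indicator {0..<1} t \<partial>lborel)"
  proof (rule nn_integral_cong_AE)
    have "AE t in lborel. t \<noteq> (1::real)" "AE t in lborel. t \<noteq> (0::real)" by (rule AE_lborel_singleton)+
    then show "AE t in lborel. ennreal (if t \<in> {0..1} then t powr (-1/2) else 0)
        = ennreal (1 / sqrt t) * indicator {0..<1} t"
      by eventually_elim (auto simp: indicator_def powr_minus powr_half_sqrt inverse_eq_divide)
  qed
  finally show ?thesis by simp
qed

lemma nn_integral_slack_sum_finite:
  assumes A: "finite A" and r: "r > 0"
  shows "(\<integral>\<^sup>+x. ennreal (slack_sum r A x) \<partial>circles A) < \<infinity>"
proof -
  let ?s = "\<lambda>x a b. ennreal (1 / sqrt (slack r x a b))"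
  have pair: "(\<lambda>x. ?s x a b * ?s x a' b') \<in> borel_measurable (circles A)"
      "(\<integral>\<^sup>+x. ?s x a b * ?s x a' b' \<partial>circles A) = 4"
    if ab: "((a, b), (a', b')) \<in> slack_pairs A" for a b a' b'
  proof -
    have AB [measurable]: "a \<in> A" "b \<in> A" "a' \<in> A" "b' \<in> A" and ne: "a \<noteq> b" "a' \<noteq> b'" "{a, b} \<noteq> {a', b'}"
      using ab by (auto simp: slack_pairs_def)
    show "(\<lambda>x. ?s x a b * ?s x a' b') \<in> borel_measurable (circles A)" by measurable
    \<comment> \<open>Two different sets of two elements each: \<open>c\<close> is moved by the
      first slack and not by the second. Each of the two factors then contributes 2.\<close>
    obtain c where c: "c \<in> {a, b}" "c \<notin> {a', b'}" using ne by blast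
    have "(\<integral>\<^sup>+x. ?s x a b * ?s x a' b' \<partial>circles A)
        = (\<integral>\<^sup>+t. ennreal (1 / sqrt t) * indicator {0..<1} t \<partial>lborel) * (\<integral>\<^sup>+x. ?s x a' b' \<partial>circles A)"
      by (rule nn_integral_slack_mult[OF A AB(1,2) ne(1) c(1)]) (use c in \<open>auto simp: slack_def\<close>)
    also have "(\<integral>\<^sup>+x. ?s x a' b' \<partial>circles A) = 2"
      using nn_integral_slack[OF A AB(3,4) ne(2), of "\<lambda>t. ennreal (1 / sqrt t)"] by (simp add: nn_integral_inverse_sqrt_unit)
    finally show "(\<integral>\<^sup>+x. ?s x a b * ?s x a' b' \<partial>circles A) = 4"
      by (simp add: nn_integral_inverse_sqrt_unit)
  qed
  define C where "C = ennreal (1 / r) + ennreal (1 / slack_bound r)"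
  have split: "ennreal (slack_sum r A x) = C + (\<Sum>((a, b), (a', b'))\<in>slack_pairs A. ?s x a b * ?s x a' b')" for x
  proof -
    have "ennreal (\<Sum>((a, b), (a', b'))\<in>slack_pairs A. 1 / sqrt (slack r x a b) * (1 / sqrt (slack r x a' b')))
      = (\<Sum>((a, b), (a', b'))\<in>slack_pairs A. ?s x a b * ?s x a' b')"
      by (subst sum_ennreal[symmetric]) (auto simp: ennreal_mult' split_beta intro!: sum.cong simp flip: ennreal_mult')
    moreover have "0 \<le> (\<Sum>((a, b), (a', b'))\<in>slack_pairs A. 1 / sqrt (slack r x a b) * (1 / sqrt (slack r x a' b')))"
      by (intro sum_nonneg) auto
    ultimately show ?thesis unfolding slack_sum_def C_def
      using r slack_bound_pos[of r] by (subst ennreal_plus) (auto simp: less_imp_le)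
  qed
  have "(\<integral>\<^sup>+x. ennreal (slack_sum r A x) \<partial>circles A)
     = (\<integral>\<^sup>+x. C + (\<Sum>z\<in>slack_pairs A. ?s x (fst (fst z)) (snd (fst z)) * ?s x (fst (snd z)) (snd (snd z))) \<partial>circles A)"
    unfolding split by (simp add: split_beta)
  also have "\<dots> = C + (\<Sum>z\<in>slack_pairs A. 4)"
  proof (subst nn_integral_add)
    show "(\<lambda>x. \<Sum>z\<in>slack_pairs A. ?s x (fst (fst z)) (snd (fst z)) * ?s x (fst (snd z)) (snd (snd z)))
        \<in> borel_measurable (circles A)"
      by (intro borel_measurable_sum pair) auto
    show "(\<integral>\<^sup>+x. C \<partial>circles A) + (\<integral>\<^sup>+x. (\<Sum>z\<in>slack_pairs A. ?s x (fst (fst z)) (snd (fst z)) * ?s x (fst (snd z)) (snd (snd z))) \<partial>circles A)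
       = C + (\<Sum>z\<in>slack_pairs A. 4)"
      by (subst nn_integral_sum)
         (auto intro!: pair sum.cong arg_cong2[where f = "(+)"] simp: prob_space.emeasure_space_1[OF prob_space_circles]
           simp del: sum_constant)
  qed auto
  also have "\<dots> < \<infinity>" by (simp add: C_def ennreal_mult_less_top of_nat_less_top)
  finally show ?thesis .
qed

lemma measurable_slack_sum [measurable]:
  assumes A: "finite A"
  shows "(\<lambda>x. slack_sum r A x) \<in> borel_measurable (circles A)"
proof -
  have "(\<lambda>x. 1 / sqrt (slack r x (fst (fst z)) (snd (fst z))) * (1 / sqrt (slack r x (fst (snd z)) (snd (snd z)))))
      \<in> borel_measurable (circles A)" if "z \<in> slack_pairs A" for z
  proof -
    have [measurable]: "fst (fst z) \<in> A" "snd (fst z) \<in> A" "fst (snd z) \<in> A" "snd (snd z) \<in> A"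
      using that by (auto simp: slack_pairs_def)
    show ?thesis by measurable
  qed
  then show ?thesis unfolding slack_sum_def split_beta
    by (intro borel_measurable_add borel_measurable_const borel_measurable_sum)
qed

lemma measurable_wide_length [measurable]:
  assumes A: "finite A"
  shows "(\<lambda>x. wide_length r A x) \<in> borel_measurable (circles A)"
proof -
  note [measurable] = measurable_slack_sum[OF A]
  have "Measurable.pred (circles A) (\<lambda>x. \<exists>a\<in>A. \<exists>b\<in>A. a \<noteq> b \<and> slack r x a b = 0)"
    by (intro pred_intros_finite A) measurable
  then have [measurable]: "Measurable.pred (circles A) (degenerate r A)"
    by (simp add: degenerate_def[abs_def])
  show ?thesis unfolding wide_length_def by measurable
qed

text \<open>On degenerate configurations the inverse is infinite, but these form a null set;
  elsewhere it equals \<open>slack_sum\<close>.\<close>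

lemma nn_integral_inverse_wide_length_finite:
  assumes A: "finite A" and r: "r > 0"
  shows "(\<integral>\<^sup>+x. inverse (ennreal (wide_length r A x)) \<partial>circles A) < \<infinity>"
proof -
  have "(\<integral>\<^sup>+x. inverse (ennreal (wide_length r A x)) \<partial>circles A) = (\<integral>\<^sup>+x. ennreal (slack_sum r A x) \<partial>circles A)"
  proof (rule nn_integral_cong_AE)
    show "AE x in circles A. inverse (ennreal (wide_length r A x)) = ennreal (slack_sum r A x)"
      using AE_not_degenerate[OF A, of r]
    proof eventually_elim
      case (elim x)
      then show ?case
        using slack_sum_pos[OF A r, of x] by (simp add: wide_length_def inverse_ennreal)
    qed
  qed
  then show ?thesis using nn_integral_slack_sum_finite[OF A r] by simp
qed

text \<open>A substitute, up to a constant, for the weight \<open>t ^ M * exp (- t / 2)\<close>,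
  which is not monotone. \<open>decay\<close> is decreasing, so lower bounds for the cell volume can
  be inserted, and it has the rational antiderivative \<open>- 1 / (1 + t)\<close>.\<close>

definition decay :: "real \<Rightarrow> real" where
  "decay t = 1 / (1 + t)\<^sup>2"

lemma decay_le_inverse:
  assumes "0 < t"
  shows "decay t \<le> 1 / t"
proof -
  have "t \<le> (1 + t)\<^sup>2" using assms by (simp add: power2_eq_square algebra_simps)
  then show ?thesis using assms unfolding decay_def by (intro frac_le) auto
qed

lemma decay_nonneg [simp]: "0 \<le> decay t"
  by (simp add: decay_def)

lemma decay_antimono: "0 \<le> s \<Longrightarrow> s \<le> t \<Longrightarrow> decay t \<le> decay s"
  unfolding decay_def by (intro divide_left_mono power_mono mult_pos_pos zero_less_power) auto

lemma measurable_decay [measurable]: "decay \<in> borel_measurable borel"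
  unfolding decay_def[abs_def] by measurable

text \<open>The slack is uniform, so this is the integral of \<open>decay (w * t)\<close> over the
  unit interval, which is \<open>(1 - 1 / (1 + w)) / w\<close>. For \<open>w = 0\<close> the
  right-hand side is infinite, so vanishing lengths need no exception later.\<close>

lemma nn_integral_decay_slack_le:
  assumes A: "finite A" "a \<in> A" "b \<in> A" "a \<noteq> b" and w: "w \<ge> 0"
  shows "(\<integral>\<^sup>+x. ennreal (decay (w * slack r x a b)) \<partial>circles A) \<le> inverse (ennreal w)"
proof (cases "w = 0")
  case False
  then have w: "w > 0" using assms by simp
  have "(\<integral>\<^sup>+x. ennreal (decay (w * slack r x a b)) \<partial>circles A)
      = (\<integral>\<^sup>+t. ennreal (decay (w * t)) * indicator {0..<1} t \<partial>lborel)"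
    by (rule nn_integral_slack[OF A]) measurable
  also have "\<dots> \<le> (\<integral>\<^sup>+t. ennreal (decay (w * t)) * indicator {0..1} t \<partial>lborel)"
    by (intro nn_integral_mono) (auto simp: indicator_def)
  also have "\<dots> = ennreal (- (1 / w) * inverse (1 + w * 1) - - (1 / w) * inverse (1 + w * 0))"
  proof (rule nn_integral_FTC_Icc[where F = "\<lambda>t. - (1 / w) * inverse (1 + w * t)"])
    fix t :: real assume t: "t \<in> {0..1}"
    then have "0 \<le> t" by simp
    then have *: "1 + w * t \<noteq> 0" using w by (smt (verit) mult_nonneg_nonneg)
    have "DERIV (\<lambda>t. - (1 / w) * inverse (1 + w * t)) t :>
        - (1 / w) * - (inverse (1 + w * t) * w * inverse (1 + w * t))"
      using * by (auto intro!: derivative_eq_intros)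
    moreover have "- (1 / w) * - (inverse (1 + w * t) * w * inverse (1 + w * t)) = decay (w * t)"
      using w by (simp add: decay_def divide_inverse power2_eq_square)
    ultimately show "DERIV (\<lambda>t. - (1 / w) * inverse (1 + w * t)) t :> decay (w * t)" by simp
  qed auto
  also have "\<dots> \<le> ennreal (1 / w)" using w by (intro ennreal_leI) simp
  also have "\<dots> = inverse (ennreal w)" using w by (simp add: inverse_ennreal inverse_eq_divide)
  finally show ?thesis .
qed simp

section \<open>Configurations with a thin or a wide common arc\<close>

lemma sets_relative_arcs:
  assumes "finite B" "B \<subseteq> A" "c \<in> A"
  shows "{x \<in> space (circles A). \<forall>a\<in>B. frac (crep (x a) - (crep (x c) + base a)) \<le> len a} \<in> sets (circles A)"
proof -
  have "Measurable.pred (circles A) (\<lambda>x. \<forall>a\<in>B. frac (crep (x a) - (crep (x c) + base a)) \<le> len a)"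
  proof (intro pred_intros_finite assms(1))
    fix a assume "a \<in> B"
    then have [measurable]: "a \<in> A" "c \<in> A" using assms by auto
    show "Measurable.pred (circles A) (\<lambda>x. frac (crep (x a) - (crep (x c) + base a)) \<le> len a)" by measurable
  qed
  then show ?thesis by (rule predE)
qed

lemma sets_circle_arc: "{c. frac (crep c - b) \<le> l} \<in> sets circle_borel"
  using measurable_sets_Collect[of "\<lambda>c. frac (crep c - b) \<le> l" circle_borel] by simp

text \<open>Given \<open>x c\<close>, the other points are independent and an arc has the measure of
  its length wherever it starts, so the inner integral is constant in \<open>x c\<close>.\<close>

lemma emeasure_relative_arcs:
  assumes B: "finite B" "c \<notin> B" and len: "\<And>a. a \<in> B \<Longrightarrow> 0 \<le> len a \<and> len a < 1"
  shows "emeasure (circles (insert c B))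
      {x \<in> space (circles (insert c B)). \<forall>a\<in>B. frac (crep (x a) - (crep (x c) + base a)) \<le> len a}
    = (\<Prod>a\<in>B. ennreal (len a))"
proof -
  let ?A = "insert c B"
  let ?T = "{x \<in> space (circles ?A). \<forall>a\<in>B. frac (crep (x a) - (crep (x c) + base a)) \<le> len a}"
  have T [measurable]: "?T \<in> sets (circles ?A)" by (rule sets_relative_arcs) (use B in auto)
  have "emeasure (circles ?A) ?T = (\<integral>\<^sup>+x. indicator ?T x \<partial>circles ?A)" by simp
  also have "\<dots> = (\<integral>\<^sup>+y. \<integral>\<^sup>+x. indicator ?T (x(c := y)) \<partial>circles B \<partial>circle_uniform)"
    by (rule circle_product.product_nn_integral_insert_rev) (use B in auto)
  also have "\<dots> = (\<integral>\<^sup>+y. (\<Prod>a\<in>B. ennreal (len a)) \<partial>circle_uniform)"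
  proof (intro nn_integral_cong)
    fix y
    let ?S = "\<lambda>a. {z. frac (crep z - (crep y + base a)) \<le> len a}"
    have "(\<integral>\<^sup>+x. indicator ?T (x(c := y)) \<partial>circles B) = (\<integral>\<^sup>+x. indicator (Pi\<^sub>E B ?S) x \<partial>circles B)"
    proof (intro nn_integral_cong)
      fix x assume "x \<in> space (circles B)"
      then have "x(c := y) \<in> ?T \<longleftrightarrow> x \<in> Pi\<^sub>E B ?S"
        using B(2) by (auto simp: space_PiM PiE_iff extensional_def)
      then show "(indicator ?T (x(c := y)) :: ennreal) = indicator (Pi\<^sub>E B ?S) x" by (simp add: indicator_def)
    qed
    also have "\<dots> = emeasure (circles B) (Pi\<^sub>E B ?S)"
      by (rule nn_integral_indicator) (use B sets_circle_arc in \<open>auto intro!: sets_PiM_I_finite\<close>)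
    also have "\<dots> = (\<Prod>a\<in>B. emeasure circle_uniform (?S a))"
      by (rule circle_product.emeasure_PiM) (use B sets_circle_arc in auto)
    also have "\<dots> = (\<Prod>a\<in>B. ennreal (len a))"
      by (intro prod.cong refl emeasure_circle_arc) (use len in auto)
    finally show "(\<integral>\<^sup>+x. indicator ?T (x(c := y)) \<partial>circles B) = (\<Prod>a\<in>B. ennreal (len a))" .
  qed
  also have "\<dots> = (\<Prod>a\<in>B. ennreal (len a))" using circle_uniform.emeasure_space_1 by simp
  finally show ?thesis .
qed

text \<open>
  The hypothesis on \<open>X (Suc a) - X a\<close> says that consecutive excluded arcs, each of length
  \<open>1 - 2 * r\<close>, overlap, so that only the gap between the last one and the first one stays uncovered.
\<close>

lemma common_arc_chain:
  fixes X :: "nat \<Rightarrow> real" and k :: "nat \<Rightarrow> int"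
  assumes q: "1 \<le> q" and r: "0 < r" "r < 1/2"
    and X: "\<And>a. a \<in> {1..q} \<Longrightarrow> crep (x a) = X a + of_int (k a)"
    and range: "\<And>a. a \<in> {1..q} \<Longrightarrow> X 1 \<le> X a \<and> X a \<le> X q" "X q \<le> X 1 + 2 * r"
    and step: "\<And>a. 1 \<le> a \<Longrightarrow> a < q \<Longrightarrow> X (Suc a) - X a < 1 - 2 * r"
  shows "common_arc r {1..q} x = {y. frac (crep y - (X q - r)) \<le> 2 * r - (X q - X 1)}"
proof (intro set_eqI iffI)
  have l: "0 \<le> 2 * r - (X q - X 1)" "2 * r - (X q - X 1) < 1" using range(2) range(1)[of q] q r by auto
  note arc_iff = frac_le_iff[OF l]
  fix y
  {
    assume "y \<in> {y. frac (crep y - (X q - r)) \<le> 2 * r - (X q - X 1)}"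
    then obtain m :: int where m: "0 \<le> crep y - (X q - r) - of_int m" "crep y - (X q - r) - of_int m \<le> 2 * r - (X q - X 1)"
      unfolding arc_iff mem_Collect_eq by blast
    show "y \<in> common_arc r {1..q} x" unfolding common_arc_def
    proof (intro CollectI ballI)
      fix a assume a: "a \<in> {1..q}"
      show "circle_dist y (x a) \<le> r"
        by (rule circle_dist_leI[of _ _ "m - k a"]) (use m X[OF a] range(1)[OF a] in auto)
    qed
  next
    assume y: "y \<in> common_arc r {1..q} x"
    then have "circle_dist y (x 1) \<le> r" using q by (auto simp: common_arc_def)
    then obtain t and m :: int where t: "\<bar>t\<bar> \<le> r" "crep (x 1) = crep y + t + of_int m"
      by (rule circle_dist_le_offset)
    define Y where "Y = X 1 - t"
    have Y: "crep y = Y + of_int (k 1 - m)" using t(2) X[of 1] q by (simp add: Y_def)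
    \<comment> \<open>Induction carries the same lift \<open>Y\<close> of \<open>y\<close> from one
      centre to the next. The next centre is \<open>Y + t' + j\<close> for an integer
      \<open>j\<close>; since it lies less than \<open>1 - 2 * r\<close> beyond a point that is at
      most \<open>Y + r\<close>, only \<open>j \<le> 0\<close> remains.\<close>
    have "X a \<le> Y + r" if "1 \<le> a" "a \<le> q" for a
      using that
    proof (induction a rule: nat_induct_at_least)
      case base
      then show ?case using t(1) by (simp add: Y_def)
    next
      case (Suc a)
      then have "circle_dist y (x (Suc a)) \<le> r" using y by (auto simp: common_arc_def)
      then obtain t' and m' :: int where t': "\<bar>t'\<bar> \<le> r" "crep (x (Suc a)) = crep y + t' + of_int m'"
        by (rule circle_dist_le_offset)
      define j where "j = k 1 - m + m' - k (Suc a)"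
      have "X (Suc a) = Y + t' + of_int j" using t'(2) X[of "Suc a"] Y Suc by (simp add: j_def)
      moreover have "X (Suc a) < Y + 1 - r" using step[of a] Suc by simp
      ultimately have "real_of_int j < 1" using t'(1) by (smt (verit))
      then have "real_of_int j \<le> 0" by simp
      then show ?case using \<open>X (Suc a) = Y + t' + of_int j\<close> t'(1) by simp
    qed
    from this[of q] have "X q \<le> Y + r" using q by simp
    then have "0 \<le> crep y - (X q - r) - of_int (k 1 - m) \<and>
        crep y - (X q - r) - of_int (k 1 - m) \<le> 2 * r - (X q - X 1)"
      unfolding Y using t(1) by (simp add: Y_def)
    then show "y \<in> {y. frac (crep y - (X q - r)) \<le> 2 * r - (X q - X 1)}"
      unfolding arc_iff mem_Collect_eq by blast
  }
qed

text \<open>The centres are spread almost evenly over a span slightly below \<open>2 * r\<close>, so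
  that the excluded arcs overlap and leave one gap. Only the last centre has to be placed with
  precision \<delta>, which costs one factor \<delta>.\<close>

lemma thin_coordinate:
  assumes q: "2 \<le> q" and r: "0 < r" "r < 1/2" and cover: "1 < real q * (1 - 2 * r)"
  obtains c d :: real where "0 < c" "0 < d" "d \<le> 1"
    "\<And>\<delta>. 0 < \<delta> \<Longrightarrow> \<delta> \<le> d \<Longrightarrow> \<exists>T\<in>sets (circles {1..q}). ennreal (c * \<delta>) \<le> emeasure (circles {1..q}) T \<and>
       (\<forall>x\<in>T. measure circle_uniform (common_arc r {1..q} x) \<in> {\<delta> / 2..\<delta>})"
proof -
  \<comment> \<open>The step of \<open>q\<close> equidistant centres over a span of
    \<open>2 * r\<close>. It is below \<open>1 - 2 * r\<close> precisely because
    \<open>q * (1 - 2 * r) > 1\<close>.\<close>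
  define b where "b = 2 * r / (real q - 1)"
  have q1: "real q - 1 \<ge> 1" using q by simp
  have b: "0 < b" "b \<le> 2 * r" "b < 1 - 2 * r" "(real q - 1) * b = 2 * r"
  proof -
    show "0 < b" using r q1 by (simp add: b_def)
    show "b \<le> 2 * r" unfolding b_def using r q1 by (simp add: divide_le_eq)
    show "b < 1 - 2 * r" 
    proof -
      have "2 * r < (1 - 2 * r) * (real q - 1)" using cover by (simp add: algebra_simps)
      then show ?thesis unfolding b_def using q1 by (subst pos_divide_less_eq) auto
    qed
    show "(real q - 1) * b = 2 * r" using q1 by (simp add: b_def)
  qed
  \<comment> \<open>The freedom of the intermediate centres: displacing two neighbours by \<eta>
    each keeps them less than \<open>1 - 2 * r\<close> apart, and with
    \<open>\<delta> \<le> b / 2\<close> every centre stays between the first and the last.\<close>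
  define \<eta> where "\<eta> = min b (1 - 2 * r - b) / 4"
  have \<eta>: "0 < \<eta>" "\<eta> \<le> b / 4" "2 * \<eta> < 1 - 2 * r - b" "2 * \<eta> < 1" using b r by (auto simp: \<eta>_def)
  show ?thesis
  proof (rule that)
    show "0 < (2 * \<eta>) ^ (q - 2) / 2" using \<eta> by simp
    show "0 < b / 2" "b / 2 \<le> 1" using b r by auto
    fix \<delta> assume \<delta>: "0 < \<delta>" "\<delta> \<le> b / 2"
    \<comment> \<open>The last centre lies between \<open>2 * r - \<delta>\<close> and
      \<open>2 * r - \<delta> / 2\<close> beyond the first, which leaves a gap of length between
      \<open>\<delta> / 2\<close> and \<delta>. The \<open>q - 2\<close> intermediate centres range
      over arcs of length \<open>2 * \<eta>\<close>.\<close>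
    define base where "base a = (if a = q then 2 * r - \<delta> else (real a - 1) * b - \<eta>)" for a
    define len where "len a = (if a = q then \<delta> / 2 else 2 * \<eta>)" for a
    have len: "0 \<le> len a" "len a < 1" for a using \<delta> b r \<eta> by (auto simp: len_def)
    let ?T = "{x \<in> space (circles {1..q}). \<forall>a\<in>{2..q}. frac (crep (x a) - (crep (x 1) + base a)) \<le> len a}"
    have ins: "insert 1 {2..q} = {1..q}" using q by auto
    have "emeasure (circles {1..q}) ?T = (\<Prod>a\<in>{2..q}. ennreal (len a))"
      using emeasure_relative_arcs[of "{2..q}" 1 len base] len unfolding ins by simp
    also have "\<dots> = ennreal (\<Prod>a\<in>{2..q}. len a)" by (rule prod_ennreal) (use len in auto)
    also have "(\<Prod>a\<in>{2..q}. len a) = (2 * \<eta>) ^ (q - 2) / 2 * \<delta>"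
    proof -
      have "{2..q} = insert q {2..<q}" using q by auto
      then have "(\<Prod>a\<in>{2..q}. len a) = \<delta> / 2 * (\<Prod>a\<in>{2..<q}. len a)" by (simp add: len_def)
      also have "(\<Prod>a\<in>{2..<q}. len a) = (\<Prod>a\<in>{2..<q}. 2 * \<eta>)" by (intro prod.cong) (auto simp: len_def)
      finally show ?thesis by simp
    qed
    finally have meas: "emeasure (circles {1..q}) ?T = ennreal ((2 * \<eta>) ^ (q - 2) / 2 * \<delta>)" .
    have "measure circle_uniform (common_arc r {1..q} x) \<in> {\<delta> / 2..\<delta>}" if x: "x \<in> ?T" for x
    proof -
      have "\<exists>k::int. 0 \<le> crep (x a) - (crep (x 1) + base a) - of_int k \<and> crep (x a) - (crep (x 1) + base a) - of_int k \<le> len a"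
        if "a \<in> {2..q}" for a using x that frac_le_iff[OF len(1)[of a] len(2)[of a], of "crep (x a) - (crep (x 1) + base a)"] by blast
      then obtain k :: "nat \<Rightarrow> int" where k: "\<And>a. a \<in> {2..q} \<Longrightarrow>
          0 \<le> crep (x a) - (crep (x 1) + base a) - of_int (k a) \<and> crep (x a) - (crep (x 1) + base a) - of_int (k a) \<le> len a"
        by metis
      define X where "X a = (if a = 1 then crep (x 1) else crep (x a) - of_int (k a))" for a
      have X1: "X 1 = crep (x 1)" by (simp add: X_def)
      have Xq: "X 1 + 2 * r - \<delta> \<le> X q" "X q \<le> X 1 + 2 * r - \<delta> / 2"
        using k[of q] q by (auto simp: X_def base_def len_def)
      have Xm: "X 1 + (real a - 1) * b - \<eta> \<le> X a" "X a \<le> X 1 + (real a - 1) * b + \<eta>" if "1 \<le> a" "a < q" for a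
      proof -
        have "X 1 + (real a - 1) * b - \<eta> \<le> X a \<and> X a \<le> X 1 + (real a - 1) * b + \<eta>"
        proof (cases "a = 1")
          case False
          then show ?thesis using k[of a] that by (auto simp: X_def base_def len_def)
        qed (use \<eta> in simp)
        then show "X 1 + (real a - 1) * b - \<eta> \<le> X a" "X a \<le> X 1 + (real a - 1) * b + \<eta>" by auto
      qed
      have "common_arc r {1..q} x = {y. frac (crep y - (X q - r)) \<le> 2 * r - (X q - X 1)}"
      proof (rule common_arc_chain)
        show "1 \<le> q" "0 < r" "r < 1/2" using q r by auto
        show "crep (x a) = X a + of_int ((\<lambda>a. if a = 1 then 0 else k a) a)" for a by (simp add: X_def)
        show "X q \<le> X 1 + 2 * r" using Xq \<delta> by simp
        fix a
        { assume a: "a \<in> {1..q}"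
          show "X 1 \<le> X a \<and> X a \<le> X q"
          proof (cases "a = 1 \<or> a = q")
            case True
            then show ?thesis using Xq \<delta> b by auto
          next
            case False
            then have a: "1 < a" "a < q" using a by auto
            have "1 * b \<le> (real a - 1) * b" using a b by (intro mult_right_mono) auto
            moreover have "(real a - 1) * b \<le> (real q - 2) * b" using a b by (intro mult_right_mono) auto
            moreover have "(real q - 2) * b = 2 * r - b" using b(4) by (simp add: algebra_simps)
            moreover have "1 \<le> a" using a by simp
            ultimately show ?thesis using Xm[OF _ a(2)] Xq \<eta> \<delta> by (intro conjI) linarith+
          qed }
        { assume a: "1 \<le> a" "a < q"
          have "X (Suc a) \<le> X 1 + real a * b + \<eta>"
          proof (cases "Suc a = q")
            case True
            then have "real a * b = 2 * r" using b(4) by auto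
            then show ?thesis using Xq \<eta> \<delta> True by simp
          next
            case False
            then show ?thesis using Xm[of "Suc a"] a by simp
          qed
          then show "X (Suc a) - X a < 1 - 2 * r" using Xm[of a] a \<eta> by (simp add: algebra_simps) }
      qed
      moreover have "0 \<le> 2 * r - (X q - X 1)" "2 * r - (X q - X 1) < 1" using Xq \<delta> b r by auto
      ultimately have "measure circle_uniform (common_arc r {1..q} x) = 2 * r - (X q - X 1)"
        using emeasure_circle_arc[of "2 * r - (X q - X 1)" "X q - r"] by (simp add: measure_def)
      then show ?thesis using Xq by simp
    qed
    moreover have "?T \<in> sets (circles {1..q})" by (rule sets_relative_arcs) (use q in auto)
    ultimately show "\<exists>T\<in>sets (circles {1..q}). ennreal ((2 * \<eta>) ^ (q - 2) / 2 * \<delta>) \<le> emeasure (circles {1..q}) T \<and>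
       (\<forall>x\<in>T. measure circle_uniform (common_arc r {1..q} x) \<in> {\<delta> / 2..\<delta>})"
      using meas by (intro bexI[of _ ?T]) auto
  qed
qed

text \<open>If all centres are close to 0, the common arc is nearly \<open>[-r, r]\<close>, and two
  short arcs on either side of 0 lie in it at distance more than \<open>r\<close>. The arcs
  \<open>J\<close> are fixed in advance, so each such coordinate offers a choice between two sides
  that does not depend on \<open>x\<close>.\<close>

lemma wide_coordinate:
  fixes A :: "'i set"
  assumes A: "finite A" and r: "0 < r" "r < 1/2"
  obtains J :: "bool \<Rightarrow> circle set" and W and e w :: real where "0 < e" "0 < w" "W \<in> sets (circles A)"
    "ennreal w \<le> emeasure (circles A) W"
    "\<forall>s. J s \<in> sets circle_borel \<and> emeasure circle_uniform (J s) = ennreal e"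
    "\<forall>x\<in>W. \<forall>s. J s \<subseteq> common_arc r A x"
    "\<forall>s s'. s \<noteq> s' \<longrightarrow> (\<forall>y\<in>J s. \<forall>y'\<in>J s'. r < circle_dist y y')"
proof -
  \<comment> \<open>The arcs sit at \<open>s / 2\<close> and \<open>- s / 2\<close>:
    \<open>s < 2 * r\<close> keeps them within reach of every centre near 0, \<open>s > r\<close>
    separates them across 0, and \<open>s < 1 - r\<close> separates them the other way round the
    circle.\<close>
  define s where "s = (r + min (1 / 2) (2 * r)) / 2"
  define \<eta> where "\<eta> = min (min (s - r) (2 * r - s)) (min (1 - r - s) 1) / 8"
  have s: "r < s" "s < 2 * r" "s < 1 - r" using r by (auto simp: s_def min_def)
  have \<eta>: "0 < \<eta>" "4 * \<eta> \<le> 2 * r - s" "2 * \<eta> < s - r" "2 * \<eta> < 1 - r - s" "2 * \<eta> < 1"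
    using s by (auto simp: \<eta>_def)
  define J where "J \<sigma> = {y. frac (crep y - ((if \<sigma> then s / 2 else - s / 2) - \<eta>)) \<le> 2 * \<eta>}" for \<sigma>
  define S where "S = {y. frac (crep y - (- \<eta>)) \<le> 2 * \<eta>}"
  have arc: "\<exists>t. \<exists>k::int. \<bar>t\<bar> \<le> \<eta> \<and> crep y = u + t + of_int k" if y: "frac (crep y - (u - \<eta>)) \<le> 2 * \<eta>" for y u
  proof -
    have "\<exists>k::int. 0 \<le> crep y - (u - \<eta>) - of_int k \<and> crep y - (u - \<eta>) - of_int k \<le> 2 * \<eta>"
      using y \<eta> by (subst (asm) frac_le_iff) auto
    then obtain k :: int where "0 \<le> crep y - (u - \<eta>) - of_int k" "crep y - (u - \<eta>) - of_int k \<le> 2 * \<eta>" by blast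
    then show ?thesis by (intro exI[of _ "crep y - u - of_int k"] exI[of _ k]) auto
  qed
  have sep: "r < circle_dist y y'" if "y \<in> J False" "y' \<in> J True" for y y'
  proof (rule ccontr)
    assume "\<not> ?thesis"
    then have "circle_dist y y' \<le> r" by simp
    then obtain t and m :: int where t: "\<bar>t\<bar> \<le> r" "crep y' = crep y + t + of_int m" by (rule circle_dist_le_offset)
    obtain u and k :: int where u: "\<bar>u\<bar> \<le> \<eta>" "crep y = - s / 2 + u + of_int k"
      using arc[of y "- s / 2"] \<open>y \<in> J False\<close> by (auto simp: J_def)
    obtain u' and k' :: int where u': "\<bar>u'\<bar> \<le> \<eta>" "crep y' = s / 2 + u' + of_int k'"
      using arc[of y' "s / 2"] \<open>y' \<in> J True\<close> by (auto simp: J_def)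
    \<comment> \<open>Being within \<open>r\<close> of each other would force an integer strictly
      between 0 and 1.\<close>
    define j where "j = k + m - k'"
    have "t + of_int j = s + u' - u" using t(2) u(2) u'(2) by (simp add: j_def)
    then have "0 < real_of_int j" "real_of_int j < 1" using t(1) u(1) u'(1) \<eta> by linarith+
    then show False by simp
  qed
  have J: "J \<sigma> \<in> sets circle_borel" "emeasure circle_uniform (J \<sigma>) = ennreal (2 * \<eta>)" for \<sigma>
    unfolding J_def using sets_circle_arc emeasure_circle_arc \<eta> by auto
  have S: "S \<in> sets circle_borel" "emeasure circle_uniform S = ennreal (2 * \<eta>)"
    unfolding S_def using \<eta> by (auto intro!: sets_circle_arc emeasure_circle_arc simp del: diff_minus_eq_add)
  define W where "W = Pi\<^sub>E A (\<lambda>_. S)"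
  have sub: "J \<sigma> \<subseteq> common_arc r A x" if "x \<in> W" for \<sigma> x
  proof
    fix y assume y: "y \<in> J \<sigma>"
    show "y \<in> common_arc r A x" unfolding common_arc_def
    proof (intro CollectI ballI)
      fix a assume "a \<in> A"
      then have "x a \<in> S" using that by (auto simp: W_def)
      then obtain t and k :: int where t: "\<bar>t\<bar> \<le> \<eta>" "crep (x a) = 0 + t + of_int k"
        using arc[of "x a" 0] unfolding S_def by auto
      obtain u and m :: int where u: "\<bar>u\<bar> \<le> \<eta>" "crep y = (if \<sigma> then s / 2 else - s / 2) + u + of_int m"
        using arc[of y "if \<sigma> then s / 2 else - s / 2"] y unfolding J_def by blast
      show "circle_dist y (x a) \<le> r"
        by (rule circle_dist_leI[of _ _ "m - k"]) (use t u \<eta> s r in auto)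
    qed
  qed
  show ?thesis
  proof (rule that)
    show "0 < 2 * \<eta>" "0 < (2 * \<eta>) ^ card A" using \<eta> by auto
    show "W \<in> sets (circles A)" unfolding W_def by (rule sets_PiM_I_finite) (use A S in auto)
    have "emeasure (circles A) W = (\<Prod>a\<in>A. emeasure circle_uniform S)"
      unfolding W_def by (rule circle_product.emeasure_PiM) (use A S in auto)
    then show "ennreal ((2 * \<eta>) ^ card A) \<le> emeasure (circles A) W"
      using \<eta> by (simp add: S ennreal_power)
    show "\<forall>\<sigma>. J \<sigma> \<in> sets circle_borel \<and> emeasure circle_uniform (J \<sigma>) = ennreal (2 * \<eta>)"
      using J by blast
    show "\<forall>x\<in>W. \<forall>\<sigma>. J \<sigma> \<subseteq> common_arc r A x" using sub by blast
    have "r < circle_dist y y'" if "\<sigma> \<noteq> \<sigma>'" "y \<in> J \<sigma>" "y' \<in> J \<sigma>'" for \<sigma> \<sigma>' y y'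
      using sep[of y y'] sep[of y' y] that circle_dist_commute[of y y'] by (cases \<sigma>; cases \<sigma>') auto
    then show "\<forall>\<sigma> \<sigma>'. \<sigma> \<noteq> \<sigma>' \<longrightarrow> (\<forall>y\<in>J \<sigma>. \<forall>y'\<in>J \<sigma>'. r < circle_dist y y')" by blast
  qed
qed

section \<open>Common cells and spread neighbours\<close>

interpretation torus_uniform: prob_space "torus_uniform D" for D
  by (rule prob_space_torus_uniform)

interpretation torus_product: product_sigma_finite "\<lambda>_. torus_uniform D" for D
  by (intro product_sigma_finite.intro prob_space_imp_sigma_finite prob_space_torus_uniform)

abbreviation tori :: "nat \<Rightarrow> 'i set \<Rightarrow> ('i \<Rightarrow> nat \<Rightarrow> circle) measure" where
  "tori D A \<equiv> PiM A (\<lambda>_. torus_uniform D)"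

definition torus_close :: "nat \<Rightarrow> real \<Rightarrow> (nat \<Rightarrow> circle) \<Rightarrow> (nat \<Rightarrow> circle) \<Rightarrow> bool" where
  "torus_close D r x y \<longleftrightarrow> (\<forall>i\<in>{1..D}. circle_dist (x i) (y i) \<le> r)"

lemma torus_dist_le_iff: "1 \<le> D \<Longrightarrow> torus_dist D x y \<le> r \<longleftrightarrow> torus_close D r x y"
  unfolding torus_dist_def torus_close_def by (subst Max_le_iff) auto

lemma torus_close_commute: "torus_close D r x y = torus_close D r y x"
  by (simp add: torus_close_def circle_dist_commute)

lemma space_torus_uniform: "space (torus_uniform D) = {1..D} \<rightarrow>\<^sub>E UNIV"
  by (simp add: torus_uniform_def space_PiM)

definition common_cell :: "nat \<Rightarrow> real \<Rightarrow> 'i set \<Rightarrow> ('i \<Rightarrow> nat \<Rightarrow> circle) \<Rightarrow> (nat \<Rightarrow> circle) set" where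
  "common_cell D r A x = Pi\<^sub>E {1..D} (\<lambda>i. common_arc r A (\<lambda>a. x a i))"

lemma mem_common_cell_iff:
  "y \<in> space (torus_uniform D) \<Longrightarrow> y \<in> common_cell D r A x \<longleftrightarrow> (\<forall>a\<in>A. torus_close D r y (x a))"
  by (auto simp: common_cell_def common_arc_def torus_close_def space_torus_uniform PiE_iff)

lemma sets_common_cell:
  assumes "finite A" "0 \<le> r" "r < 1/2"
  shows "common_cell D r A x \<in> sets (torus_uniform D)"
  unfolding common_cell_def torus_uniform_def
  by (rule sets_PiM_I_finite) (use sets_common_arc[OF assms] in auto)

lemma emeasure_torus_PiE:
  assumes "\<And>i. i \<in> {1..D} \<Longrightarrow> S i \<in> sets circle_borel"
  shows "emeasure (torus_uniform D) (Pi\<^sub>E {1..D} S) = (\<Prod>i\<in>{1..D}. emeasure circle_uniform (S i))"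
  unfolding torus_uniform_def by (rule circle_product.emeasure_PiM) (use assms in auto)

lemma measure_common_cell:
  assumes "finite A" "0 \<le> r" "r < 1/2"
  shows "measure (torus_uniform D) (common_cell D r A x)
    = (\<Prod>i\<in>{1..D}. measure circle_uniform (common_arc r A (\<lambda>a. x a i)))"
  unfolding measure_def common_cell_def
  by (subst emeasure_torus_PiE) (use sets_common_arc[OF assms] in \<open>auto simp: circle_uniform.emeasure_eq_measure prod_ennreal prod_nonneg\<close>)

text \<open>Centres \<open>x\<close> and candidate neighbours \<open>y\<close> are separate
  arguments, so that the centres can be fixed while the neighbours are averaged. Distinctness is
  explicit because, for \<open>r \<ge> 0\<close>, \<open>torus_close\<close> is reflexive whereas
  the graph has no loops.\<close>

definition spread :: "nat \<Rightarrow> real \<Rightarrow> 'i set \<Rightarrow> ('i \<Rightarrow> nat \<Rightarrow> circle) \<Rightarrow> nat set \<Rightarrow> (nat \<Rightarrow> nat \<Rightarrow> circle) \<Rightarrow> bool" where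
  "spread D r A x B y \<longleftrightarrow> (let N = {w\<in>B. y w \<in> common_cell D r A x} in
     card N = M_dim D \<and> (\<forall>u\<in>N. \<forall>w\<in>N. u \<noteq> w \<longrightarrow> \<not> torus_close D r (y u) (y w)))"

text \<open>The graph is loopless, so none of the vertices \<open>1, ..., q\<close> is adjacent to
  all of them, and the common neighbours are found among the remaining vertices. Distinctness of the
  \<open>q\<close> vertices holds since each variable is evaluated at its own index.\<close>

lemma models_Theta_iff_spread:
  assumes D: "1 \<le> D" and q: "q \<le> n" and X: "X \<in> space (torus_sample D n)"
  shows "models (torus_graph D n r X) (\<lambda>a. a) (Theta D q) \<longleftrightarrow> spread D r {1..q} X {q+1..n} X"
proof -
  let ?G = "torus_graph D n r X"
  have adj: "snd ?G u w \<longleftrightarrow> u \<in> {1..n} \<and> w \<in> {1..n} \<and> u \<noteq> w \<and> torus_close D r (X u) (X w)" for u w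
    by (simp add: torus_graph_def torus_dist_le_iff[OF D])
  have N: "{w \<in> fst ?G. \<forall>a\<in>{1..q}. snd ?G w a} = {w\<in>{q+1..n}. X w \<in> common_cell D r {1..q} X}"
  proof (intro set_eqI iffI)
    fix w assume w: "w \<in> {w \<in> fst ?G. \<forall>a\<in>{1..q}. snd ?G w a}"
    then have w1: "w \<in> {1..n}" by (simp add: torus_graph_def)
    then have "X w \<in> space (torus_uniform D)" using X by (auto simp: torus_sample_def space_PiM)
    moreover have "w \<notin> {1..q}" using w adj by blast
    ultimately show "w \<in> {w\<in>{q+1..n}. X w \<in> common_cell D r {1..q} X}"
      using w w1 adj by (auto simp: mem_common_cell_iff)
  next
    fix w assume w: "w \<in> {w\<in>{q+1..n}. X w \<in> common_cell D r {1..q} X}"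
    then have w1: "w \<in> {1..n}" by auto
    then have "X w \<in> space (torus_uniform D)" using X by (auto simp: torus_sample_def space_PiM)
    then show "w \<in> {w \<in> fst ?G. \<forall>a\<in>{1..q}. snd ?G w a}"
      using w w1 adj q by (auto simp: mem_common_cell_iff torus_graph_def)
  qed
  have "models ?G (\<lambda>a. a) (Theta D q) \<longleftrightarrow> inj_on (\<lambda>a. a) {1..q} \<and>
      card {w \<in> fst ?G. \<forall>a\<in>{1..q}. snd ?G w a} = M_dim D \<and>
      (\<forall>u\<in>{w \<in> fst ?G. \<forall>a\<in>{1..q}. snd ?G w a}. \<forall>w\<in>{w \<in> fst ?G. \<forall>a\<in>{1..q}. snd ?G w a}. \<not> snd ?G u w)"
    by (rule models_Theta_iff) (auto simp: adj torus_close_commute)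
  then show ?thesis unfolding N spread_def Let_def by (auto simp: adj)
qed

lemma spread_cong:
  assumes "\<And>a. a \<in> A \<Longrightarrow> x a = x' a" "\<And>w. w \<in> B \<Longrightarrow> y w = y' w"
  shows "spread D r A x B y = spread D r A x' B y'"
proof -
  have "common_arc r A (\<lambda>a. x a i) = common_arc r A (\<lambda>a. x' a i)" for i
    using assms(1) by (auto simp: common_arc_def)
  then have "common_cell D r A x = common_cell D r A x'" by (simp add: common_cell_def)
  then have "{w\<in>B. y w \<in> common_cell D r A x} = {w\<in>B. y' w \<in> common_cell D r A x'}" using assms(2) by auto
  then show ?thesis unfolding spread_def Let_def using assms(2) by auto
qed

section \<open>Measurability of the spread event and its disintegration over the centres\<close>

lemma measurable_torus_close:
  assumes "u \<in> A" "w \<in> A" "0 \<le> r" "r < 1/2"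
  shows "Measurable.pred (tori D A) (\<lambda>X. torus_close D r (X u) (X w))"
  unfolding torus_close_def circle_dist_le_iff_frac[OF assms(3,4)]
proof (intro pred_intros_finite)
  fix i assume i: "i \<in> {1..D}"
  have c: "(\<lambda>X. crep (X v i)) \<in> borel_measurable (tori D A)" if "v \<in> A" for v
    unfolding torus_uniform_def
    by (rule measurable_compose[OF measurable_component_component[OF that i]]) simp
  note [measurable] = c[OF assms(1)] c[OF assms(2)]
  show "Measurable.pred (tori D A) (\<lambda>X. frac (crep (X u i) - crep (X w i) + r) \<le> 2 * r)"
    by measurable
qed simp

text \<open>The set of neighbours is random, so the event is split over its finitely many possible
  values \<open>S\<close>; for fixed \<open>S\<close> it is a finite Boolean combination of
  closeness conditions.\<close>

lemma sets_spread:
  assumes A: "finite A" "finite B" "0 \<le> r" "r < 1/2"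
  shows "{X \<in> space (tori D (A \<union> B)). spread D r A X B X} \<in> sets (tori D (A \<union> B))"
proof -
  let ?M = "tori D (A \<union> B)"
  define P where "P X S \<longleftrightarrow> card S = M_dim D \<and> (\<forall>w\<in>B. w \<in> S \<longleftrightarrow> (\<forall>a\<in>A. torus_close D r (X w) (X a)))
      \<and> (\<forall>u\<in>B. \<forall>w\<in>B. u \<in> S \<and> w \<in> S \<and> u \<noteq> w \<longrightarrow> \<not> torus_close D r (X u) (X w))" for X S
  have "Measurable.pred ?M (\<lambda>X. \<exists>S\<in>Pow B. P X S)"
  proof (intro pred_intros_finite)
    fix S
    have [measurable]: "Measurable.pred ?M (\<lambda>X. torus_close D r (X u) (X w))"
      if "u \<in> A \<union> B" "w \<in> A \<union> B" for u w by (rule measurable_torus_close) (use that A in auto)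
    show "Measurable.pred ?M (\<lambda>X. P X S)" unfolding P_def
      by (intro pred_intros_logic pred_intros_finite A) auto
  qed (use A in auto)
  then have "{X \<in> space ?M. \<exists>S\<in>Pow B. P X S} \<in> sets ?M" by (rule predE)
  also have "{X \<in> space ?M. \<exists>S\<in>Pow B. P X S} = {X \<in> space ?M. spread D r A X B X}"
  proof (intro Collect_cong conj_cong refl)
    fix X assume X: "X \<in> space ?M"
    have "X w \<in> common_cell D r A X \<longleftrightarrow> (\<forall>a\<in>A. torus_close D r (X w) (X a))" if "w \<in> B" for w
      by (rule mem_common_cell_iff) (use X that in \<open>auto simp: space_PiM\<close>)
    then have N: "{w\<in>B. X w \<in> common_cell D r A X} = {w\<in>B. \<forall>a\<in>A. torus_close D r (X w) (X a)}"
      by auto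
    show "(\<exists>S\<in>Pow B. P X S) \<longleftrightarrow> spread D r A X B X"
    proof
      assume "\<exists>S\<in>Pow B. P X S"
      then obtain S where S: "S \<subseteq> B" "P X S" by blast
      then have "S = {w\<in>B. \<forall>a\<in>A. torus_close D r (X w) (X a)}" by (auto simp: P_def)
      then show "spread D r A X B X" unfolding spread_def N Let_def using S by (auto simp: P_def)
    next
      assume "spread D r A X B X"
      then show "\<exists>S\<in>Pow B. P X S"
        by (intro bexI[of _ "{w\<in>B. \<forall>a\<in>A. torus_close D r (X w) (X a)}"])
           (auto simp: spread_def N Let_def P_def)
    qed
  qed
  finally show ?thesis .
qed

text \<open>The same splitting for an arbitrary fixed \<open>x\<close>, with membership in the cell
  in place of closeness to the centres.\<close>

lemma sets_spread_section:
  assumes A: "finite A" "finite B" "0 \<le> r" "r < 1/2"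
  shows "{y \<in> space (tori D B). spread D r A x B y} \<in> sets (tori D B)"
proof -
  define P where "P y S \<longleftrightarrow> card S = M_dim D \<and> (\<forall>w\<in>B. w \<in> S \<longleftrightarrow> y w \<in> common_cell D r A x)
      \<and> (\<forall>u\<in>B. \<forall>w\<in>B. u \<in> S \<and> w \<in> S \<and> u \<noteq> w \<longrightarrow> \<not> torus_close D r (y u) (y w))" for y S
  note [measurable] = sets_common_cell[OF A(1,3,4)]
  have "Measurable.pred (tori D B) (\<lambda>y. \<exists>S\<in>Pow B. P y S)"
  proof (intro pred_intros_finite)
    fix S
    show "Measurable.pred (tori D B) (\<lambda>y. P y S)" unfolding P_def
      by (intro pred_intros_logic pred_intros_finite A) (auto intro!: measurable_torus_close A)
  qed (use A in auto)
  then have "{y \<in> space (tori D B). \<exists>S\<in>Pow B. P y S} \<in> sets (tori D B)" by (rule predE)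
  also have "{y \<in> space (tori D B). \<exists>S\<in>Pow B. P y S} = {y \<in> space (tori D B). spread D r A x B y}"
  proof (intro Collect_cong conj_cong refl)
    fix y
    show "(\<exists>S\<in>Pow B. P y S) \<longleftrightarrow> spread D r A x B y"
    proof
      assume "\<exists>S\<in>Pow B. P y S"
      then obtain S where S: "S \<subseteq> B" "P y S" by blast
      then have "S = {w\<in>B. y w \<in> common_cell D r A x}" by (auto simp: P_def)
      then show "spread D r A x B y" unfolding spread_def Let_def using S by (auto simp: P_def)
    next
      assume "spread D r A x B y"
      then show "\<exists>S\<in>Pow B. P y S"
        by (intro bexI[of _ "{w\<in>B. y w \<in> common_cell D r A x}"]) (auto simp: spread_def Let_def P_def)
    qed
  qed
  finally show ?thesis .
qed

lemma emeasure_spread: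
  assumes A: "finite A" "finite B" "A \<inter> B = {}" "0 \<le> r" "r < 1/2"
  shows "emeasure (tori D (A \<union> B)) {X \<in> space (tori D (A \<union> B)). spread D r A X B X}
    = (\<integral>\<^sup>+x. emeasure (tori D B) {y \<in> space (tori D B). spread D r A x B y} \<partial>tori D A)"
proof -
  let ?E = "{X \<in> space (tori D (A \<union> B)). spread D r A X B X}"
  have E [measurable]: "?E \<in> sets (tori D (A \<union> B))" by (rule sets_spread) (use A in auto)
  have "emeasure (tori D (A \<union> B)) ?E = (\<integral>\<^sup>+X. indicator ?E X \<partial>tori D (A \<union> B))" by simp
  also have "\<dots> = (\<integral>\<^sup>+x. \<integral>\<^sup>+y. indicator ?E (merge A B (x, y)) \<partial>tori D B \<partial>tori D A)"
    by (rule torus_product.product_nn_integral_fold) (use A in auto)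
  also have "\<dots> = (\<integral>\<^sup>+x. emeasure (tori D B) {y \<in> space (tori D B). spread D r A x B y} \<partial>tori D A)"
  proof (intro nn_integral_cong)
    fix x assume x: "x \<in> space (tori D A)"
    have "(\<integral>\<^sup>+y. indicator ?E (merge A B (x, y)) \<partial>tori D B)
        = (\<integral>\<^sup>+y. indicator {y \<in> space (tori D B). spread D r A x B y} y \<partial>tori D B)"
    proof (intro nn_integral_cong)
      fix y assume y: "y \<in> space (tori D B)"
      have "merge A B (x, y) \<in> space (tori D (A \<union> B))"
        using x y A(3) by (auto simp: space_PiM PiE_iff merge_def extensional_def)
      moreover have "spread D r A (merge A B (x, y)) B (merge A B (x, y)) = spread D r A x B y"
        by (rule spread_cong) (use A(3) in \<open>auto simp: merge_def\<close>)
      ultimately show "(indicator ?E (merge A B (x, y)) :: ennreal)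
          = indicator {y \<in> space (tori D B). spread D r A x B y} y"
        using y by (simp add: indicator_def)
    qed
    then show "(\<integral>\<^sup>+y. indicator ?E (merge A B (x, y)) \<partial>tori D B)
        = emeasure (tori D B) {y \<in> space (tori D B). spread D r A x B y}"
      using sets_spread_section[OF A(1,2,4,5)] by simp
  qed
  finally show ?thesis .
qed

section \<open>Binomial weights and \<open>decay\<close>\<close>

lemma power_over_fact_le_exp:
  fixes x :: real
  assumes "0 \<le> x"
  shows "x ^ k / fact k \<le> exp x"
proof -
  have s: "(\<lambda>n. x ^ n /\<^sub>R fact n) sums exp x" by (rule exp_converges)
  have "(\<Sum>n\<in>{k}. x ^ n /\<^sub>R fact n) \<le> (\<Sum>n. x ^ n /\<^sub>R fact n)"
    by (rule sum_le_suminf[OF sums_summable[OF s]]) (use assms in auto)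
  then show ?thesis using sums_unique[OF s] by (simp add: divide_inverse mult.commute)
qed

text \<open>With \<open>t = n * V\<close>, the binomial coefficient is at most \<open>n ^ M\<close>,
  and \<open>n - p - M \<ge> n / 2\<close> bounds the last power by \<open>exp (- t / 2)\<close>.
  The exponential absorbs \<open>(1 + t) ^ (M + 2)\<close>, whose two surplus powers form
  \<open>decay t\<close>.\<close>

lemma choose_power_le_decay:
  fixes V :: real
  assumes V: "0 \<le> V" "V \<le> 1" and n: "2 * (p + M) \<le> n"
  shows "real ((n - p) choose M) * (V ^ M * (1 - V) ^ (n - p - M))
    \<le> 2 ^ (M + 2) * fact (M + 2) * exp (1 / 2) * decay (real n * V)"
proof -
  define t where "t = real n * V"
  have t: "0 \<le> t" using V by (simp add: t_def)
  have "real ((n - p) choose M) \<le> real ((n - p) ^ M)"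
    using n by (intro of_nat_mono binomial_le_pow) auto
  also have "\<dots> \<le> real n ^ M" by (simp add: power_mono)
  finally have c: "real ((n - p) choose M) \<le> real n ^ M" .
  have "(1 - V) ^ (n - p - M) \<le> exp (- V) ^ (n - p - M)"
    using V exp_ge_add_one_self[of "- V"] by (intro power_mono) auto
  also have "\<dots> = exp (- (real (n - p - M) * V))" by (simp flip: exp_of_nat_mult)
  also have "\<dots> \<le> exp (- (t / 2))"
  proof -
    have "real n / 2 \<le> real (n - p - M)" using n by simp
    then have "real n / 2 * V \<le> real (n - p - M) * V" using V by (intro mult_right_mono) auto
    then show ?thesis by (simp add: t_def)
  qed
  finally have e: "(1 - V) ^ (n - p - M) \<le> exp (- (t / 2))" .
  have "real ((n - p) choose M) * (V ^ M * (1 - V) ^ (n - p - M)) \<le> real n ^ M * (V ^ M * exp (- (t / 2)))"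
    using c e V by (intro mult_mono) auto
  also have "\<dots> = t ^ M * exp (- (t / 2))" by (simp add: t_def power_mult_distrib)
  also have "\<dots> \<le> (1 + t) ^ M * exp (- (t / 2))" using t by (intro mult_right_mono power_mono) auto
  also have "\<dots> = (1 + t) ^ (M + 2) * exp (- (t / 2)) * decay t"
  proof -
    have eq: "(1 + t) ^ (M + 2) * decay t = (1 + t) ^ M" using t by (simp only: power_add decay_def) simp
    have "(1 + t) ^ (M + 2) * exp (- (t / 2)) * decay t = ((1 + t) ^ (M + 2) * decay t) * exp (- (t / 2))"
      by (simp only: mult_ac)
    then show ?thesis by (simp only: eq)
  qed
  \<comment> \<open>The constant comes from comparing \<open>exp\<close> at
    \<open>(1 + t) / 2\<close> with its Taylor term of order \<open>M + 2\<close>.\<close>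
  also have "\<dots> \<le> (2 ^ (M + 2) * fact (M + 2) * exp ((1 + t) / 2)) * exp (- (t / 2)) * decay t"
  proof (intro mult_right_mono)
    have "((1 + t) / 2) ^ (M + 2) / fact (M + 2) \<le> exp ((1 + t) / 2)"
      using t by (intro power_over_fact_le_exp) simp
    then have "((1 + t) / 2) ^ (M + 2) \<le> fact (M + 2) * exp ((1 + t) / 2)"
      by (simp add: divide_le_eq mult.commute)
    then show "(1 + t) ^ (M + 2) \<le> 2 ^ (M + 2) * fact (M + 2) * exp ((1 + t) / 2)"
      by (simp add: power_divide divide_le_eq mult_ac)
  qed auto
  also have "\<dots> = 2 ^ (M + 2) * fact (M + 2) * exp (1 / 2) * decay t"
    by (simp add: add_divide_distrib exp_add exp_minus)
  finally show ?thesis by (simp add: t_def)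
qed

section \<open>The upper bound\<close>

text \<open>Only the number of points in the cell is kept, non-adjacency is dropped; what remains is
  a union bound over the index sets of size \<open>M_dim D\<close>, a binomial point
  probability.\<close>

lemma emeasure_spread_section_le:
  fixes D :: nat and B :: "nat set" and x :: "'i \<Rightarrow> nat \<Rightarrow> circle"
  assumes A: "finite A" and B: "finite B" and r: "0 \<le> r" "r < 1/2"
  defines "V \<equiv> measure (torus_uniform D) (common_cell D r A x)"
  shows "emeasure (tori D B) {y \<in> space (tori D B). spread D r A x B y}
    \<le> ennreal (real (card B choose M_dim D) * (V ^ M_dim D * (1 - V) ^ (card B - M_dim D)))"
proof -
  let ?M = "M_dim D" and ?C = "common_cell D r A x" and ?T = "torus_uniform D"
  define \<S> where "\<S> = {S. S \<subseteq> B \<and> card S = ?M}"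
  define F where "F S = Pi\<^sub>E B (\<lambda>j. if j \<in> S then ?C else space ?T - ?C)" for S
  note C = sets_common_cell[OF A r, of D x]
  have V: "0 \<le> V" "V \<le> 1" by (simp_all add: V_def)
  have emC: "emeasure ?T ?C = ennreal V" "emeasure ?T (space ?T - ?C) = ennreal (1 - V)"
    using C torus_uniform.prob_compl[OF C] by (auto simp: V_def torus_uniform.emeasure_eq_measure)
  have sub: "{y \<in> space (tori D B). spread D r A x B y} \<subseteq> (\<Union>S\<in>\<S>. F S)"
  proof
    fix y assume y: "y \<in> {y \<in> space (tori D B). spread D r A x B y}"
    define N where "N = {w\<in>B. y w \<in> ?C}"
    have "N \<in> \<S>" using y by (auto simp: \<S>_def N_def spread_def Let_def)
    moreover have "y \<in> F N" using y by (auto simp: F_def N_def space_PiM PiE_iff)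
    ultimately show "y \<in> (\<Union>S\<in>\<S>. F S)" by blast
  qed
  have F: "F S \<in> sets (tori D B)" for S
    unfolding F_def by (rule sets_PiM_I_finite) (use B C in auto)
  have emF: "emeasure (tori D B) (F S) = ennreal (V ^ ?M * (1 - V) ^ (card B - ?M))" if S: "S \<in> \<S>" for S
  proof -
    have S: "S \<subseteq> B" "card S = ?M" "finite S" using S B by (auto simp: \<S>_def intro: finite_subset)
    have "emeasure (tori D B) (F S) = (\<Prod>j\<in>B. emeasure ?T (if j \<in> S then ?C else space ?T - ?C))"
      unfolding F_def by (rule torus_product.emeasure_PiM) (use B C in auto)
    also have "\<dots> = (\<Prod>j\<in>B. ennreal (if j \<in> S then V else 1 - V))"
      by (intro prod.cong refl) (simp add: emC)
    also have "\<dots> = ennreal (\<Prod>j\<in>B. if j \<in> S then V else 1 - V)" by (rule prod_ennreal) (use V in auto)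
    also have "(\<Prod>j\<in>B. if j \<in> S then V else 1 - V) = V ^ ?M * (1 - V) ^ (card B - ?M)"
    proof -
      have "B \<inter> {j. j \<in> S} = S" "B \<inter> - {j. j \<in> S} = B - S" using S by auto
      then show ?thesis using B S by (simp add: prod.If_cases card_Diff_subset)
    qed
    finally show ?thesis .
  qed
  have "emeasure (tori D B) {y \<in> space (tori D B). spread D r A x B y} \<le> emeasure (tori D B) (\<Union>S\<in>\<S>. F S)"
    by (rule emeasure_mono[OF sub]) (use F B in \<open>auto simp: \<S>_def\<close>)
  also have "\<dots> \<le> (\<Sum>S\<in>\<S>. emeasure (tori D B) (F S))"
    by (rule emeasure_subadditive_finite) (use F B in \<open>auto simp: \<S>_def\<close>)
  also have "\<dots> = (\<Sum>S\<in>\<S>. ennreal (V ^ ?M * (1 - V) ^ (card B - ?M)))" by (intro sum.cong refl emF)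
  also have "\<dots> = ennreal (real (card B choose ?M) * (V ^ ?M * (1 - V) ^ (card B - ?M)))"
    using V n_subsets[OF B, of ?M] by (simp add: \<S>_def ennreal_mult ennreal_of_nat_eq_real_of_nat)
  finally show ?thesis .
qed

text \<open>
  A coordinate in which the common arc is a clique does not help to separate common neighbours, and
  every other coordinate only contributes the side on which the point lies of a fixed centre.
\<close>

lemma not_spread_if_two_cliques:
  assumes ij: "i \<in> {1..D}" "j \<in> {1..D}" "i \<noteq> j" and A: "A \<noteq> {}"
    and clique: "\<And>l p p'. l \<in> {i, j} \<Longrightarrow> p \<in> common_arc r A (\<lambda>a. x a l) \<Longrightarrow>
      p' \<in> common_arc r A (\<lambda>a. x a l) \<Longrightarrow> circle_dist p p' \<le> r"
  shows "\<not> spread D r A x B y"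
proof
  assume sp: "spread D r A x B y"
  define N where "N = {w\<in>B. y w \<in> common_cell D r A x}"
  have cN: "card N = M_dim D" and sep: "\<And>u w. u \<in> N \<Longrightarrow> w \<in> N \<Longrightarrow> u \<noteq> w \<Longrightarrow> \<not> torus_close D r (y u) (y w)"
    using sp by (auto simp: spread_def Let_def N_def)
  obtain a where a: "a \<in> A" using A by blast
  have arc: "y w l \<in> common_arc r A (\<lambda>a. x a l)" if "w \<in> N" "l \<in> {1..D}" for w l
    using that by (auto simp: N_def common_cell_def)
  \<comment> \<open>The sign of an offset from \<open>y w\<close> to the fixed centre
    \<open>x a\<close>. Two offsets on the same side both lie in \<open>[0, r]\<close> or both in
    \<open>[-r, 0]\<close>, hence differ by at most \<open>r\<close>.\<close>
  define side where "side w l \<longleftrightarrow> (\<exists>t. \<exists>k::int. 0 \<le> t \<and> t \<le> r \<and> crep (x a l) = crep (y w l) + t + of_int k)" for w l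
  have same: "circle_dist (y u l) (y w l) \<le> r"
    if uw: "u \<in> N" "w \<in> N" "l \<in> {1..D}" and eq: "side u l = side w l" for u w l
  proof -
    have off: "\<exists>t. \<exists>k::int. \<bar>t\<bar> \<le> r \<and> crep (x a l) = crep (y v l) + t + of_int k \<and> (if side v l then 0 \<le> t else t \<le> 0)"
      if "v \<in> N" for v
    proof (cases "side v l")
      case True
      then show ?thesis unfolding side_def by (metis abs_of_nonneg)
    next
      case False
      have "circle_dist (y v l) (x a l) \<le> r" using arc[OF that uw(3)] a by (auto simp: common_arc_def)
      then obtain t and k :: int where t: "\<bar>t\<bar> \<le> r" "crep (x a l) = crep (y v l) + t + of_int k"
        by (rule circle_dist_le_offset)
      then have "t \<le> 0" using False unfolding side_def by (meson abs_le_D1 linear)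
      then show ?thesis using t False by (intro exI[of _ t] exI[of _ k]) auto
    qed
    obtain t and k :: int where t: "\<bar>t\<bar> \<le> r" "crep (x a l) = crep (y u l) + t + of_int k" "if side u l then 0 \<le> t else t \<le> 0"
      using off[OF uw(1)] by blast
    obtain t' and k' :: int where t': "\<bar>t'\<bar> \<le> r" "crep (x a l) = crep (y w l) + t' + of_int k'" "if side w l then 0 \<le> t' else t' \<le> 0"
      using off[OF uw(2)] by blast
    show ?thesis
      by (rule circle_dist_leI[of _ _ "k' - k"]) (use t t' eq in \<open>auto split: if_splits\<close>)
  qed
  \<comment> \<open>Two points with the same sides outside \<open>{i, j}\<close> are close in every
    coordinate, so \<phi> is injective on \<open>N\<close>, yet it takes at most
    \<open>2 ^ (D - 2)\<close> values.\<close>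
  define \<phi> where "\<phi> w = restrict (side w) ({1..D} - {i, j})" for w
  have "inj_on \<phi> N"
  proof (rule inj_onI, rule ccontr)
    fix u w assume uw: "u \<in> N" "w \<in> N" "\<phi> u = \<phi> w" "u \<noteq> w"
    have "circle_dist (y u l) (y w l) \<le> r" if l: "l \<in> {1..D}" for l
    proof (cases "l \<in> {i, j}")
      case True
      then show ?thesis using clique arc uw l by blast
    next
      case False
      then have "\<phi> u l = side u l" "\<phi> w l = side w l" using l by (simp_all add: \<phi>_def)
      then have "side u l = side w l" using uw(3) by simp
      then show ?thesis by (rule same[OF uw(1,2) l])
    qed
    then show False using sep[OF uw(1,2,4)] by (auto simp: torus_close_def)
  qed
  moreover have "\<phi> ` N \<subseteq> Pi\<^sub>E ({1..D} - {i, j}) (\<lambda>_. UNIV)" by (auto simp: \<phi>_def)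
  moreover have "finite (Pi\<^sub>E ({1..D} - {i, j}) (\<lambda>_. UNIV :: bool set))" by (intro finite_PiE) auto
  ultimately have "card N \<le> card (Pi\<^sub>E ({1..D} - {i, j}) (\<lambda>_. UNIV :: bool set))"
    by (rule card_inj_on_le)
  also have "\<dots> = 2 ^ (D - 2)"
    using ij by (simp add: card_PiE card_Diff_subset card_UNIV_bool)
  finally show False using cN by (simp add: M_dim_def)
qed

text \<open>The contribution of \<open>i\<close> as the possibly thin coordinate. \<open>W\<close>
  bounds the product of the other lengths from below, and the length in coordinate \<open>i\<close>
  is at least some slack: the first term is the case of equal extremes with slack
  \<open>2 * r\<close>, and summing over all pairs avoids a measurable choice of the extreme
  one.\<close>

definition spread_bound :: "nat \<Rightarrow> real \<Rightarrow> 'i set \<Rightarrow> real \<Rightarrow> (nat \<Rightarrow> 'i \<Rightarrow> circle) \<Rightarrow> nat \<Rightarrow> ennreal" where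
  "spread_bound D r A n z i = (let W = \<Prod>l\<in>{1..D} - {i}. wide_length r A (z l) in
     ennreal (decay (n * W * (2 * r))) +
     (\<Sum>p\<in>{p\<in>A \<times> A. fst p \<noteq> snd p}. ennreal (decay (n * W * slack r (z i) (fst p) (snd p)))))"

lemma emeasure_spread_section_le_bound:
  fixes x :: "nat \<Rightarrow> nat \<Rightarrow> circle"
  assumes D: "1 \<le> D" and q: "1 \<le> q" and r: "0 < r" "r < 1/2" and n: "2 * (q + M_dim D) \<le> n"
  defines "z \<equiv> \<lambda>i\<in>{1..D}. \<lambda>a\<in>{1..q}. x a i"
  shows "emeasure (tori D {q+1..n}) {y \<in> space (tori D {q+1..n}). spread D r {1..q} x {q+1..n} y}
    \<le> ennreal (2 ^ (M_dim D + 2) * fact (M_dim D + 2) * exp (1 / 2)) *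
       (\<Sum>i\<in>{1..D}. spread_bound D r {1..q} (real n) z i)"
    (is "?L \<le> ennreal ?K * ?R")
\<comment> \<open>If some \<open>y\<close> is spread, then \<open>x\<close> itself has nonempty
  common arcs and at most one clique coordinate; otherwise the section is empty.\<close>
proof (cases "\<exists>y. spread D r {1..q} x {q+1..n} y")
  case False
  then show ?thesis by simp
next
  case True
  then obtain y where sp: "spread D r {1..q} x {q+1..n} y" by blast
  let ?A = "{1..q}"
  define V where "V = measure (torus_uniform D) (common_cell D r ?A x)"
  define L where "L i = measure circle_uniform (common_arc r ?A (z i))" for i
  have A: "finite ?A" "?A \<noteq> {}" using q by auto
  have r': "0 \<le> r" "r < 1/2" using r by auto
  have z: "common_arc r ?A (\<lambda>a. x a i) = common_arc r ?A (z i)" if "i \<in> {1..D}" for i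
    using that by (auto simp: common_arc_def z_def)
  have V: "V = (\<Prod>i\<in>{1..D}. L i)"
    unfolding V_def L_def measure_common_cell[OF A(1) r'] by (intro prod.cong refl) (simp only: z)
  have ne: "common_arc r ?A (z i) \<noteq> {}" if i: "i \<in> {1..D}" for i
  proof
    assume "common_arc r ?A (z i) = {}"
    then have "common_cell D r ?A x = {}" using i z[OF i] by (auto simp: common_cell_def PiE_eq_empty_iff)
    then show False using sp by (simp add: spread_def Let_def M_dim_def)
  qed
  define clique where "clique i \<longleftrightarrow> (\<forall>p\<in>common_arc r ?A (z i). \<forall>p'\<in>common_arc r ?A (z i). circle_dist p p' \<le> r)" for i
  have two: "\<not> (clique i \<and> clique j)" if "i \<in> {1..D}" "j \<in> {1..D}" "i \<noteq> j" for i j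
  proof
    assume "clique i \<and> clique j"
    then have "\<not> spread D r ?A x {q+1..n} y"
      by (intro not_spread_if_two_cliques[OF that A(2)]) (use z that in \<open>auto simp: clique_def\<close>)
    then show False using sp by simp
  qed
  \<comment> \<open>The only clique coordinate, or an arbitrary one if there is none: the bound on
    the length in coordinate \<open>i\<close> uses only that its common arc is nonempty.\<close>
  obtain i where i: "i \<in> {1..D}" "\<And>l. l \<in> {1..D} - {i} \<Longrightarrow> \<not> clique l"
  proof (cases "\<exists>i\<in>{1..D}. clique i")
    case True
    then show ?thesis using two that by blast
  next
    case False
    then show ?thesis using D that[of 1] by auto
  qed
  define W where "W = (\<Prod>l\<in>{1..D} - {i}. wide_length r ?A (z l))"
  have W0: "0 \<le> W" unfolding W_def by (intro prod_nonneg) (use wide_length_nonneg A r in auto)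
  have "W \<le> (\<Prod>l\<in>{1..D} - {i}. L l)" unfolding W_def
  proof (intro prod_mono conjI)
    fix l assume l: "l \<in> {1..D} - {i}"
    show "0 \<le> wide_length r ?A (z l)" using wide_length_nonneg A r by auto
    obtain p p' where "p \<in> common_arc r ?A (z l)" "p' \<in> common_arc r ?A (z l)" "circle_dist p p' > r"
      using i(2)[OF l] by (auto simp: clique_def not_le)
    then show "wide_length r ?A (z l) \<le> L l" unfolding L_def by (rule wide_length_le[OF A r])
  qed
  moreover have "V = L i * (\<Prod>l\<in>{1..D} - {i}. L l)" unfolding V by (rule prod.remove) (use i in auto)
  ultimately have VW: "W * s \<le> V" if "0 \<le> s" "s \<le> L i" for s
    using mult_mono[of W "\<Prod>l\<in>{1..D} - {i}. L l" s "L i"] that W0 by (simp add: mult.commute L_def prod_nonneg)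
  have dec: "decay (real n * V) \<le> decay (real n * W * s)" if "0 \<le> s" "s \<le> L i" for s
    using VW[OF that] that W0 by (intro decay_antimono) (auto simp: mult.assoc intro: mult_left_mono)
  have "ennreal (decay (real n * V)) \<le> spread_bound D r ?A (real n) z i"
  proof -
    obtain p where "p \<in> common_arc r ?A (z i)" using ne[OF i(1)] by blast
    from slack_le_common_arc[OF A r' this] obtain a b where ab: "a \<in> ?A" "b \<in> ?A" "slack r (z i) a b \<le> L i"
      unfolding L_def by metis
    show ?thesis
    proof (cases "a = b")
      case True
      then have "2 * r \<le> L i" using ab slack_self[OF r', of "z i" b] by simp
      then have "ennreal (decay (real n * V)) \<le> ennreal (decay (real n * W * (2 * r)))"
        using dec[of "2 * r"] r by (intro ennreal_leI) simp
      then show ?thesis unfolding spread_bound_def Let_def W_def[symmetric] by (rule add_increasing2[rotated]) simp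
    next
      case False
      let ?f = "\<lambda>p. ennreal (decay (real n * W * slack r (z i) (fst p) (snd p)))"
      have "ennreal (decay (real n * V)) \<le> ?f (a, b)" using dec[of "slack r (z i) a b"] ab by (intro ennreal_leI) simp
      also have "\<dots> \<le> (\<Sum>p\<in>{p\<in>?A \<times> ?A. fst p \<noteq> snd p}. ?f p)"
        by (rule member_le_sum) (use ab False in auto)
      finally show ?thesis unfolding spread_bound_def Let_def W_def[symmetric] by (rule add_increasing[rotated]) simp
    qed
  qed
  also have "\<dots> \<le> ?R" by (rule member_le_sum) (use i in auto)
  finally have R: "ennreal (decay (real n * V)) \<le> ?R" .
  have "?L \<le> ennreal (real (card {q+1..n} choose M_dim D) * (V ^ M_dim D * (1 - V) ^ (card {q+1..n} - M_dim D)))"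
    unfolding V_def by (rule emeasure_spread_section_le) (use r' in auto)
  also have "\<dots> \<le> ennreal (?K * decay (real n * V))"
    using choose_power_le_decay[of V q "M_dim D" n] n by (intro ennreal_leI) (auto simp: V_def)
  also have "\<dots> = ennreal ?K * ennreal (decay (real n * V))" by (rule ennreal_mult) auto
  also have "\<dots> \<le> ennreal ?K * ?R" by (intro mult_left_mono R) auto
  finally show ?thesis .
qed

section \<open>Averaging the bound over the centres\<close>

interpretation circles_product: product_sigma_finite "\<lambda>_. circles A" for A
  by (intro product_sigma_finite.intro prob_space_imp_sigma_finite prob_space_circles)

lemma ennreal_inverse_prod:
  assumes "\<And>i. i \<in> I \<Longrightarrow> 0 \<le> g i"
  shows "inverse (ennreal (\<Prod>i\<in>I. g i)) = (\<Prod>i\<in>I. inverse (ennreal (g i)))"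
  using assms
proof (induction I rule: infinite_finite_induct)
  case (insert i I)
  then show ?case by (simp add: ennreal_mult prod_nonneg ennreal_inverse_mult)
qed simp_all

lemma measurable_spread_bound:
  assumes A: "finite A" and i: "i \<in> {1..D}"
  shows "(\<lambda>z. spread_bound D r A n z i) \<in> borel_measurable (PiM {1..D} (\<lambda>_. circles A))"
proof -
  let ?M = "PiM {1..D} (\<lambda>_. circles A)"
  have W [measurable]: "(\<lambda>z. \<Prod>l\<in>{1..D} - {i}. wide_length r A (z l)) \<in> borel_measurable ?M"
  proof (rule borel_measurable_prod)
    fix l assume "l \<in> {1..D} - {i}"
    then show "(\<lambda>z. wide_length r A (z l)) \<in> borel_measurable ?M"
      by (intro measurable_compose[OF measurable_component_singleton[where M = "\<lambda>_. circles A"] measurable_wide_length[OF A]]) auto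
  qed
  show ?thesis unfolding spread_bound_def Let_def
  proof (intro borel_measurable_add borel_measurable_sum)
    fix p assume "p \<in> {p\<in>A \<times> A. fst p \<noteq> snd p}"
    then have [measurable]: "(\<lambda>z. slack r (z i) (fst p) (snd p)) \<in> borel_measurable ?M"
      by (intro measurable_compose[OF measurable_component_singleton[OF i, where M = "\<lambda>_. circles A"] measurable_slack]) auto
    show "(\<lambda>z. ennreal (decay (n * (\<Prod>l\<in>{1..D} - {i}. wide_length r A (z l)) * slack r (z i) (fst p) (snd p))))
        \<in> borel_measurable ?M" by measurable
  qed measurable
qed

text \<open>Coordinate \<open>i\<close> is integrated first with the others, and so
  \<open>W\<close>, held fixed; this gives a multiple of \<open>1 / (n * W)\<close>. The inverse of
  \<open>W\<close> is a product over independent coordinates, which yields the power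
  \<open>D - 1\<close>.\<close>

lemma nn_integral_spread_bound_le:
  assumes A: "finite A" and r: "0 < r" and n: "0 < n" and i: "i \<in> {1..D}"
  shows "(\<integral>\<^sup>+z. spread_bound D r A n z i \<partial>PiM {1..D} (\<lambda>_. circles A))
    \<le> (ennreal (1 / (2 * r)) + of_nat (card {p\<in>A \<times> A. fst p \<noteq> snd p})) *
      (\<integral>\<^sup>+w. inverse (ennreal (wide_length r A w)) \<partial>circles A) ^ (D - 1) * inverse (ennreal n)"
proof -
  let ?P = "{p\<in>A \<times> A. fst p \<noteq> snd p}"
  define R where "R = {1..D} - {i}"
  define c where "c = ennreal (1 / (2 * r)) + of_nat (card ?P)"
  have R: "finite R" "i \<notin> R" "insert i R = {1..D}" "card R = D - 1" using i by (auto simp: R_def card_Diff_subset)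
  define W where "W z = (\<Prod>l\<in>R. wide_length r A (z l))" for z :: "nat \<Rightarrow> 'a \<Rightarrow> circle"
  have W0: "0 \<le> W z" for z unfolding W_def by (intro prod_nonneg) (use wide_length_nonneg A r in auto)
  have Wupd: "W (z(i := w)) = W z" for z w unfolding W_def using R(2) by (intro prod.cong) auto
  have inner: "(\<integral>\<^sup>+w. spread_bound D r A n (z(i := w)) i \<partial>circles A) \<le> c * inverse (ennreal (n * W z))" for z
  proof -
    have nW: "0 \<le> n * W z" using n W0 by simp
    have first: "ennreal (decay (n * W z * (2 * r))) \<le> ennreal (1 / (2 * r)) * inverse (ennreal (n * W z))"
    proof (cases "n * W z = 0")
      case True
      have "inverse (ennreal (n * W z)) = \<top>" unfolding True by simp
      then show ?thesis using r by (simp only:) (simp add: ennreal_mult_top)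
    next
      case False
      then have pos: "0 < n * W z" using nW by linarith
      then have "ennreal (decay (n * W z * (2 * r))) \<le> ennreal (1 / (n * W z * (2 * r)))"
        using r by (intro ennreal_leI decay_le_inverse) simp
      also have "\<dots> = ennreal (1 / (2 * r)) * inverse (ennreal (n * W z))"
        using pos r by (simp add: inverse_ennreal flip: ennreal_mult') (simp add: field_simps)
      finally show ?thesis .
    qed
    have meas: "(\<lambda>w. ennreal (decay (n * W z * slack r w (fst p) (snd p)))) \<in> borel_measurable (circles A)"
      if "p \<in> ?P" for p
    proof -
      have [measurable]: "fst p \<in> A" "snd p \<in> A" using that by auto
      show ?thesis by measurable
    qed
    have "(\<integral>\<^sup>+w. spread_bound D r A n (z(i := w)) i \<partial>circles A)
       = (\<integral>\<^sup>+w. ennreal (decay (n * W z * (2 * r))) +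
           (\<Sum>p\<in>?P. ennreal (decay (n * W z * slack r w (fst p) (snd p)))) \<partial>circles A)"
      unfolding spread_bound_def Let_def R_def[symmetric] W_def[symmetric] Wupd by simp
    also have "\<dots> = ennreal (decay (n * W z * (2 * r))) +
        (\<Sum>p\<in>?P. \<integral>\<^sup>+w. ennreal (decay (n * W z * slack r w (fst p) (snd p))) \<partial>circles A)"
      using A by (subst nn_integral_add)
        (auto intro!: borel_measurable_sum meas nn_integral_sum
          simp: prob_space.emeasure_space_1[OF prob_space_circles] simp del: sum_ennreal)
    also have "\<dots> \<le> ennreal (1 / (2 * r)) * inverse (ennreal (n * W z)) + (\<Sum>p\<in>?P. inverse (ennreal (n * W z)))"
      by (intro add_mono first sum_mono nn_integral_decay_slack_le) (use A nW in auto)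
    also have "\<dots> = c * inverse (ennreal (n * W z))" by (simp add: c_def distrib_right)
    finally show ?thesis .
  qed
  have meas [measurable]: "(\<lambda>w. inverse (ennreal (wide_length r A w))) \<in> borel_measurable (circles A)"
    using measurable_wide_length[OF A] by measurable
  have meas_prod: "(\<lambda>z. \<Prod>l\<in>R. inverse (ennreal (wide_length r A (z l)))) \<in> borel_measurable (PiM R (\<lambda>_. circles A))"
    by (intro borel_measurable_prod_ennreal measurable_compose[OF measurable_component_singleton[where M = "\<lambda>_. circles A"] meas])
  have "(\<integral>\<^sup>+z. spread_bound D r A n z i \<partial>PiM {1..D} (\<lambda>_. circles A))
     = (\<integral>\<^sup>+z. \<integral>\<^sup>+w. spread_bound D r A n (z(i := w)) i \<partial>circles A \<partial>PiM R (\<lambda>_. circles A))"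
    unfolding R(3)[symmetric]
    by (rule circles_product.product_nn_integral_insert[OF R(1,2)]) (use measurable_spread_bound[OF A i] R(3) in simp)
  also have "\<dots> \<le> (\<integral>\<^sup>+z. c * inverse (ennreal (n * W z)) \<partial>PiM R (\<lambda>_. circles A))"
    by (intro nn_integral_mono inner)
  also have "\<dots> = (\<integral>\<^sup>+z. (c * inverse (ennreal n)) * (\<Prod>l\<in>R. inverse (ennreal (wide_length r A (z l)))) \<partial>PiM R (\<lambda>_. circles A))"
  proof (intro nn_integral_cong)
    fix z
    have "inverse (ennreal (n * W z)) = inverse (ennreal n) * inverse (ennreal (W z))"
      using n W0[of z] by (simp add: ennreal_mult ennreal_inverse_mult)
    also have "inverse (ennreal (W z)) = (\<Prod>l\<in>R. inverse (ennreal (wide_length r A (z l))))"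
      unfolding W_def by (rule ennreal_inverse_prod) (use wide_length_nonneg A r in auto)
    finally show "c * inverse (ennreal (n * W z)) = (c * inverse (ennreal n)) * (\<Prod>l\<in>R. inverse (ennreal (wide_length r A (z l))))"
      by (simp add: mult.assoc)
  qed
  also have "\<dots> = (c * inverse (ennreal n)) * (\<integral>\<^sup>+z. (\<Prod>l\<in>R. inverse (ennreal (wide_length r A (z l)))) \<partial>PiM R (\<lambda>_. circles A))"
    by (rule nn_integral_cmult[OF meas_prod])
  also have "(\<integral>\<^sup>+z. (\<Prod>l\<in>R. inverse (ennreal (wide_length r A (z l)))) \<partial>PiM R (\<lambda>_. circles A))
      = (\<integral>\<^sup>+w. inverse (ennreal (wide_length r A w)) \<partial>circles A) ^ (D - 1)"
    by (subst circles_product.product_nn_integral_prod[OF R(1) meas]) (simp add: R(4))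
  finally show ?thesis by (simp add: c_def mult_ac)
qed

lemma nn_integral_transpose:
  assumes D: "1 \<le> D" and q: "A \<noteq> {}" and f: "f \<in> borel_measurable (PiM {1..D} (\<lambda>_. circles A))"
  shows "(\<integral>\<^sup>+x. f (\<lambda>i\<in>{1..D}. \<lambda>a\<in>A. x a i) \<partial>tori D A) = (\<integral>\<^sup>+z. f z \<partial>PiM {1..D} (\<lambda>_. circles A))"
proof -
  have T: "(\<lambda>x. \<lambda>i\<in>{1..D}. \<lambda>a\<in>A. x a i) \<in> tori D A \<rightarrow>\<^sub>M PiM {1..D} (\<lambda>_. circles A)"
    unfolding torus_uniform_def by (intro measurable_restrict measurable_component_component)
  have "distr (tori D A) (PiM {1..D} (\<lambda>_. circles A)) (\<lambda>x. \<lambda>i\<in>{1..D}. \<lambda>a\<in>A. x a i) = PiM {1..D} (\<lambda>_. circles A)"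
    unfolding torus_uniform_def by (rule distr_PiM_transpose[OF prob_space_circle_uniform]) (use D q in auto)
  then show ?thesis using nn_integral_distr[OF T, of f] f by simp
qed

lemma emeasure_spread_upper:
  assumes D: "1 \<le> D" and q: "1 \<le> q" and r: "0 < r" "r < 1/2"
  obtains C :: real where "0 < C" "\<And>n. 2 * (q + M_dim D) \<le> n \<Longrightarrow>
    emeasure (tori D ({1..q} \<union> {q+1..n})) {X \<in> space (tori D ({1..q} \<union> {q+1..n})). spread D r {1..q} X {q+1..n} X}
      \<le> ennreal (C / real n)"
proof -
  let ?A = "{1..q}"
  define K where "K = ennreal (2 ^ (M_dim D + 2) * fact (M_dim D + 2) * exp (1 / 2))"
  define c where "c = K * (of_nat D * ((ennreal (1 / (2 * r)) + of_nat (card {p\<in>?A \<times> ?A. fst p \<noteq> snd p})) *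
      (\<integral>\<^sup>+w. inverse (ennreal (wide_length r ?A w)) \<partial>circles ?A) ^ (D - 1)))"
  have "c < \<infinity>"
    using nn_integral_inverse_wide_length_finite[of ?A r] r
    by (auto simp: c_def K_def ennreal_mult_less_top of_nat_less_top intro!: power_less_top_ennreal[THEN iffD2])
  then obtain C where C: "0 \<le> C" "c = ennreal C" by (metis ennreal_cases infinity_ennreal_def less_irrefl)
  show ?thesis
  proof (rule that)
    \<comment> \<open>The constant \<open>C\<close> is only known to be nonnegative; adding 1 makes
      it positive.\<close>
    show "0 < C + 1" using C by simp
    fix n assume n: "2 * (q + M_dim D) \<le> n"
    then have n0: "0 < real n" using q by simp
    have T: "(\<lambda>z. \<Sum>i\<in>{1..D}. spread_bound D r ?A (real n) z i) \<in> borel_measurable (PiM {1..D} (\<lambda>_. circles ?A))"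
      by (intro borel_measurable_sum measurable_spread_bound) auto
    have "emeasure (tori D (?A \<union> {q+1..n})) {X \<in> space (tori D (?A \<union> {q+1..n})). spread D r ?A X {q+1..n} X}
        = (\<integral>\<^sup>+x. emeasure (tori D {q+1..n}) {y \<in> space (tori D {q+1..n}). spread D r ?A x {q+1..n} y} \<partial>tori D ?A)"
      by (rule emeasure_spread) (use r in auto)
    also have "\<dots> \<le> (\<integral>\<^sup>+x. K * (\<Sum>i\<in>{1..D}. spread_bound D r ?A (real n) (\<lambda>i\<in>{1..D}. \<lambda>a\<in>?A. x a i) i) \<partial>tori D ?A)"
      unfolding K_def by (intro nn_integral_mono emeasure_spread_section_le_bound[OF D q r n])
    also have "\<dots> = (\<integral>\<^sup>+z. K * (\<Sum>i\<in>{1..D}. spread_bound D r ?A (real n) z i) \<partial>PiM {1..D} (\<lambda>_. circles ?A))"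
      by (rule nn_integral_transpose[OF D]) (use q T in auto)
    also have "\<dots> = K * (\<Sum>i\<in>{1..D}. \<integral>\<^sup>+z. spread_bound D r ?A (real n) z i \<partial>PiM {1..D} (\<lambda>_. circles ?A))"
      by (subst nn_integral_cmult[OF T], subst nn_integral_sum) (auto intro: measurable_spread_bound simp del: One_nat_def)
    also have "\<dots> \<le> K * (\<Sum>i\<in>{1..D}. (ennreal (1 / (2 * r)) + of_nat (card {p\<in>?A \<times> ?A. fst p \<noteq> snd p})) *
        (\<integral>\<^sup>+w. inverse (ennreal (wide_length r ?A w)) \<partial>circles ?A) ^ (D - 1) * inverse (ennreal (real n)))"
      by (intro mult_left_mono sum_mono nn_integral_spread_bound_le) (use r n0 in auto)
    also have "\<dots> = c * inverse (ennreal (real n))" by (simp add: c_def mult_ac)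
    also have "\<dots> = ennreal (C / real n)" using C n0 by (simp add: inverse_ennreal divide_inverse ennreal_mult)
    also have "\<dots> \<le> ennreal ((C + 1) / real n)" using n0 by (intro ennreal_leI divide_right_mono) auto
    finally show "emeasure (tori D (?A \<union> {q+1..n})) {X \<in> space (tori D (?A \<union> {q+1..n})). spread D r ?A X {q+1..n} X}
      \<le> ennreal ((C + 1) / real n)" .
  qed
qed

section \<open>The lower bound\<close>

text \<open>
  The sample points are split into \<open>M_dim D\<close> blocks of \<open>m\<close> indices; the witnessing events, one for each
  choice of one index per block, put the chosen points into their boxes and all others outside the cell.
\<close>

lemma emeasure_spread_section_ge:
  fixes D :: nat and x :: "'i \<Rightarrow> nat \<Rightarrow> circle" and \<beta> :: real
  assumes A: "finite A" and r: "0 \<le> r" "r < 1/2"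
    and Q: "\<And>k. k < M_dim D \<Longrightarrow> Q k \<in> sets (torus_uniform D)"
      "\<And>k. k < M_dim D \<Longrightarrow> Q k \<subseteq> common_cell D r A x"
      "\<And>k. k < M_dim D \<Longrightarrow> ennreal \<beta> \<le> emeasure (torus_uniform D) (Q k)"
      "\<And>k l u w. k < M_dim D \<Longrightarrow> l < M_dim D \<Longrightarrow> k \<noteq> l \<Longrightarrow> u \<in> Q k \<Longrightarrow> w \<in> Q l \<Longrightarrow> \<not> torus_close D r u w"
    and \<beta>: "0 \<le> \<beta>" and m: "0 < m" "q + m * M_dim D \<le> n"
  defines "V \<equiv> measure (torus_uniform D) (common_cell D r A x)"
  shows "ennreal (real m ^ M_dim D * (\<beta> ^ M_dim D * (1 - V) ^ (n - q - M_dim D)))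
    \<le> emeasure (tori D {q+1..n}) {y \<in> space (tori D {q+1..n}). spread D r A x {q+1..n} y}"
proof -
  let ?M = "M_dim D" and ?C = "common_cell D r A x" and ?T = "torus_uniform D"
  let ?B = "{q+1..n}"
  define block where "block k = {q + 1 + k * m..<q + 1 + k * m + m}" for k
  define \<Phi> where "\<Phi> = Pi\<^sub>E {..<?M} block"
  \<comment> \<open>Recovers the block of an index, and thus which box a chosen index has to
    hit.\<close>
  define num where "num j = (j - (q + 1)) div m" for j
  define F where "F f = Pi\<^sub>E ?B (\<lambda>j. if j \<in> f ` {..<?M} then Q (num j) else space ?T - ?C)" for f
  note C = sets_common_cell[OF A r, of D x]
  have V: "0 \<le> V" "V \<le> 1" by (simp_all add: V_def)
  have emC: "emeasure ?T (space ?T - ?C) = ennreal (1 - V)"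
    using torus_uniform.prob_compl[OF C] by (auto simp: V_def torus_uniform.emeasure_eq_measure)
  have num: "num (f k) = k" if "f \<in> \<Phi>" "k < ?M" for f k
  proof -
    have "f k \<in> block k" using that by (auto simp: \<Phi>_def)
    then have "f k - (q + 1) = k * m + (f k - (q + 1 + k * m))" "f k - (q + 1 + k * m) < m"
      by (auto simp: block_def)
    then show ?thesis using m(1) by (simp add: num_def)
  qed
  have inB: "f k \<in> ?B" if "f \<in> \<Phi>" "k < ?M" for f k
  proof -
    have "f k \<in> block k" using that by (auto simp: \<Phi>_def)
    moreover have "k * m + m \<le> m * ?M" using that(2) by (metis Suc_leI mult_Suc mult.commute add.commute mult_le_mono1)
    ultimately show ?thesis using m(2) by (auto simp: block_def)
  qed
  have inj: "inj_on f {..<?M}" if "f \<in> \<Phi>" for f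
    by (rule inj_on_inverseI[of _ num]) (use num that in auto)
  have chosen: "num j < ?M \<and> f (num j) = j" if "f \<in> \<Phi>" "j \<in> f ` {..<?M}" for f j
    using num that by auto
  have F: "F f \<in> sets (tori D ?B)" if f: "f \<in> \<Phi>" for f
    unfolding F_def by (rule sets_PiM_I_finite) (use Q(1) C chosen[OF f] in auto)
  have emF: "ennreal (\<beta> ^ ?M * (1 - V) ^ (n - q - ?M)) \<le> emeasure (tori D ?B) (F f)" if f: "f \<in> \<Phi>" for f
  proof -
    let ?S = "f ` {..<?M}"
    have S: "?S \<subseteq> ?B" "card ?S = ?M" using inB[OF f] card_image[OF inj[OF f]] by auto
    have "(\<Prod>j\<in>?B. if j \<in> ?S then \<beta> else 1 - V) = \<beta> ^ ?M * (1 - V) ^ (card ?B - ?M)"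
    proof -
      have "?B \<inter> {j. j \<in> ?S} = ?S" "?B \<inter> - {j. j \<in> ?S} = ?B - ?S" using S by auto
      then show ?thesis using S by (simp add: prod.If_cases card_Diff_subset)
    qed
    then have "ennreal (\<beta> ^ ?M * (1 - V) ^ (n - q - ?M)) = ennreal (\<Prod>j\<in>?B. if j \<in> ?S then \<beta> else 1 - V)" by simp
    also have "\<dots> = (\<Prod>j\<in>?B. ennreal (if j \<in> ?S then \<beta> else 1 - V))"
      by (rule prod_ennreal[symmetric]) (use V \<beta> in auto)
    also have "\<dots> \<le> (\<Prod>j\<in>?B. emeasure ?T (if j \<in> ?S then Q (num j) else space ?T - ?C))"
      by (intro prod_mono_ennreal) (use Q(3) chosen[OF f] emC in auto)
    also have "\<dots> = emeasure (tori D ?B) (F f)"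
      unfolding F_def by (rule torus_product.emeasure_PiM[symmetric]) (use Q(1) C chosen[OF f] in auto)
    finally show ?thesis .
  qed
  have in_Q: "y (f k) \<in> Q k" if "f \<in> \<Phi>" "y \<in> F f" "k < ?M" for f y k
  proof -
    have "y (f k) \<in> (if f k \<in> f ` {..<?M} then Q (num (f k)) else space ?T - ?C)"
      using that(2) inB[OF that(1,3)] unfolding F_def by (rule PiE_mem)
    then show ?thesis using num[OF that(1,3)] that(3) by simp
  qed
  have cell: "y j \<in> ?C \<longleftrightarrow> j \<in> f ` {..<?M}" if "f \<in> \<Phi>" "y \<in> F f" "j \<in> ?B" for f y j
  proof
    assume "j \<in> f ` {..<?M}"
    then show "y j \<in> ?C" using in_Q[OF that(1,2)] Q(2) by auto
  next
    assume "y j \<in> ?C"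
    moreover have "y j \<in> (if j \<in> f ` {..<?M} then Q (num j) else space ?T - ?C)"
      using that(2,3) unfolding F_def by (rule PiE_mem)
    ultimately show "j \<in> f ` {..<?M}" by (auto split: if_splits)
  qed
  \<comment> \<open>A sample in \<open>F f\<close> determines \<open>f\<close>: its points inside
    the cell are exactly the chosen ones, and \<open>num\<close> tells which block each of them
    represents. Hence the probabilities of all \<open>m ^ M_dim D\<close> choices add up.\<close>
  have disj: "disjoint_family_on F \<Phi>"
    unfolding disjoint_family_on_def
  proof (intro ballI impI, rule ccontr)
    fix f g assume fg: "f \<in> \<Phi>" "g \<in> \<Phi>" "f \<noteq> g" "F f \<inter> F g \<noteq> {}"
    then obtain y where y: "y \<in> F f" "y \<in> F g" by blast
    have "f k = g k" if k: "k < ?M" for k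
    proof -
      have "y (f k) \<in> ?C" using in_Q[OF fg(1) y(1) k] Q(2)[OF k] by blast
      then have "f k \<in> g ` {..<?M}" using cell[OF fg(2) y(2) inB[OF fg(1) k]] by simp
      then show ?thesis using chosen[OF fg(2)] num[OF fg(1) k] by force
    qed
    then have "f = g" using fg(1,2) by (intro PiE_ext[of f "{..<?M}" block g]) (auto simp: \<Phi>_def)
    then show False using fg(3) by simp
  qed
  have sub: "(\<Union>f\<in>\<Phi>. F f) \<subseteq> {y \<in> space (tori D ?B). spread D r A x ?B y}"
  proof
    fix y assume "y \<in> (\<Union>f\<in>\<Phi>. F f)"
    then obtain f where f: "f \<in> \<Phi>" "y \<in> F f" by blast
    have N: "{w\<in>?B. y w \<in> ?C} = f ` {..<?M}" using cell[OF f] inB[OF f(1)] by auto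
    have "\<not> torus_close D r (y (f k)) (y (f l))" if "k < ?M" "l < ?M" "f k \<noteq> f l" for k l
      using Q(4)[OF that(1,2) _ in_Q[OF f that(1)] in_Q[OF f that(2)]] that(3) by blast
    then have "spread D r A x ?B y"
      unfolding spread_def Let_def N using card_image[OF inj[OF f(1)]] by auto
    moreover have "y \<in> space (tori D ?B)" using F[OF f(1)] f(2) sets.sets_into_space by blast
    ultimately show "y \<in> {y \<in> space (tori D ?B). spread D r A x ?B y}" by simp
  qed
  have fin: "finite \<Phi>" unfolding \<Phi>_def by (intro finite_PiE) (auto simp: block_def)
  have "ennreal (real m ^ ?M * (\<beta> ^ ?M * (1 - V) ^ (n - q - ?M)))
      = (\<Sum>f\<in>\<Phi>. ennreal (\<beta> ^ ?M * (1 - V) ^ (n - q - ?M)))"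
    using V \<beta> by (simp add: \<Phi>_def card_PiE block_def ennreal_mult ennreal_of_nat_eq_real_of_nat flip: of_nat_power)
  also have "\<dots> \<le> (\<Sum>f\<in>\<Phi>. emeasure (tori D ?B) (F f))" by (intro sum_mono emF)
  also have "\<dots> = emeasure (tori D ?B) (\<Union>f\<in>\<Phi>. F f)"
    by (rule sum_emeasure[OF _ disj fin]) (use F in auto)
  also have "\<dots> \<le> emeasure (tori D ?B) {y \<in> space (tori D ?B). spread D r A x ?B y}"
    by (rule emeasure_mono[OF sub sets_spread_section]) (use A r in auto)
  finally show ?thesis .
qed

text \<open>Every box takes the whole thin arc in coordinate 1 and one of the two arcs
  \<open>J\<close> in each other coordinate, so different side patterns are separated in some
  coordinate. As the other lengths are at most 1, the cell has volume at most \<delta>, the same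
  order in \<delta> as a single box.\<close>

lemma emeasure_spread_section_ge_thin:
  fixes x :: "'i \<Rightarrow> nat \<Rightarrow> circle" and J :: "bool \<Rightarrow> circle set"
  assumes D: "2 \<le> D" and A: "finite A" and r: "0 \<le> r" "r < 1/2"
    and thin: "measure circle_uniform (common_arc r A (\<lambda>a. x a 1)) \<in> {\<delta> / 2..\<delta>}" and \<delta>: "0 \<le> \<delta>" "\<delta> \<le> 1"
    and J: "\<And>s. J s \<in> sets circle_borel" "\<And>s. emeasure circle_uniform (J s) = ennreal e"
      "\<And>s i. i \<in> {2..D} \<Longrightarrow> J s \<subseteq> common_arc r A (\<lambda>a. x a i)"
      "\<And>s s' y y'. s \<noteq> s' \<Longrightarrow> y \<in> J s \<Longrightarrow> y' \<in> J s' \<Longrightarrow> r < circle_dist y y'"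
    and e: "0 \<le> e" and m: "0 < m" "q + m * M_dim D \<le> n"
  shows "ennreal (real m ^ M_dim D * ((\<delta> / 2 * e ^ (D - 1)) ^ M_dim D * (1 - \<delta>) ^ (n - q - M_dim D)))
    \<le> emeasure (tori D {q+1..n}) {y \<in> space (tori D {q+1..n}). spread D r A x {q+1..n} y}"
proof -
  let ?M = "M_dim D"
  define V where "V = measure (torus_uniform D) (common_cell D r A x)"
  define L where "L i = measure circle_uniform (common_arc r A (\<lambda>a. x a i))" for i
  have D12: "{1..D} = insert 1 {2..D}" using D by auto
  have "V = L 1 * (\<Prod>i\<in>{2..D}. L i)"
    unfolding V_def L_def measure_common_cell[OF A r] D12 by (subst prod.insert) auto
  also have "\<dots> \<le> L 1 * 1" by (intro mult_left_mono prod_le_1) (auto simp: L_def)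
  finally have V: "0 \<le> V" "V \<le> \<delta>" using thin by (auto simp: L_def V_def)
  \<comment> \<open>There are \<open>2 ^ (D - 1)\<close> side patterns, twice
    \<open>2 ^ (D - 2)\<close>, which leaves room for the additional 1 in
    \<open>M_dim\<close>.\<close>
  have cM: "card {..<?M} \<le> card (Pi\<^sub>E {2..D} (\<lambda>_. UNIV :: bool set))"
  proof -
    have "D - 1 = Suc (D - 2)" using D by simp
    then have "?M \<le> 2 ^ (D - 1)" unfolding M_dim_def by (simp only: power_Suc) simp
    then show ?thesis using D by (simp add: card_PiE)
  qed
  obtain \<sigma> where \<sigma>: "inj_on \<sigma> {..<?M}" "\<sigma> ` {..<?M} \<subseteq> Pi\<^sub>E {2..D} (\<lambda>_. UNIV :: bool set)"
    using card_le_inj[OF finite_lessThan finite_PiE cM] by auto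
  define Q where "Q k = Pi\<^sub>E {1..D} (\<lambda>i. if i = 1 then common_arc r A (\<lambda>a. x a 1) else J (\<sigma> k i))" for k
  have arc: "common_arc r A (\<lambda>a. x a 1) \<in> sets circle_borel" by (rule sets_common_arc[OF A r])
  have "ennreal (real m ^ ?M * ((\<delta> / 2 * e ^ (D - 1)) ^ ?M * (1 - \<delta>) ^ (n - q - ?M)))
    \<le> ennreal (real m ^ ?M * ((\<delta> / 2 * e ^ (D - 1)) ^ ?M * (1 - V) ^ (n - q - ?M)))"
    using V e \<delta> by (intro ennreal_leI mult_left_mono power_mono) auto
  also have "\<dots> \<le> emeasure (tori D {q+1..n}) {y \<in> space (tori D {q+1..n}). spread D r A x {q+1..n} y}"
    unfolding V_def
  proof (rule emeasure_spread_section_ge[OF A r, where Q = Q])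
    fix k
    show "Q k \<in> sets (torus_uniform D)"
      unfolding Q_def torus_uniform_def by (rule sets_PiM_I_finite) (use arc J in auto)
    show "Q k \<subseteq> common_cell D r A x"
      unfolding Q_def common_cell_def
    proof (rule PiE_mono)
      fix i assume "i \<in> {1..D}"
      then show "(if i = 1 then common_arc r A (\<lambda>a. x a 1) else J (\<sigma> k i)) \<subseteq> common_arc r A (\<lambda>a. x a i)"
        using J(3)[of i] by (cases "i = 1") auto
    qed
    have "emeasure (torus_uniform D) (Q k) = (\<Prod>i\<in>{1..D}. emeasure circle_uniform (if i = 1 then common_arc r A (\<lambda>a. x a 1) else J (\<sigma> k i)))"
      unfolding Q_def by (rule emeasure_torus_PiE) (use arc J in auto)
    also have "\<dots> = emeasure circle_uniform (common_arc r A (\<lambda>a. x a 1)) * (\<Prod>i\<in>{2..D}. ennreal e)"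
      unfolding D12 by (subst prod.insert) (auto simp: J intro!: arg_cong2[where f = "(*)"] prod.cong)
    also have "\<dots> = ennreal (L 1 * e ^ (D - 1))"
      using D e by (simp add: circle_uniform.emeasure_eq_measure L_def ennreal_mult ennreal_power)
    finally have Qk: "emeasure (torus_uniform D) (Q k) = ennreal (L 1 * e ^ (D - 1))" .
    have "ennreal (\<delta> / 2 * e ^ (D - 1)) \<le> ennreal (L 1 * e ^ (D - 1))"
      using thin e by (intro ennreal_leI mult_right_mono) (auto simp: L_def)
    then show "ennreal (\<delta> / 2 * e ^ (D - 1)) \<le> emeasure (torus_uniform D) (Q k)" by (simp only: Qk)
  next
    fix k l u w assume kl: "k < ?M" "l < ?M" "k \<noteq> l" and uw: "u \<in> Q k" "w \<in> Q l"
    have "\<sigma> k \<noteq> \<sigma> l" using \<sigma>(1) kl by (auto simp: inj_on_def)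
    moreover have "\<sigma> k \<in> Pi\<^sub>E {2..D} (\<lambda>_. UNIV)" "\<sigma> l \<in> Pi\<^sub>E {2..D} (\<lambda>_. UNIV)" using \<sigma>(2) kl by auto
    ultimately obtain i where i: "i \<in> {2..D}" "\<sigma> k i \<noteq> \<sigma> l i"
      using PiE_ext[of "\<sigma> k" "{2..D}" "\<lambda>_. UNIV" "\<sigma> l"] by blast
    then have i1: "i \<in> {1..D}" "i \<noteq> 1" by auto
    have "u i \<in> J (\<sigma> k i)" "w i \<in> J (\<sigma> l i)"
      using PiE_mem[OF uw(1)[unfolded Q_def] i1(1)] PiE_mem[OF uw(2)[unfolded Q_def] i1(1)] i1(2) by simp_all
    then have "r < circle_dist (u i) (w i)" using J(4) i(2) by blast
    then show "\<not> torus_close D r u w" using i1(1) unfolding torus_close_def by (meson not_le)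
  qed (use e \<delta> m in auto)
  finally show ?thesis .
qed

lemma emeasure_spread_lower:
  assumes D: "2 \<le> D" and q: "2 \<le> q" and r: "0 < r" "r < 1/2" and cover: "1 < real q * (1 - 2 * r)"
  obtains c :: real where "0 < c" "\<And>n. 2 * (q + M_dim D) \<le> n \<Longrightarrow> ennreal (c / real n) \<le>
    emeasure (tori D ({1..q} \<union> {q+1..n})) {X \<in> space (tori D ({1..q} \<union> {q+1..n})). spread D r {1..q} X {q+1..n} X}"
proof -
  let ?A = "{1..q}" and ?M = "M_dim D"
  obtain c d where cd: "0 < c" "0 < d" "d \<le> 1"
    and thin: "\<And>\<delta>. 0 < \<delta> \<Longrightarrow> \<delta> \<le> d \<Longrightarrow> \<exists>T\<in>sets (circles ?A). ennreal (c * \<delta>) \<le> emeasure (circles ?A) T \<and>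
       (\<forall>x\<in>T. measure circle_uniform (common_arc r ?A x) \<in> {\<delta> / 2..\<delta>})"
    by (rule thin_coordinate[OF q r cover]) (rule that; blast)
  obtain J :: "bool \<Rightarrow> circle set" and W and e w :: real
    where ew: "0 < e" "0 < w" and W: "W \<in> sets (circles ?A)" "ennreal w \<le> emeasure (circles ?A) W"
      and J: "\<forall>s. J s \<in> sets circle_borel \<and> emeasure circle_uniform (J s) = ennreal e"
        "\<forall>x\<in>W. \<forall>s. J s \<subseteq> common_arc r ?A x"
        "\<forall>s s'. s \<noteq> s' \<longrightarrow> (\<forall>y\<in>J s. \<forall>y'\<in>J s'. r < circle_dist y y')"
    by (rule wide_coordinate[OF finite_atLeastAtMost r, of 1 q])
  \<comment> \<open>For \<open>\<delta> = \<kappa> / n\<close>, the bound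
    \<open>\<kappa> \<le> d\<close> makes \<open>thin_coordinate\<close> applicable for every
    \<open>n\<close>, and \<open>\<kappa> \<le> 1 / 2\<close> gives
    \<open>(1 - \<delta>) ^ n \<ge> 1 / 2\<close> by Bernoulli's inequality.\<close>
  define \<kappa> where "\<kappa> = min d (1 / 2)"
  have \<kappa>: "0 < \<kappa>" "\<kappa> \<le> d" "\<kappa> \<le> 1 / 2" using cd by (auto simp: \<kappa>_def)
  have M0: "0 < ?M" by (simp add: M_dim_def)
  \<comment> \<open>A lower bound for \<open>m * (\<delta> / 2 * e ^ (D - 1))\<close>, the mean
    number of points of a block in its box, since \<open>m \<ge> n / (2 * M_dim D)\<close>.\<close>
  define \<gamma> where "\<gamma> = \<kappa> * e ^ (D - 1) / (4 * real ?M)"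
  have \<gamma>: "0 < \<gamma>" using \<kappa> ew M0 by (simp add: \<gamma>_def)
  \<comment> \<open>The first factor bounds the conditional probability given good centres, its
    \<open>1 / 2\<close> accounting for the other points avoiding the cell; the second is
    \<open>n\<close> times the lower bound for the probability of good centres.\<close>
  define c' where "c' = \<gamma> ^ ?M / 2 * (c * \<kappa> * w ^ (D - 1))"
  show ?thesis
  proof (rule that)
    show "0 < c'" using \<gamma> \<kappa> cd ew by (simp add: c'_def)
    fix n assume n: "2 * (q + ?M) \<le> n"
    then have n1: "1 \<le> real n" "0 < real n" using q by auto
    define \<delta> where "\<delta> = \<kappa> / real n"
    have "\<delta> \<le> \<kappa> / 1" unfolding \<delta>_def using n1 \<kappa> by (intro divide_left_mono) auto
    then have \<delta>: "0 < \<delta>" "\<delta> \<le> d" "\<delta> \<le> 1" "real n * \<delta> = \<kappa>" using \<kappa> cd n1 by (auto simp: \<delta>_def)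
    obtain T where T: "T \<in> sets (circles ?A)" "ennreal (c * \<delta>) \<le> emeasure (circles ?A) T"
       "\<And>x. x \<in> T \<Longrightarrow> measure circle_uniform (common_arc r ?A x) \<in> {\<delta> / 2..\<delta>}"
      using thin[OF \<delta>(1,2)] by blast
    define E where "E = Pi\<^sub>E {1..D} (\<lambda>i. if i = 1 then T else W)"
    have E: "E \<in> sets (PiM {1..D} (\<lambda>_. circles ?A))"
      unfolding E_def by (rule sets_PiM_I_finite) (use T W in auto)
    have D12: "{1..D} = insert 1 {2..D}" using D by auto
    have "ennreal (c * \<delta> * w ^ (D - 1)) = ennreal (c * \<delta>) * (\<Prod>i\<in>{2..D}. ennreal w)"
      using D cd \<delta> ew by (simp add: ennreal_mult ennreal_power)
    also have "\<dots> \<le> emeasure (circles ?A) T * (\<Prod>i\<in>{2..D}. emeasure (circles ?A) W)"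
      by (intro mult_mono prod_mono_ennreal T(2) W(2)) auto
    also have "\<dots> = (\<Prod>i\<in>{1..D}. emeasure (circles ?A) (if i = 1 then T else W))"
      unfolding D12 by (subst prod.insert) (auto intro!: arg_cong2[where f = "(*)"] prod.cong)
    also have "\<dots> = emeasure (PiM {1..D} (\<lambda>_. circles ?A)) E"
      unfolding E_def by (rule circles_product.emeasure_PiM[symmetric]) (use T W in auto)
    finally have emE: "ennreal (c * \<delta> * w ^ (D - 1)) \<le> emeasure (PiM {1..D} (\<lambda>_. circles ?A)) E" .
    \<comment> \<open>The largest block length that fits. As \<open>q + M_dim D\<close> is at most
      \<open>n / 2\<close>, rounding loses at most half of the sample.\<close>
    define m where "m = (n - q) div ?M"
    have m: "0 < m" "q + m * ?M \<le> n" "real n \<le> 2 * real ?M * real m"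
    proof -
      have "?M \<le> n - q" using n by simp
      then show "0 < m" using M0 by (simp add: m_def div_greater_zero_iff)
      have "m * ?M \<le> n - q" by (simp add: m_def)
      then show "q + m * ?M \<le> n" using n by simp
      have "n - q < m * ?M + ?M" 
        unfolding m_def using dividend_less_times_div[OF M0, of "n - q"] by (simp only: mult.commute add.commute)
      then have "n \<le> 2 * (?M * m)" using n by (simp add: mult.commute)
      then have "real n \<le> real (2 * (?M * m))" by (rule of_nat_mono)
      then show "real n \<le> 2 * real ?M * real m" by (simp add: mult.assoc)
    qed
    have sec: "ennreal (\<gamma> ^ ?M / 2) \<le> emeasure (tori D {q+1..n}) {y \<in> space (tori D {q+1..n}). spread D r ?A x {q+1..n} y}"
      if x: "(\<lambda>i\<in>{1..D}. \<lambda>a\<in>?A. x a i) \<in> E" for x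
    proof -
      have comp: "(\<lambda>a\<in>?A. x a i) \<in> (if i = 1 then T else W)" if i: "i \<in> {1..D}" for i
        using PiE_mem[OF x[unfolded E_def] i] i by simp
      have arc: "common_arc r ?A (\<lambda>a\<in>?A. x a i) = common_arc r ?A (\<lambda>a. x a i)" for i by (simp add: common_arc_def)
      have "\<gamma> \<le> real m * (\<delta> / 2 * e ^ (D - 1))"
      proof -
        have "\<kappa> \<le> 2 * real ?M * real m * \<delta>" using mult_right_mono[OF m(3), of \<delta>] \<delta> by simp
        then have "\<kappa> * e ^ (D - 1) \<le> (2 * real ?M * real m * \<delta>) * e ^ (D - 1)" using ew by (intro mult_right_mono) auto
        then show ?thesis unfolding \<gamma>_def using M0 by (simp add: divide_le_eq mult_ac)
      qed
      then have "\<gamma> ^ ?M \<le> (real m * (\<delta> / 2 * e ^ (D - 1))) ^ ?M" using \<gamma> by (intro power_mono) auto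
      moreover have "1 / 2 \<le> (1 - \<delta>) ^ (n - q - ?M)"
      proof -
        have "1 - real n * \<delta> \<le> (1 - \<delta>) ^ n"
          using Bernoulli_inequality[of "- \<delta>" n] \<delta> by simp
        also have "\<dots> \<le> (1 - \<delta>) ^ (n - q - ?M)" using \<delta> by (intro power_decreasing) auto
        finally show ?thesis using \<delta> \<kappa> by simp
      qed
      ultimately have "\<gamma> ^ ?M * (1 / 2) \<le> (real m * (\<delta> / 2 * e ^ (D - 1))) ^ ?M * (1 - \<delta>) ^ (n - q - ?M)"
        using \<gamma> ew \<delta> by (intro mult_mono) auto
      also have "\<dots> = real m ^ ?M * ((\<delta> / 2 * e ^ (D - 1)) ^ ?M * (1 - \<delta>) ^ (n - q - ?M))"
        by (simp only: power_mult_distrib[of "real m" "\<delta> / 2 * e ^ (D - 1)"] mult.assoc)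
      finally have "ennreal (\<gamma> ^ ?M / 2) \<le> ennreal (real m ^ ?M * ((\<delta> / 2 * e ^ (D - 1)) ^ ?M * (1 - \<delta>) ^ (n - q - ?M)))"
        by (intro ennreal_leI) simp
      also have "\<dots> \<le> emeasure (tori D {q+1..n}) {y \<in> space (tori D {q+1..n}). spread D r ?A x {q+1..n} y}"
      proof (rule emeasure_spread_section_ge_thin[OF D, where J = J and e = e])
        show "J s \<in> sets circle_borel" "emeasure circle_uniform (J s) = ennreal e" for s using J(1) by auto
        show "measure circle_uniform (common_arc r ?A (\<lambda>a. x a 1)) \<in> {\<delta> / 2..\<delta>}"
          using T(3)[of "\<lambda>a\<in>?A. x a 1"] comp[of 1] D unfolding arc by auto
        show "J s \<subseteq> common_arc r ?A (\<lambda>a. x a i)" if "i \<in> {2..D}" for s i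
          using J(2) comp[of i] that unfolding arc[of i, symmetric] by auto
        show "r < circle_dist y y'" if "s \<noteq> s'" "y \<in> J s" "y' \<in> J s'" for s s' y y' using J(3) that by blast
      qed (use r \<delta> ew m in auto)
      finally show ?thesis .
    qed
    have "c' / real n = \<gamma> ^ ?M / 2 * (c * \<delta> * w ^ (D - 1))" by (simp add: c'_def \<delta>_def)
    then have "ennreal (c' / real n) = ennreal (\<gamma> ^ ?M / 2 * (c * \<delta> * w ^ (D - 1)))" by (simp only:)
    also have "\<dots> = ennreal (\<gamma> ^ ?M / 2) * ennreal (c * \<delta> * w ^ (D - 1))"
      by (rule ennreal_mult) (use \<gamma> cd \<delta> ew in auto)
    also have "\<dots> \<le> ennreal (\<gamma> ^ ?M / 2) * emeasure (PiM {1..D} (\<lambda>_. circles ?A)) E"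
      by (intro mult_left_mono emE) auto
    also have "\<dots> = (\<integral>\<^sup>+z. ennreal (\<gamma> ^ ?M / 2) * indicator E z \<partial>PiM {1..D} (\<lambda>_. circles ?A))"
      using E by (simp add: nn_integral_cmult_indicator)
    also have "\<dots> = (\<integral>\<^sup>+x. ennreal (\<gamma> ^ ?M / 2) * indicator E (\<lambda>i\<in>{1..D}. \<lambda>a\<in>?A. x a i) \<partial>tori D ?A)"
      by (rule nn_integral_transpose[where f = "\<lambda>z. ennreal (\<gamma> ^ ?M / 2) * indicator E z", symmetric]) (use D q E in auto)
    also have "\<dots> \<le> (\<integral>\<^sup>+x. emeasure (tori D {q+1..n}) {y \<in> space (tori D {q+1..n}). spread D r ?A x {q+1..n} y} \<partial>tori D ?A)"
    proof (intro nn_integral_mono)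
      fix x
      show "ennreal (\<gamma> ^ ?M / 2) * indicator E (\<lambda>i\<in>{1..D}. \<lambda>a\<in>?A. x a i)
          \<le> emeasure (tori D {q+1..n}) {y \<in> space (tori D {q+1..n}). spread D r ?A x {q+1..n} y}"
        using sec[of x] by (cases "(\<lambda>i\<in>{1..D}. \<lambda>a\<in>?A. x a i) \<in> E") simp_all
    qed
    also have "\<dots> = emeasure (tori D (?A \<union> {q+1..n})) {X \<in> space (tori D (?A \<union> {q+1..n})). spread D r ?A X {q+1..n} X}"
      by (rule emeasure_spread[symmetric]) (use r in auto)
    finally show "ennreal (c' / real n) \<le>
      emeasure (tori D (?A \<union> {q+1..n})) {X \<in> space (tori D (?A \<union> {q+1..n})). spread D r ?A X {q+1..n} X}" .
  qed
qed

theorem theorem1p7: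
  fixes D q :: nat and r g :: real
  assumes "D \<ge> 3" and "0 < r" and "r < 1/2"
    and "g = 1 - 2 * r" and "q = nat \<lfloor>1 / g\<rfloor> + 1"
  shows "\<exists>c C :: real. 0 < c \<and> c < C \<and>
    (\<forall>\<^sub>F n in sequentially.
       c / real n \<le> \<P>(X in torus_sample D n. models (torus_graph D n r X) (\<lambda>a. a) (Theta D q)) \<and>
       \<P>(X in torus_sample D n. models (torus_graph D n r X) (\<lambda>a. a) (Theta D q)) \<le> C / real n)"
proof -
  have g: "0 < g" "g < 1" using assms by auto
  have "1 \<le> \<lfloor>1 / g\<rfloor>" using g by (simp add: le_floor_iff)
  moreover from this have "real (nat \<lfloor>1 / g\<rfloor>) = of_int \<lfloor>1 / g\<rfloor>" by (subst of_nat_nat) (use g in simp_all)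
  ultimately have q: "2 \<le> q" "real q = of_int \<lfloor>1 / g\<rfloor> + 1" unfolding assms(5) by linarith+
  \<comment> \<open>\<open>q\<close> is the least integer above \<open>1 / g\<close>, the least
    number of arcs of length \<open>g\<close> whose total length exceeds the circle.\<close>
  have "1 / g < real q" unfolding q(2) by linarith
  then have cover: "1 < real q * (1 - 2 * r)" using g assms(4) by (simp add: divide_less_eq)
  have D: "1 \<le> D" "2 \<le> D" and q1: "1 \<le> q" using assms(1) q by auto
  let ?E = "\<lambda>n. {X \<in> space (tori D ({1..q} \<union> {q+1..n})). spread D r {1..q} X {q+1..n} X}"
  obtain C where C: "0 < C" "\<And>n. 2 * (q + M_dim D) \<le> n \<Longrightarrow>
      emeasure (tori D ({1..q} \<union> {q+1..n})) (?E n) \<le> ennreal (C / real n)"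
    using emeasure_spread_upper[OF D(1) q1 assms(2,3)] by blast
  obtain c where c: "0 < c" "\<And>n. 2 * (q + M_dim D) \<le> n \<Longrightarrow>
      ennreal (c / real n) \<le> emeasure (tori D ({1..q} \<union> {q+1..n})) (?E n)"
    using emeasure_spread_lower[OF D(2) q(1) assms(2,3) cover] by blast
  \<comment> \<open>\<open>C + c\<close> instead of \<open>C\<close> makes the upper constant
    strictly larger than the lower one.\<close>
  have "c / real n \<le> \<P>(X in torus_sample D n. models (torus_graph D n r X) (\<lambda>a. a) (Theta D q)) \<and>
      \<P>(X in torus_sample D n. models (torus_graph D n r X) (\<lambda>a. a) (Theta D q)) \<le> (C + c) / real n"
    (is "?lower \<and> ?upper") if n: "2 * (q + M_dim D) \<le> n" for n
  proof -
    have sample: "torus_sample D n = tori D ({1..q} \<union> {q+1..n})"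
    proof -
      have "{1..n} = {1..q} \<union> {q+1..n}" using n by auto
      then show ?thesis by (simp only: torus_sample_def)
    qed
    have ev: "{X \<in> space (torus_sample D n). models (torus_graph D n r X) (\<lambda>a. a) (Theta D q)} = ?E n"
      using models_Theta_iff_spread[OF D(1), of q n] n unfolding sample by auto
    have "emeasure (torus_sample D n) (?E n) = ennreal (measure (torus_sample D n) (?E n))"
      by (intro finite_measure.emeasure_eq_measure prob_space.finite_measure prob_space_torus_sample)
    then have eq: "emeasure (tori D ({1..q} \<union> {q+1..n})) (?E n)
        = ennreal (\<P>(X in torus_sample D n. models (torus_graph D n r X) (\<lambda>a. a) (Theta D q)))"
      unfolding ev unfolding sample .
    have ?lower using c(2)[OF n] unfolding eq by (subst (asm) ennreal_le_iff) auto
    moreover have "\<P>(X in torus_sample D n. models (torus_graph D n r X) (\<lambda>a. a) (Theta D q)) \<le> C / real n"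
      using C(2)[OF n] C(1) unfolding eq by (subst (asm) ennreal_le_iff) auto
    moreover have "C / real n \<le> (C + c) / real n" using c(1) by (intro divide_right_mono) auto
    ultimately show ?thesis by linarith
  qed
  then show ?thesis
    using c(1) C(1)
    by (intro exI[of _ c] exI[of _ "C + c"] conjI eventually_sequentiallyI[of "2 * (q + M_dim D)"]) auto
qed

end
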